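(* Let $L = L_{\overline{0}} \oplus L_{\overline{1}}$ be a restricted Lie superalgebra over a field $k$ of characteristic $2$, with quadratic operator $q : L_{\overline{1}} \to L_{\overline{0}}$ and with $2$-operation $x \mapsto x^{[2]}$ on $L_{\overline{0}}$. Let $\overline{L}$ be the ordinary Lie algebra over $k$ obtained from $L$ by forgetting the quadratic operator $q$. For $z \in L$, write $z = z_{\overline{0}} + z_{\overline{1}}$ with $z_{\overline{0}} \in L_{\overline{0}}$ and $z_{\overline{1}} \in L_{\overline{1}}$. Then the map $$z \mapsto z^{\{2\}} := (z_{\overline{0}})^{[2]} + q(z_{\overline{1}}) + [z_{\overline{1}}, z_{\overline{0}}]$$ defines a $2$-operation on $\overline{L}$ that makes $\overline{L}$ into a restricted $\mathbb{Z}/2\mathbb{Z}$-graded Lie algebra over $k$. Moreover, the canonical quotient map $U(\overline{L}) \twoheadrightarrow U(L)$ induces an isomorphism of Hopf (super)algebras $V(\overline{L}) \cong V(L)$.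
   Context: Let $k$ be a field of characteristic $2$. A Lie superalgebra over $k$ is a $\mathbb{Z}/2\mathbb{Z}$-graded $k$-vector space $L = L_{\overline{0}} \oplus L_{\overline{1}}$ with a degree-preserving bilinear bracket $[\,,\,] : L \otimes L \to L$ and a quadratic operator $q : L_{\overline{1}} \to L_{\overline{0}}$ (in particular $q(\alpha y) = \alpha^2 q(y)$ for $\alpha \in k$) such that: $[x,y] = [y,x]$ for homogeneous $x,y$ (signs are irrelevant in characteristic $2$); $[x,[y,z]] = [[x,y],z] + [y,[x,z]]$; $[x,x]=0$ for $x \in L_{\overline{0}}$; $[y,[y,y]]=0$ for $y \in L_{\overline{1}}$; $[x,y] = q(x+y)-q(x)-q(y)$ for $x,y \in L_{\overline{1}}$; $[y,[y,z]] = [q(y),z]$ for $y \in L_{\overline{1}}$, $z \in L$. It follows that $[y,y] = 2q(y) = 0$ for $y \in L_{\overline{1}}$, so the bracket makes $L$ into an ordinary Lie algebra $\overline{L}$. A $2$-operation (or $p$-operation, $p=2$) on a Lie algebra $\mathfrak{g}$ over $k$ is a map $x \mapsto x^{[2]}$ on $\mathfrak{g}$ with $(\alpha x)^{[2]} = \alpha^2 x^{[2]}$ for $\alpha \in k$, $\operatorname{ad}(x^{[2]}) = \operatorname{ad}(x)^2$, and $(x+y)^{[2]} = x^{[2]} + y^{[2]} + [y,x]$. A restricted Lie superalgebra is a Lie superalgebra $L$ with a map $x \mapsto x^{[2]}$ on $L_{\overline{0}}$ satisfying these identities for $x,y\in L_{\overline 0}$, where $\operatorname{ad}(x^{[2]})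 = \operatorname{ad}(x)^2$ is required to hold on all of $L$. A restricted $\mathbb{Z}/2\mathbb{Z}$-graded Lie algebra is a restricted Lie algebra with a $\mathbb{Z}/2\mathbb{Z}$-grading $\mathfrak{g}=\mathfrak{g}_{\overline 0}\oplus \mathfrak{g}_{\overline 1}$ such that $[\mathfrak{g}_i,\mathfrak{g}_j]\subseteq \mathfrak{g}_{i+j}$ and $(\mathfrak{g}_i)^{[2]} \subseteq \mathfrak{g}_{2i} = \mathfrak{g}_{\overline{0}}$. Enveloping algebras: $U(L)$ is the quotient of the tensor algebra $T(L)$ by the ideal generated by $x \otimes y - y \otimes x - [x,y]$ ($x,y \in L$ homogeneous) and $y \otimes y - q(y)$ ($y \in L_{\overline{1}}$); $V(L) = U(L)/\langle x^2 - x^{[2]} : x \in L_{\overline{0}}\rangle$. $U(\overline{L})$ is the ordinary universal enveloping algebra of $\overline{L}$, so that $U(L) = U(\overline{L})/\langle y^2 - q(y) : y \in L_{\overline{1}} \rangle$, and $V(\overline{L}) = U(\overline{L})/\langle z^2 - z^{\{2\}} : z \in \overline{L} \rangle$ is the ordinary restricted enveloping algebra. All are Hopf algebras in which the elements of $L$ are primitive; in characteristic $2$ a Hopf superalgebra is a Hopf algebra with a compatible $\mathbb{Z}/2\mathbb{Z}$-grading. *)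

theory Defs
  imports
    Complex_Main
    "HOL-Library.Poly_Mapping"
    "HOL-Library.FuncSet"
    "HOL-Library.Z2"
    "HOL-Algebra.Module"
    "HOL-Algebra.QuotRing"
begin

section \<open>Lie algebras and Lie superalgebras in characteristic 2\<close>

text \<open>
  The locales below are meant for a field of characteristic 2; that assumption is made
  where they are used. A \<open>\<int>/2\<close>-grading is a family of subspaces indexed by \<^typ>\<open>bit\<close>.
\<close>

locale graded_vector_space = vector_space scale
  for scale :: "'k::field \<Rightarrow> 'v::ab_group_add \<Rightarrow> 'v" +
  fixes gr :: "bit \<Rightarrow> 'v set"
  assumes gr_subspace: "subspace (gr i)"
    and gr_direct_sum: "\<exists>!f. (\<forall>i. f i \<in> gr i) \<and> z = f 0 + f 1"

definition hcomp :: "(bit \<Rightarrow> 'v::ab_group_add set) \<Rightarrow> 'v \<Rightarrow> bit \<Rightarrow> 'v" where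
  "hcomp gr z = (THE f. (\<forall>i. f i \<in> gr i) \<and> z = f 0 + f 1)"

locale lie_superalgebra = graded_vector_space scale gr
  for scale :: "'k::field \<Rightarrow> 'v::ab_group_add \<Rightarrow> 'v" and gr +
  fixes br :: "'v \<Rightarrow> 'v \<Rightarrow> 'v" and q :: "'v \<Rightarrow> 'v"
  assumes br_linear_left: "Vector_Spaces.linear scale scale (\<lambda>x. br x y)"
    and br_linear_right: "Vector_Spaces.linear scale scale (br x)"
    and br_graded: "x \<in> gr i \<Longrightarrow> y \<in> gr j \<Longrightarrow> br x y \<in> gr (i + j)"
    and br_sym: "x \<in> gr i \<Longrightarrow> y \<in> gr j \<Longrightarrow> br x y = br y x"
    and br_jacobi: "br x (br y z) = br (br x y) z + br y (br x z)"
    and br_even_self: "x \<in> gr 0 \<Longrightarrow> br x x = 0"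
    and br_odd_cube: "y \<in> gr 1 \<Longrightarrow> br y (br y y) = 0"
    and q_even: "y \<in> gr 1 \<Longrightarrow> q y \<in> gr 0"
    and q_scale: "y \<in> gr 1 \<Longrightarrow> q (scale c y) = scale (c\<^sup>2) (q y)"
    and q_polar: "x \<in> gr 1 \<Longrightarrow> y \<in> gr 1 \<Longrightarrow> br x y = q (x + y) - q x - q y"
    and q_ad: "y \<in> gr 1 \<Longrightarrow> br y (br y z) = br (q y) z"

text \<open>The operators \<open>q\<close> and \<open>p\<close> are total functions, constrained only on the odd and
  the even part, respectively.\<close>

locale restricted_lie_superalgebra = lie_superalgebra scale gr br q
  for scale :: "'k::field \<Rightarrow> 'v::ab_group_add \<Rightarrow> 'v" and gr br q +
  fixes p :: "'v \<Rightarrow> 'v"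
  assumes p_even: "x \<in> gr 0 \<Longrightarrow> p x \<in> gr 0"
    and p_scale: "x \<in> gr 0 \<Longrightarrow> p (scale c x) = scale (c\<^sup>2) (p x)"
    and p_ad: "x \<in> gr 0 \<Longrightarrow> br (p x) z = br x (br x z)"
    and p_add: "x \<in> gr 0 \<Longrightarrow> y \<in> gr 0 \<Longrightarrow> p (x + y) = p x + p y + br y x"

locale lie_algebra = vector_space scale
  for scale :: "'k::field \<Rightarrow> 'v::ab_group_add \<Rightarrow> 'v" +
  fixes br :: "'v \<Rightarrow> 'v \<Rightarrow> 'v"
  assumes br_linear_left: "Vector_Spaces.linear scale scale (\<lambda>x. br x y)"
    and br_linear_right: "Vector_Spaces.linear scale scale (br x)"
    and br_self: "br x x = 0"
    and br_jacobi: "br x (br y z) = br (br x y) z + br y (br x z)"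

locale restricted_lie_algebra = lie_algebra scale br
  for scale :: "'k::field \<Rightarrow> 'v::ab_group_add \<Rightarrow> 'v" and br +
  fixes p :: "'v \<Rightarrow> 'v"
  assumes p_scale: "p (scale c x) = scale (c\<^sup>2) (p x)"
    and p_ad: "br (p x) z = br x (br x z)"
    and p_add: "p (x + y) = p x + p y + br y x"

locale restricted_graded_lie_algebra =
  graded_vector_space scale gr + restricted_lie_algebra scale br p
  for scale :: "'k::field \<Rightarrow> 'v::ab_group_add \<Rightarrow> 'v" and gr br p +
  assumes br_graded: "x \<in> gr i \<Longrightarrow> y \<in> gr j \<Longrightarrow> br x y \<in> gr (i + j)"
    and p_graded: "x \<in> gr i \<Longrightarrow> p x \<in> gr (i + i)"

definition forget_p ::
  "(bit \<Rightarrow> 'v::ab_group_add set) \<Rightarrow> ('v \<Rightarrow> 'v \<Rightarrow> 'v) \<Rightarrow> ('v \<Rightarrow> 'v) \<Rightarrow> ('v \<Rightarrow> 'v) \<Rightarrow> 'v \<Rightarrow> 'v" where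
  "forget_p gr br q p z =
     p (hcomp gr z 0) + q (hcomp gr z 1) + br (hcomp gr z 1) (hcomp gr z 0)"


section \<open>Associative algebras over a field\<close>

definition type_ring :: "'a::ring_1 ring" where
  "type_ring = \<lparr>carrier = UNIV, monoid.mult = (*), one = 1, zero = 0, add = (+)\<rparr>"

text \<open>The carrier-based \<^locale>\<open>algebra\<close> of HOL-Algebra is commutative.\<close>

locale assoc_algebra = ring A + Module.module "type_ring :: 'k ring" A
  for A :: "('k::field, 'a, 'm) module_scheme" (structure) +
  assumes smult_mult_left:
      "x \<in> carrier A \<Longrightarrow> y \<in> carrier A \<Longrightarrow> (c \<odot> x) \<otimes> y = c \<odot> (x \<otimes> y)"
    and smult_mult_right:
      "x \<in> carrier A \<Longrightarrow> y \<in> carrier A \<Longrightarrow> x \<otimes> (c \<odot> y) = c \<odot> (x \<otimes> y)"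

definition alg_hom ::
  "('k, 'a, 'm) module_scheme \<Rightarrow> ('k, 'b, 'n) module_scheme \<Rightarrow> ('a \<Rightarrow> 'b) set" where
  "alg_hom A B = {h \<in> ring_hom A B. \<forall>c. \<forall>x\<in>carrier A. h (c \<odot>\<^bsub>A\<^esub> x) = c \<odot>\<^bsub>B\<^esub> h x}"

definition ground_algebra :: "('k::field, 'k) module" where
  "ground_algebra = \<lparr>carrier = UNIV, monoid.mult = (*), one = 1, zero = 0, add = (+), smult = (*)\<rparr>"

definition opposite_algebra :: "('k, 'a, 'm) module_scheme \<Rightarrow> ('k, 'a, 'm) module_scheme" where
  "opposite_algebra A = A\<lparr>monoid.mult := (\<lambda>x y. y \<otimes>\<^bsub>A\<^esub> x)\<rparr>"

definition quotient_algebra ::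
  "('k, 'a, 'm) module_scheme \<Rightarrow> 'a set \<Rightarrow> ('k, 'a set) module" where
  "quotient_algebra A I =
     \<lparr>carrier = carrier (A Quot I), monoid.mult = monoid.mult (A Quot I), one = one (A Quot I),
      zero = zero (A Quot I), add = add (A Quot I),
      smult = (\<lambda>c X. \<Union>x\<in>X. I +>\<^bsub>A\<^esub> (c \<odot>\<^bsub>A\<^esub> x))\<rparr>"

definition linear_span :: "('k::field, 'a, 'm) module_scheme \<Rightarrow> 'a set \<Rightarrow> 'a set" where
  "linear_span M S = (\<lambda>H. submodule H (type_ring :: 'k ring) M) hull S"


section \<open>Tensor products of algebras\<close>

text \<open>The tensor product \<open>A \<otimes> B\<close> is the free vector space on
  \<^term>\<open>carrier A \<times> carrier B\<close> modulo the bilinearity relations. The multiplication carries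
  no sign: this is also the super tensor product in characteristic 2.\<close>

definition pm_scale :: "'k::field \<Rightarrow> ('s \<Rightarrow>\<^sub>0 'k) \<Rightarrow> ('s \<Rightarrow>\<^sub>0 'k)" where
  "pm_scale c t = Poly_Mapping.map ((*) c) t"

definition tensor_relations ::
  "('k::field, 'a, 'm) module_scheme \<Rightarrow> ('k, 'b, 'n) module_scheme \<Rightarrow> ('a \<times> 'b \<Rightarrow>\<^sub>0 'k) set" where
  "tensor_relations A B =
     {Poly_Mapping.single (a \<oplus>\<^bsub>A\<^esub> a', b) 1 - Poly_Mapping.single (a, b) 1
        - Poly_Mapping.single (a', b) 1 | a a' b.
        a \<in> carrier A \<and> a' \<in> carrier A \<and> b \<in> carrier B} \<union>
     {Poly_Mapping.single (a, b \<oplus>\<^bsub>B\<^esub> b') 1 - Poly_Mapping.single (a, b) 1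
        - Poly_Mapping.single (a, b') 1 | a b b'.
        a \<in> carrier A \<and> b \<in> carrier B \<and> b' \<in> carrier B} \<union>
     {Poly_Mapping.single (c \<odot>\<^bsub>A\<^esub> a, b) 1 - Poly_Mapping.single (a, b) c | c a b.
        a \<in> carrier A \<and> b \<in> carrier B} \<union>
     {Poly_Mapping.single (a, c \<odot>\<^bsub>B\<^esub> b) 1 - Poly_Mapping.single (a, b) c | c a b.
        a \<in> carrier A \<and> b \<in> carrier B}"

definition tensor_class ::
  "('k::field, 'a, 'm) module_scheme \<Rightarrow> ('k, 'b, 'n) module_scheme \<Rightarrow>
   ('a \<times> 'b \<Rightarrow>\<^sub>0 'k) \<Rightarrow> ('a \<times> 'b \<Rightarrow>\<^sub>0 'k) set" where
  "tensor_class A B t = {s. s - t \<in> Modules.module.span pm_scale (tensor_relations A B)}"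

definition pure_tensor ::
  "('k::field, 'a, 'm) module_scheme \<Rightarrow> ('k, 'b, 'n) module_scheme \<Rightarrow>
   'a \<Rightarrow> 'b \<Rightarrow> ('a \<times> 'b \<Rightarrow>\<^sub>0 'k) set" where
  "pure_tensor A B a b = tensor_class A B (Poly_Mapping.single (a, b) 1)"

definition tensor_algebra_prod ::
  "('k::field, 'a, 'm) module_scheme \<Rightarrow> ('k, 'b, 'n) module_scheme \<Rightarrow>
   ('k, ('a \<times> 'b \<Rightarrow>\<^sub>0 'k) set) module" where
  "tensor_algebra_prod A B =
     \<lparr>carrier = tensor_class A B ` {t. Poly_Mapping.keys t \<subseteq> carrier A \<times> carrier B},
      monoid.mult = (\<lambda>X Y. \<Union>s\<in>X. \<Union>t\<in>Y. tensor_class A B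
        (\<Sum>(a, b)\<in>Poly_Mapping.keys s. \<Sum>(a', b')\<in>Poly_Mapping.keys t.
           Poly_Mapping.single (a \<otimes>\<^bsub>A\<^esub> a', b \<otimes>\<^bsub>B\<^esub> b')
             (Poly_Mapping.lookup s (a, b) * Poly_Mapping.lookup t (a', b')))),
      one = pure_tensor A B \<one>\<^bsub>A\<^esub> \<one>\<^bsub>B\<^esub>,
      zero = tensor_class A B 0,
      add = (\<lambda>X Y. \<Union>s\<in>X. \<Union>t\<in>Y. tensor_class A B (s + t)),
      smult = (\<lambda>c X. \<Union>t\<in>X. tensor_class A B (pm_scale c t))\<rparr>"

text \<open>The linear map out of a tensor product induced by a bilinear map \<open>\<beta>\<close> with
  values in \<open>M\<close>; if \<open>\<beta>\<close> is bilinear, the argument of \<^const>\<open>the_elem\<close> is a singleton.\<close>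

definition tensor_lift ::
  "('k::field, 'm, 'z) module_scheme \<Rightarrow> ('a \<Rightarrow> 'b \<Rightarrow> 'm) \<Rightarrow> ('a \<times> 'b \<Rightarrow>\<^sub>0 'k) set \<Rightarrow> 'm" where
  "tensor_lift M \<beta> X = the_elem
     ((\<lambda>t. finsum M (\<lambda>(a, b). Poly_Mapping.lookup t (a, b) \<odot>\<^bsub>M\<^esub> \<beta> a b)
             (Poly_Mapping.keys t)) ` X)"

definition tensor_map ::
  "('k::field, 'c, 'm) module_scheme \<Rightarrow> ('k, 'd, 'n) module_scheme \<Rightarrow>
   ('a \<Rightarrow> 'c) \<Rightarrow> ('b \<Rightarrow> 'd) \<Rightarrow> ('a \<times> 'b \<Rightarrow>\<^sub>0 'k) set \<Rightarrow> ('c \<times> 'd \<Rightarrow>\<^sub>0 'k) set" where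
  "tensor_map C D f g =
     tensor_lift (tensor_algebra_prod C D) (\<lambda>a b. pure_tensor C D (f a) (g b))"

definition tensor_assoc ::
  "('k::field, 'a, 'l) module_scheme \<Rightarrow> ('k, 'b, 'm) module_scheme \<Rightarrow> ('k, 'c, 'n) module_scheme \<Rightarrow>
   (('a \<times> 'b \<Rightarrow>\<^sub>0 'k) set \<times> 'c \<Rightarrow>\<^sub>0 'k) set \<Rightarrow> ('a \<times> ('b \<times> 'c \<Rightarrow>\<^sub>0 'k) set \<Rightarrow>\<^sub>0 'k) set" where
  "tensor_assoc A B C =
     (let BC = tensor_algebra_prod B C; ABC = tensor_algebra_prod A BC in
      tensor_lift ABC (\<lambda>x c.
        tensor_lift ABC (\<lambda>a b. pure_tensor A BC a (pure_tensor B C b c)) x))"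


section \<open>Hopf superalgebras in characteristic 2\<close>

record (overloaded) ('k, 'a) hopf = "('k, 'a) module" +
  comult :: "'a \<Rightarrow> ('a \<times> 'a \<Rightarrow>\<^sub>0 'k) set"
  counit :: "'a \<Rightarrow> 'k"
  antipode :: "'a \<Rightarrow> 'a"
  grade :: "bit \<Rightarrow> 'a set"

locale hopf_superalgebra = assoc_algebra H
  for H :: "('k::field, 'a) hopf" (structure) +
  assumes comult_hom: "comult H \<in> alg_hom H (tensor_algebra_prod H H)"
    and counit_hom: "counit H \<in> alg_hom H ground_algebra"
    and coassoc: "x \<in> carrier H \<Longrightarrow>
      tensor_assoc H H H (tensor_map (tensor_algebra_prod H H) H (comult H) id (comult H x)) =
      tensor_map H (tensor_algebra_prod H H) id (comult H) (comult H x)"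
    and counit_left: "x \<in> carrier H \<Longrightarrow>
      tensor_lift H (\<lambda>a b. counit H a \<odot> b) (comult H x) = x"
    and counit_right: "x \<in> carrier H \<Longrightarrow>
      tensor_lift H (\<lambda>a b. counit H b \<odot> a) (comult H x) = x"
    and antipode_closed: "x \<in> carrier H \<Longrightarrow> antipode H x \<in> carrier H"
    and antipode_add: "x \<in> carrier H \<Longrightarrow> y \<in> carrier H \<Longrightarrow>
      antipode H (x \<oplus> y) = antipode H x \<oplus> antipode H y"
    and antipode_smult: "x \<in> carrier H \<Longrightarrow> antipode H (c \<odot> x) = c \<odot> antipode H x"
    and antipode_left: "x \<in> carrier H \<Longrightarrow>
      tensor_lift H (\<lambda>a b. antipode H a \<otimes> b) (comult H x) = counit H x \<odot> \<one>"
    and antipode_right: "x \<in> carrier H \<Longrightarrow>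
      tensor_lift H (\<lambda>a b. a \<otimes> antipode H b) (comult H x) = counit H x \<odot> \<one>"
    and grade_submodule: "submodule (grade H i) (type_ring :: 'k ring) H"
    and grade_direct_sum: "x \<in> carrier H \<Longrightarrow> \<exists>!f. (\<forall>i. f i \<in> grade H i) \<and> x = f 0 \<oplus> f 1"
    and grade_one: "\<one> \<in> grade H 0"
    and grade_mult: "x \<in> grade H i \<Longrightarrow> y \<in> grade H j \<Longrightarrow> x \<otimes> y \<in> grade H (i + j)"
    and grade_comult: "x \<in> grade H i \<Longrightarrow> comult H x \<in> linear_span (tensor_algebra_prod H H)
      {pure_tensor H H a b | a b j l. a \<in> grade H j \<and> b \<in> grade H l \<and> j + l = i}"
    and grade_counit: "x \<in> grade H 1 \<Longrightarrow> counit H x = 0"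
    and grade_antipode: "x \<in> grade H i \<Longrightarrow> antipode H x \<in> grade H i"

definition hopf_superalgebra_hom ::
  "('k::field, 'a) hopf \<Rightarrow> ('k, 'b) hopf \<Rightarrow> ('a \<Rightarrow> 'b) set" where
  "hopf_superalgebra_hom H K = {h \<in> alg_hom H K.
     (\<forall>x\<in>carrier H. tensor_map K K h h (comult H x) = comult K (h x)) \<and>
     (\<forall>x\<in>carrier H. counit K (h x) = counit H x) \<and>
     (\<forall>x\<in>carrier H. h (antipode H x) = antipode K (h x)) \<and>
     (\<forall>i. h ` grade H i \<subseteq> grade K i)}"

definition hopf_superalgebra_iso ::
  "('k::field, 'a) hopf \<Rightarrow> ('k, 'b) hopf \<Rightarrow> ('a \<Rightarrow> 'b) set" where
  "hopf_superalgebra_iso H K = {h \<in> hopf_superalgebra_hom H K.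
     hopf_superalgebra H \<and> hopf_superalgebra K \<and> bij_betw h (carrier H) (carrier K)}"

text \<open>For an algebra \<open>A\<close> generated by the image of a linear map \<open>\<iota>\<close> from a graded space:
  the Hopf superalgebra structure in which the elements \<open>\<iota> x\<close> are primitive. Comultiplication
  and counit are the algebra homomorphisms and the antipode is the antihomomorphism determined by
  \<open>x \<mapsto> x \<otimes> 1 + 1 \<otimes> x\<close>, \<open>x \<mapsto> 0\<close>, \<open>x \<mapsto> - x\<close>. The homogeneous parts are spanned
  by the products of homogeneous elements of total degree \<open>i\<close>. Restricting to
  \<^const>\<open>extensional\<close> functions makes the descriptions unique.\<close>

definition primitive_hopf ::
  "('k::field, 'a) module \<Rightarrow> ('v \<Rightarrow> 'a) \<Rightarrow> (bit \<Rightarrow> 'v set) \<Rightarrow> ('k, 'a) hopf" where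
  "primitive_hopf A \<iota> gr =
     \<lparr>carrier = carrier A, monoid.mult = monoid.mult A, one = one A, zero = zero A, add = add A,
      smult = smult A,
      comult = (THE D. D \<in> extensional (carrier A) \<and> D \<in> alg_hom A (tensor_algebra_prod A A) \<and>
        (\<forall>x. D (\<iota> x) =
           pure_tensor A A (\<iota> x) \<one>\<^bsub>A\<^esub> \<oplus>\<^bsub>tensor_algebra_prod A A\<^esub> pure_tensor A A \<one>\<^bsub>A\<^esub> (\<iota> x))),
      counit = (THE e. e \<in> extensional (carrier A) \<and> e \<in> alg_hom A ground_algebra \<and>
        (\<forall>x. e (\<iota> x) = 0)),
      antipode = (THE s. s \<in> extensional (carrier A) \<and> s \<in> alg_hom A (opposite_algebra A) \<and>
        (\<forall>x. s (\<iota> x) = \<ominus>\<^bsub>A\<^esub> \<iota> x)),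
      grade = (\<lambda>i. linear_span A
        {foldr (mult A) (map \<iota> xs) \<one>\<^bsub>A\<^esub> | xs ds.
           list_all2 (\<lambda>x d. x \<in> gr d) xs ds \<and> sum_list ds = i})\<rparr>"


section \<open>Enveloping algebras\<close>

datatype 'v tword = TWord (letters: "'v list")

text \<open>Words in the letters \<^typ>\<open>'v\<close>, written additively, so that \<^typ>\<open>'v tword \<Rightarrow>\<^sub>0 'k\<close> with
  its convolution product is the free associative algebra on the set \<^typ>\<open>'v\<close>.\<close>

instantiation tword :: (type) monoid_add
begin

definition zero_tword :: "'v tword" where
  "zero_tword = TWord []"

definition plus_tword :: "'v tword \<Rightarrow> 'v tword \<Rightarrow> 'v tword" where
  "plus_tword u w = TWord (letters u @ letters w)"

instance
  by standard (simp_all add: zero_tword_def plus_tword_def)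

end

definition free_algebra :: "('k::field, 'v tword \<Rightarrow>\<^sub>0 'k) module" where
  "free_algebra = \<lparr>carrier = UNIV, monoid.mult = (*), one = 1, zero = 0, add = (+), smult = pm_scale\<rparr>"

definition letter :: "'v \<Rightarrow> ('v tword \<Rightarrow>\<^sub>0 'k::field)" where
  "letter x = Poly_Mapping.single (TWord [x]) 1"

text \<open>The two-sided ideal below is spanned by the multilinearity relations in every position of
  every word, so that the quotient is the tensor algebra \<open>T(L) = \<Oplus>\<^sub>n L\<^sup>\<otimes>\<^sup>n\<close>.\<close>

definition tensor_ideal ::
  "('k::field \<Rightarrow> 'v::ab_group_add \<Rightarrow> 'v) \<Rightarrow> ('v tword \<Rightarrow>\<^sub>0 'k) set" where
  "tensor_ideal scale = Idl\<^bsub>free_algebra\<^esub>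
     ({letter (x + y) - letter x - letter y | x y. True} \<union>
      {letter (scale c x) - pm_scale c (letter x) | c x. True})"

definition tensor_algebra ::
  "('k::field \<Rightarrow> 'v::ab_group_add \<Rightarrow> 'v) \<Rightarrow> ('k, ('v tword \<Rightarrow>\<^sub>0 'k) set) module" where
  "tensor_algebra scale = quotient_algebra free_algebra (tensor_ideal scale)"

definition tensor_incl ::
  "('k::field \<Rightarrow> 'v::ab_group_add \<Rightarrow> 'v) \<Rightarrow> 'v \<Rightarrow> ('v tword \<Rightarrow>\<^sub>0 'k) set" where
  "tensor_incl scale x = tensor_ideal scale +>\<^bsub>free_algebra\<^esub> letter x"

definition commutator_relation ::
  "('k::field \<Rightarrow> 'v::ab_group_add \<Rightarrow> 'v) \<Rightarrow> ('v \<Rightarrow> 'v \<Rightarrow> 'v) \<Rightarrow> 'v \<Rightarrow> 'v \<Rightarrow>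
   ('v tword \<Rightarrow>\<^sub>0 'k) set" where
  "commutator_relation scale br x y =
     (let T = tensor_algebra scale; j = tensor_incl scale in
      (j x \<otimes>\<^bsub>T\<^esub> j y) \<ominus>\<^bsub>T\<^esub> (j y \<otimes>\<^bsub>T\<^esub> j x) \<ominus>\<^bsub>T\<^esub> j (br x y))"

definition square_relation ::
  "('k, 'a, 'm) module_scheme \<Rightarrow> ('v \<Rightarrow> 'a) \<Rightarrow> ('v \<Rightarrow> 'v) \<Rightarrow> 'v \<Rightarrow> 'a" where
  "square_relation A j s x = (j x \<otimes>\<^bsub>A\<^esub> j x) \<ominus>\<^bsub>A\<^esub> j (s x)"

subsection \<open>Ordinary Lie algebras: \<open>U(g)\<close> and \<open>V(g)\<close>\<close>

definition lie_ideal ::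
  "('k::field \<Rightarrow> 'v::ab_group_add \<Rightarrow> 'v) \<Rightarrow> ('v \<Rightarrow> 'v \<Rightarrow> 'v) \<Rightarrow> ('v tword \<Rightarrow>\<^sub>0 'k) set set" where
  "lie_ideal scale br =
     Idl\<^bsub>tensor_algebra scale\<^esub> {commutator_relation scale br x y | x y. True}"

definition lie_U ::
  "('k::field \<Rightarrow> 'v::ab_group_add \<Rightarrow> 'v) \<Rightarrow> ('v \<Rightarrow> 'v \<Rightarrow> 'v) \<Rightarrow>
   ('k, ('v tword \<Rightarrow>\<^sub>0 'k) set set) module" where
  "lie_U scale br = quotient_algebra (tensor_algebra scale) (lie_ideal scale br)"

definition lie_U_incl ::
  "('k::field \<Rightarrow> 'v::ab_group_add \<Rightarrow> 'v) \<Rightarrow> ('v \<Rightarrow> 'v \<Rightarrow> 'v) \<Rightarrow> 'v \<Rightarrow>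
   ('v tword \<Rightarrow>\<^sub>0 'k) set set" where
  "lie_U_incl scale br x = lie_ideal scale br +>\<^bsub>tensor_algebra scale\<^esub> tensor_incl scale x"

definition lie_V_ideal ::
  "('k::field \<Rightarrow> 'v::ab_group_add \<Rightarrow> 'v) \<Rightarrow> ('v \<Rightarrow> 'v \<Rightarrow> 'v) \<Rightarrow> ('v \<Rightarrow> 'v) \<Rightarrow>
   ('v tword \<Rightarrow>\<^sub>0 'k) set set set" where
  "lie_V_ideal scale br p =
     Idl\<^bsub>lie_U scale br\<^esub> {square_relation (lie_U scale br) (lie_U_incl scale br) p z | z. True}"

definition lie_V ::
  "('k::field \<Rightarrow> 'v::ab_group_add \<Rightarrow> 'v) \<Rightarrow> (bit \<Rightarrow> 'v set) \<Rightarrow> ('v \<Rightarrow> 'v \<Rightarrow> 'v) \<Rightarrow> ('v \<Rightarrow> 'v) \<Rightarrow>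
   ('k, ('v tword \<Rightarrow>\<^sub>0 'k) set set set) hopf" where
  "lie_V scale gr br p =
     primitive_hopf (quotient_algebra (lie_U scale br) (lie_V_ideal scale br p))
       (\<lambda>x. lie_V_ideal scale br p +>\<^bsub>lie_U scale br\<^esub> lie_U_incl scale br x) gr"

subsection \<open>Lie superalgebras: \<open>U(L)\<close> and \<open>V(L)\<close>\<close>

definition super_ideal ::
  "('k::field \<Rightarrow> 'v::ab_group_add \<Rightarrow> 'v) \<Rightarrow> (bit \<Rightarrow> 'v set) \<Rightarrow> ('v \<Rightarrow> 'v \<Rightarrow> 'v) \<Rightarrow> ('v \<Rightarrow> 'v) \<Rightarrow>
   ('v tword \<Rightarrow>\<^sub>0 'k) set set" where
  "super_ideal scale gr br q = Idl\<^bsub>tensor_algebra scale\<^esub>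
     ({commutator_relation scale br x y | x y i j. x \<in> gr i \<and> y \<in> gr j} \<union>
      {square_relation (tensor_algebra scale) (tensor_incl scale) q y | y. y \<in> gr 1})"

definition super_U ::
  "('k::field \<Rightarrow> 'v::ab_group_add \<Rightarrow> 'v) \<Rightarrow> (bit \<Rightarrow> 'v set) \<Rightarrow> ('v \<Rightarrow> 'v \<Rightarrow> 'v) \<Rightarrow> ('v \<Rightarrow> 'v) \<Rightarrow>
   ('k, ('v tword \<Rightarrow>\<^sub>0 'k) set set) module" where
  "super_U scale gr br q = quotient_algebra (tensor_algebra scale) (super_ideal scale gr br q)"

definition super_U_incl ::
  "('k::field \<Rightarrow> 'v::ab_group_add \<Rightarrow> 'v) \<Rightarrow> (bit \<Rightarrow> 'v set) \<Rightarrow> ('v \<Rightarrow> 'v \<Rightarrow> 'v) \<Rightarrow> ('v \<Rightarrow> 'v) \<Rightarrow>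
   'v \<Rightarrow> ('v tword \<Rightarrow>\<^sub>0 'k) set set" where
  "super_U_incl scale gr br q x =
     super_ideal scale gr br q +>\<^bsub>tensor_algebra scale\<^esub> tensor_incl scale x"

definition super_V_ideal ::
  "('k::field \<Rightarrow> 'v::ab_group_add \<Rightarrow> 'v) \<Rightarrow> (bit \<Rightarrow> 'v set) \<Rightarrow> ('v \<Rightarrow> 'v \<Rightarrow> 'v) \<Rightarrow> ('v \<Rightarrow> 'v) \<Rightarrow>
   ('v \<Rightarrow> 'v) \<Rightarrow> ('v tword \<Rightarrow>\<^sub>0 'k) set set set" where
  "super_V_ideal scale gr br q p = Idl\<^bsub>super_U scale gr br q\<^esub>
     {square_relation (super_U scale gr br q) (super_U_incl scale gr br q) p x | x. x \<in> gr 0}"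

definition super_V ::
  "('k::field \<Rightarrow> 'v::ab_group_add \<Rightarrow> 'v) \<Rightarrow> (bit \<Rightarrow> 'v set) \<Rightarrow> ('v \<Rightarrow> 'v \<Rightarrow> 'v) \<Rightarrow> ('v \<Rightarrow> 'v) \<Rightarrow>
   ('v \<Rightarrow> 'v) \<Rightarrow> ('k, ('v tword \<Rightarrow>\<^sub>0 'k) set set set) hopf" where
  "super_V scale gr br q p =
     primitive_hopf (quotient_algebra (super_U scale gr br q) (super_V_ideal scale gr br q p))
       (\<lambda>x. super_V_ideal scale gr br q p +>\<^bsub>super_U scale gr br q\<^esub> super_U_incl scale gr br q x) gr"

text \<open>The canonical map from \<open>U\<close> of the underlying Lie algebra to \<open>U(L)\<close>, both being
  quotients of \<open>T(L)\<close>: the class of \<open>t\<close> goes to the class of \<open>t\<close>.\<close>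

definition U_proj ::
  "('k::field \<Rightarrow> 'v::ab_group_add \<Rightarrow> 'v) \<Rightarrow> (bit \<Rightarrow> 'v set) \<Rightarrow> ('v \<Rightarrow> 'v \<Rightarrow> 'v) \<Rightarrow> ('v \<Rightarrow> 'v) \<Rightarrow>
   ('v tword \<Rightarrow>\<^sub>0 'k) set set \<Rightarrow> ('v tword \<Rightarrow>\<^sub>0 'k) set set" where
  "U_proj scale gr br q X =
     the_elem ((\<lambda>t. super_ideal scale gr br q +>\<^bsub>tensor_algebra scale\<^esub> t) ` X)"

end

theory Submission
  imports Defs
begin

text \<open>
  In characteristic 2 an element \<open>z = z\<^sub>0 + z\<^sub>1\<close> of an associative algebra satisfies
  \<open>z\<^sup>2 = z\<^sub>0\<^sup>2 + z\<^sub>1\<^sup>2 + [z\<^sub>1, z\<^sub>0]\<close>. In \<open>V(L)\<close> the right hand side is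
  \<open>p z\<^sub>0 + q z\<^sub>1 + [z\<^sub>1, z\<^sub>0]\<close>, and this is the definition of the 2-operation on the underlying
  Lie algebra. That it is a 2-operation is checked from the axioms for \<open>p\<close> and \<open>q\<close>; the mixed terms
  appear twice and cancel. Conversely, it restricts to \<open>p\<close> on the even part and to \<open>q\<close> on the odd
  part. Hence requiring that the 2-operation is squaring, for all \<open>z\<close>, amounts to \<open>x\<^sup>2 = p x\<close> for even
  \<open>x\<close> and \<open>y\<^sup>2 = q y\<close> for odd \<open>y\<close>. In the free algebra on the underlying set of \<open>L\<close> the relations of
  the two restricted enveloping algebras thus generate the same ideal (\<open>Idl_relations_eq\<close>), and the
  isomorphism is the identity on words.

  The remaining work is to see that the Hopf superalgebra structure exists. An algebra generated by
  primitive elements is a Hopf superalgebra as soon as the comultiplication, the counit and the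
  antipode are well defined on it and its grading is direct
  (\<open>primitively_generated.hopf_superalgebra\<close>): the axioms on comultiplication and counit compare
  algebra homomorphisms, which may be done on generators, and those on the antipode and on degrees
  follow by induction on words. The structure maps come from the universal property
  (\<open>enveloping_lift\<close>). So does the grading: an algebra graded by \<open>\<int>/2\<close> is one with a suitable
  homomorphism to its group algebra of \<open>\<int>/2\<close> (\<open>parity_exists\<close>). As the structure maps are determined
  on generators, an algebra isomorphism that matches generators is an isomorphism of Hopf
  superalgebras (\<open>primitively_generated_hom\<close>).

  All of this needs that the tensor product of two algebras is an algebra, and that bilinear maps
  which are multiplicative on pure tensors extend to homomorphisms (\<open>tensor_lift_hom\<close>).
\<close>

section \<open>Associative algebras\<close>

lemma type_ring_simps [simp]:
  "carrier (type_ring :: 'k::field ring) = UNIV"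
  "monoid.mult (type_ring :: 'k::field ring) = (*)"
  "one (type_ring :: 'k::field ring) = 1"
  "zero (type_ring :: 'k::field ring) = 0"
  "add (type_ring :: 'k::field ring) = (+)"
  by (simp_all add: type_ring_def)

lemma cring_type_ring: "cring (type_ring :: 'k::field ring)"
proof (rule cringI)
  show "abelian_group (type_ring :: 'k ring)"
    by (rule abelian_groupI) (auto simp: algebra_simps intro: exI[of _ "- x" for x])
  show "comm_monoid (type_ring :: 'k ring)"
    by (rule comm_monoidI) (auto simp: algebra_simps)
qed (auto simp: algebra_simps)

text \<open>Existence of negatives is replaced by \<open>0 \<odot> x = \<zero>\<close>: the negative of \<open>x\<close> is
  \<open>(- 1) \<odot> x\<close>. This makes every axiom an equation or a closure condition.\<close>

lemma assoc_algebraI: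
  fixes A :: "('k::field, 'a, 'm) module_scheme" (structure)
  assumes closed: "\<And>x y. x \<in> carrier A \<Longrightarrow> y \<in> carrier A \<Longrightarrow> x \<oplus> y \<in> carrier A" "\<zero> \<in> carrier A"
      "\<And>x y. x \<in> carrier A \<Longrightarrow> y \<in> carrier A \<Longrightarrow> x \<otimes> y \<in> carrier A" "\<one> \<in> carrier A"
      "\<And>c x. x \<in> carrier A \<Longrightarrow> c \<odot> x \<in> carrier A"
    and add: "\<And>x y z. x \<in> carrier A \<Longrightarrow> y \<in> carrier A \<Longrightarrow> z \<in> carrier A \<Longrightarrow> (x \<oplus> y) \<oplus> z = x \<oplus> (y \<oplus> z)"
      "\<And>x y. x \<in> carrier A \<Longrightarrow> y \<in> carrier A \<Longrightarrow> x \<oplus> y = y \<oplus> x"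
      "\<And>x. x \<in> carrier A \<Longrightarrow> \<zero> \<oplus> x = x"
    and mult: "\<And>x y z. x \<in> carrier A \<Longrightarrow> y \<in> carrier A \<Longrightarrow> z \<in> carrier A \<Longrightarrow> (x \<otimes> y) \<otimes> z = x \<otimes> (y \<otimes> z)"
      "\<And>x. x \<in> carrier A \<Longrightarrow> \<one> \<otimes> x = x" "\<And>x. x \<in> carrier A \<Longrightarrow> x \<otimes> \<one> = x"
      "\<And>x y z. x \<in> carrier A \<Longrightarrow> y \<in> carrier A \<Longrightarrow> z \<in> carrier A \<Longrightarrow> (x \<oplus> y) \<otimes> z = x \<otimes> z \<oplus> y \<otimes> z"
      "\<And>x y z. x \<in> carrier A \<Longrightarrow> y \<in> carrier A \<Longrightarrow> z \<in> carrier A \<Longrightarrow> z \<otimes> (x \<oplus> y) = z \<otimes> x \<oplus> z \<otimes> y"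
    and smult: "\<And>c d x. x \<in> carrier A \<Longrightarrow> (c + d) \<odot> x = c \<odot> x \<oplus> d \<odot> x"
      "\<And>c x y. x \<in> carrier A \<Longrightarrow> y \<in> carrier A \<Longrightarrow> c \<odot> (x \<oplus> y) = c \<odot> x \<oplus> c \<odot> y"
      "\<And>c d x. x \<in> carrier A \<Longrightarrow> (c * d) \<odot> x = c \<odot> (d \<odot> x)"
      "\<And>x. x \<in> carrier A \<Longrightarrow> 1 \<odot> x = x" "\<And>x. x \<in> carrier A \<Longrightarrow> 0 \<odot> x = \<zero>"
    and smult_mult: "\<And>c x y. x \<in> carrier A \<Longrightarrow> y \<in> carrier A \<Longrightarrow> (c \<odot> x) \<otimes> y = c \<odot> (x \<otimes> y)"
      "\<And>c x y. x \<in> carrier A \<Longrightarrow> y \<in> carrier A \<Longrightarrow> x \<otimes> (c \<odot> y) = c \<odot> (x \<otimes> y)"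
  shows "assoc_algebra A"
proof -
  have grp: "abelian_group A"
  proof (rule abelian_groupI)
    fix x assume x: "x \<in> carrier A"
    have "(- 1) \<odot> x \<oplus> x = (- 1 + 1) \<odot> x"
      using x by (simp only: smult(1) smult(4))
    then have "(- 1) \<odot> x \<oplus> x = \<zero>"
      using x smult(5) by simp
    then show "\<exists>y\<in>carrier A. y \<oplus> x = \<zero>"
      using x closed(5) by blast
  qed (use closed add in auto)
  have rng: "ring A"
    by (rule ringI[OF grp]) (use closed mult in \<open>auto intro!: monoidI\<close>)
  have "Module.module (type_ring :: 'k ring) A"
    by (rule moduleI[OF cring_type_ring grp]) (use closed smult in auto)
  then show ?thesis
    using rng smult_mult by (intro assoc_algebra.intro assoc_algebra_axioms.intro) auto
qed

context assoc_algebra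
begin

text \<open>Facts about the scalar ring and about \<open>A\<close> compete for the same names; the names are
  bound here to the facts about \<open>A\<close>.\<close>

lemma ring: "ring A"
  by (rule assoc_algebra.axioms(1)[OF assoc_algebra_axioms])

lemma additive_group: "abelian_group A"
  by (rule ring.is_abelian_group[OF ring])

lemmas a_closed = ring.ring_simprules(1)[OF ring]
lemmas zero_closed = ring.ring_simprules(2)[OF ring]
lemmas a_assoc = ring.ring_simprules(7)[OF ring]
lemmas l_zero = ring.ring_simprules(8)[OF ring]
lemmas l_neg = ring.ring_simprules(9)[OF ring]
lemmas a_comm = ring.ring_simprules(10)[OF ring]
lemmas m_assoc = ring.ring_simprules(11)[OF ring]
lemmas l_distr = ring.ring_simprules(13)[OF ring]
lemmas r_neg = ring.ring_simprules(16)[OF ring]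
lemmas minus_add = ring.ring_simprules(19)[OF ring]
lemmas a_lcomm = ring.ring_simprules(22)[OF ring]
lemmas r_distr = ring.ring_simprules(23)[OF ring]
lemmas l_null = ring.ring_simprules(24)[OF ring]
lemmas r_null = ring.ring_simprules(25)[OF ring]
lemmas r_one = monoid.r_one[OF ring.is_monoid[OF ring]]
lemmas minus_equality = abelian_group.minus_equality[OF additive_group]
lemmas a_ac = a_assoc a_comm a_lcomm

lemma smult_in [simp, intro]: "x \<in> carrier A \<Longrightarrow> c \<odot> x \<in> carrier A"
  using smult_closed[of c x] by simp

lemma smult_add_left: "x \<in> carrier A \<Longrightarrow> (c + d) \<odot> x = c \<odot> x \<oplus> d \<odot> x"
  using smult_l_distr[of c d x] by simp

lemma smult_add_right:
  "x \<in> carrier A \<Longrightarrow> y \<in> carrier A \<Longrightarrow> c \<odot> (x \<oplus> y) = c \<odot> x \<oplus> c \<odot> y"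
  using smult_r_distr[of c x y] by simp

lemma smult_smult: "x \<in> carrier A \<Longrightarrow> c \<odot> (d \<odot> x) = (c * d) \<odot> x"
  using smult_assoc1[of c d x] by simp

lemma one_smult [simp]: "x \<in> carrier A \<Longrightarrow> 1 \<odot> x = x"
  using smult_one[of x] by simp

lemma zero_smult [simp]: "x \<in> carrier A \<Longrightarrow> 0 \<odot> x = \<zero>"
  using smult_l_null[of x] by simp

lemma smult_zero [simp]: "c \<odot> \<zero> = \<zero>"
  using smult_r_null[of c] by simp

lemma minus_eq_smult: "x \<in> carrier A \<Longrightarrow> \<ominus> x = (- 1) \<odot> x"
proof -
  assume x: "x \<in> carrier A"
  have "(- 1) \<odot> x \<oplus> x = (- 1 + 1) \<odot> x"
    using x by (simp only: smult_add_left one_smult)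
  then have "(- 1) \<odot> x \<oplus> x = \<zero>"
    using x by simp
  then show ?thesis
    using x by (simp add: minus_equality)
qed

lemma diff_self: "x \<in> carrier A \<Longrightarrow> x \<ominus> x = \<zero>"
  by (simp add: a_minus_def r_neg)

lemma add_diff_diff: "x \<in> carrier A \<Longrightarrow> y \<in> carrier A \<Longrightarrow> x \<oplus> y \<ominus> x \<ominus> y = \<zero>"
proof -
  assume "x \<in> carrier A" "y \<in> carrier A"
  then have "x \<oplus> y \<ominus> x \<ominus> y = (x \<oplus> y) \<ominus> (x \<oplus> y)" and "x \<oplus> y \<in> carrier A"
    by (simp_all add: a_minus_def minus_add a_assoc)
  then show ?thesis
    by (simp add: diff_self)
qed

lemma submodule_iff:
  "submodule N (type_ring :: 'k ring) A \<longleftrightarrow> N \<subseteq> carrier A \<and> \<zero> \<in> N \<and>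
     (\<forall>x\<in>N. \<forall>y\<in>N. x \<oplus> y \<in> N) \<and> (\<forall>c. \<forall>x\<in>N. c \<odot> x \<in> N)"
proof
  assume N: "submodule N (type_ring :: 'k ring) A"
  obtain a where "a \<in> N" "a \<in> carrier A"
    using submoduleE(1,2)[OF N] by blast
  then have "\<zero> \<in> N"
    using submoduleE(4)[OF N, of 0 a] by simp
  then show "N \<subseteq> carrier A \<and> \<zero> \<in> N \<and>
     (\<forall>x\<in>N. \<forall>y\<in>N. x \<oplus> y \<in> N) \<and> (\<forall>c. \<forall>x\<in>N. c \<odot> x \<in> N)"
    using submoduleE[OF N] by simp
next
  assume "N \<subseteq> carrier A \<and> \<zero> \<in> N \<and>
     (\<forall>x\<in>N. \<forall>y\<in>N. x \<oplus> y \<in> N) \<and> (\<forall>c. \<forall>x\<in>N. c \<odot> x \<in> N)"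
  then show "submodule N (type_ring :: 'k ring) A"
    by (intro submoduleI) (auto simp: minus_eq_smult subset_iff)
qed

lemma linear_span_submodule:
  assumes "S \<subseteq> carrier A"
  shows "submodule (linear_span A S) (type_ring :: 'k ring) A"
  using assms unfolding linear_span_def hull_def submodule_iff
  by (auto intro: bexI[of _ "carrier A"])

lemma linear_span_base: "x \<in> S \<Longrightarrow> x \<in> linear_span A S"
  unfolding linear_span_def by (rule hull_inc)

lemma linear_span_add:
  "S \<subseteq> carrier A \<Longrightarrow> x \<in> linear_span A S \<Longrightarrow> y \<in> linear_span A S \<Longrightarrow> x \<oplus> y \<in> linear_span A S"
  using linear_span_submodule[of S] by (simp add: submodule_iff)

lemma linear_span_smult:
  "S \<subseteq> carrier A \<Longrightarrow> x \<in> linear_span A S \<Longrightarrow> c \<odot> x \<in> linear_span A S"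
  using linear_span_submodule[of S] by (simp add: submodule_iff)

lemma linear_span_zero: "S \<subseteq> carrier A \<Longrightarrow> \<zero> \<in> linear_span A S"
  using linear_span_submodule[of S] by (simp add: submodule_iff)

lemma linear_span_closed: "S \<subseteq> carrier A \<Longrightarrow> x \<in> linear_span A S \<Longrightarrow> x \<in> carrier A"
  using linear_span_submodule[of S] by (auto simp: submodule_iff)

lemma linear_span_induct [consumes 2, case_names base zero add smult]:
  assumes x: "x \<in> linear_span A S" and S: "S \<subseteq> carrier A"
    and P: "\<And>x. x \<in> S \<Longrightarrow> P x" "P \<zero>"
      "\<And>x y. x \<in> carrier A \<Longrightarrow> y \<in> carrier A \<Longrightarrow> P x \<Longrightarrow> P y \<Longrightarrow> P (x \<oplus> y)"
      "\<And>c x. x \<in> carrier A \<Longrightarrow> P x \<Longrightarrow> P (c \<odot> x)"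
  shows "P x"
proof -
  have "submodule {x \<in> carrier A. P x} (type_ring :: 'k ring) A"
    using P by (auto simp: submodule_iff)
  then have "linear_span A S \<subseteq> {x \<in> carrier A. P x}"
    unfolding linear_span_def by (intro hull_minimal) (use P S in auto)
  then show ?thesis
    using x by auto
qed

end


section \<open>Homomorphisms, and algebras derived from an algebra\<close>

lemma alg_homI:
  assumes "\<And>x. x \<in> carrier A \<Longrightarrow> h x \<in> carrier B"
    and "\<And>x y. x \<in> carrier A \<Longrightarrow> y \<in> carrier A \<Longrightarrow> h (x \<otimes>\<^bsub>A\<^esub> y) = h x \<otimes>\<^bsub>B\<^esub> h y"
    and "\<And>x y. x \<in> carrier A \<Longrightarrow> y \<in> carrier A \<Longrightarrow> h (x \<oplus>\<^bsub>A\<^esub> y) = h x \<oplus>\<^bsub>B\<^esub> h y"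
    and "h \<one>\<^bsub>A\<^esub> = \<one>\<^bsub>B\<^esub>"
    and "\<And>c x. x \<in> carrier A \<Longrightarrow> h (c \<odot>\<^bsub>A\<^esub> x) = c \<odot>\<^bsub>B\<^esub> h x"
  shows "h \<in> alg_hom A B"
  using assms by (auto simp: alg_hom_def intro: ring_hom_memI)

lemma alg_homD:
  assumes "h \<in> alg_hom A B"
  shows "\<And>x. x \<in> carrier A \<Longrightarrow> h x \<in> carrier B"
    and "\<And>x y. x \<in> carrier A \<Longrightarrow> y \<in> carrier A \<Longrightarrow> h (x \<otimes>\<^bsub>A\<^esub> y) = h x \<otimes>\<^bsub>B\<^esub> h y"
    and "\<And>x y. x \<in> carrier A \<Longrightarrow> y \<in> carrier A \<Longrightarrow> h (x \<oplus>\<^bsub>A\<^esub> y) = h x \<oplus>\<^bsub>B\<^esub> h y"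
    and "h \<one>\<^bsub>A\<^esub> = \<one>\<^bsub>B\<^esub>"
    and "\<And>c x. x \<in> carrier A \<Longrightarrow> h (c \<odot>\<^bsub>A\<^esub> x) = c \<odot>\<^bsub>B\<^esub> h x"
  using assms by (auto simp: alg_hom_def dest: ring_hom_memE)

lemma alg_hom_zero:
  assumes "assoc_algebra A" "assoc_algebra B" "h \<in> alg_hom A B"
  shows "h \<zero>\<^bsub>A\<^esub> = \<zero>\<^bsub>B\<^esub>"
proof -
  interpret A: assoc_algebra A by fact
  interpret B: assoc_algebra B by fact
  have "h (0 \<odot>\<^bsub>A\<^esub> \<zero>\<^bsub>A\<^esub>) = 0 \<odot>\<^bsub>B\<^esub> h \<zero>\<^bsub>A\<^esub>"
    using alg_homD(5)[OF assms(3)] by blast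
  then show ?thesis
    using alg_homD(1)[OF assms(3) A.zero_closed] by simp
qed

lemma alg_hom_minus:
  assumes "assoc_algebra A" "assoc_algebra B" "h \<in> alg_hom A B" "x \<in> carrier A"
  shows "h (\<ominus>\<^bsub>A\<^esub> x) = \<ominus>\<^bsub>B\<^esub> h x"
  using assms by (simp add: assoc_algebra.minus_eq_smult alg_homD)

lemma alg_hom_diff:
  assumes "assoc_algebra A" "assoc_algebra B" "h \<in> alg_hom A B" "x \<in> carrier A" "y \<in> carrier A"
  shows "h (x \<ominus>\<^bsub>A\<^esub> y) = h x \<ominus>\<^bsub>B\<^esub> h y"
proof -
  interpret A: assoc_algebra A by fact
  show ?thesis
    using assms by (simp add: a_minus_def alg_hom_minus alg_homD(3))
qed

lemma alg_hom_comp: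
  assumes "f \<in> alg_hom A B" "g \<in> alg_hom B C"
  shows "(\<lambda>x. g (f x)) \<in> alg_hom A C"
  by (rule alg_homI) (simp_all add: alg_homD[OF assms(1)] alg_homD[OF assms(2)])

lemma alg_hom_id: "(\<lambda>x. x) \<in> alg_hom A A"
  by (rule alg_homI) auto

lemma alg_hom_cong:
  assumes "assoc_algebra A" "f \<in> alg_hom A B" "\<And>x. x \<in> carrier A \<Longrightarrow> f x = g x"
  shows "g \<in> alg_hom A B"
proof -
  interpret A: assoc_algebra A by fact
  show ?thesis
    by (rule alg_homI) (simp_all add: alg_homD[OF assms(2)] flip: assms(3))
qed

text \<open>Apart from closure, the axioms are equations, and equations pass to images of maps that
  preserve the operations. Quotients and tensor products become algebras in this way.\<close>

lemma assoc_algebra_image: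
  fixes A :: "('k::field, 'a, 'm) module_scheme" and B :: "('k, 'b, 'n) module_scheme"
  assumes "assoc_algebra A" and surj: "h ` carrier A = carrier B" and hom: "h \<in> alg_hom A B"
    and zero: "h \<zero>\<^bsub>A\<^esub> = \<zero>\<^bsub>B\<^esub>"
  shows "assoc_algebra B"
proof -
  interpret A: assoc_algebra A by fact
  note h = alg_homD(2,3,5)[OF hom, symmetric]
  have car: "carrier B = h ` carrier A" and eqs: "\<one>\<^bsub>B\<^esub> = h \<one>\<^bsub>A\<^esub>" "\<zero>\<^bsub>B\<^esub> = h \<zero>\<^bsub>A\<^esub>"
    using surj zero alg_homD(4)[OF hom] by auto
  show ?thesis
    by (rule assoc_algebraI; unfold car eqs)
      (auto simp: h A.a_assoc A.m_assoc A.l_distr A.r_distr A.smult_add_left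
          A.smult_add_right A.smult_smult A.smult_mult_left A.smult_mult_right intro: arg_cong[where f = h, OF A.a_comm])
qed

lemma assoc_algebra_ground: "assoc_algebra (ground_algebra :: ('k::field, 'k) module)"
  by (rule assoc_algebraI) (simp_all add: ground_algebra_def algebra_simps)

lemma opposite_algebra_simps [simp]:
  "carrier (opposite_algebra A) = carrier A" "monoid.mult (opposite_algebra A) = (\<lambda>x y. y \<otimes>\<^bsub>A\<^esub> x)"
  "one (opposite_algebra A) = \<one>\<^bsub>A\<^esub>" "zero (opposite_algebra A) = \<zero>\<^bsub>A\<^esub>"
  "add (opposite_algebra A) = add A" "smult (opposite_algebra A) = smult A"
  by (simp_all add: opposite_algebra_def)

lemma assoc_algebra_opposite:
  assumes "assoc_algebra A" shows "assoc_algebra (opposite_algebra A)"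
proof -
  interpret assoc_algebra A by fact
  show ?thesis
    by (rule assoc_algebraI)
      (auto simp: m_assoc a_assoc l_distr r_distr smult_add_left smult_add_right smult_smult
        smult_mult_left smult_mult_right intro: a_comm)
qed

text \<open>The group algebra of \<open>\<int>/2\<close> with coefficients in \<open>A\<close>: the pair \<open>(a, b)\<close> stands for
  \<open>a + b \<epsilon>\<close> with \<open>\<epsilon>\<close> central and \<open>\<epsilon>\<^sup>2 = 1\<close>. A grading of \<open>A\<close> by \<open>\<int>/2\<close> is a
  homomorphism into it that sends a homogeneous \<open>a\<close> to \<open>a\<close> or to \<open>a \<epsilon>\<close>.\<close>

definition parity_algebra ::
  "('k::field, 'a, 'm) module_scheme \<Rightarrow> ('k, 'a \<times> 'a) module" where
  "parity_algebra A =
     \<lparr>carrier = carrier A \<times> carrier A,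
      monoid.mult = (\<lambda>(a, b) (c, d). (a \<otimes>\<^bsub>A\<^esub> c \<oplus>\<^bsub>A\<^esub> b \<otimes>\<^bsub>A\<^esub> d, a \<otimes>\<^bsub>A\<^esub> d \<oplus>\<^bsub>A\<^esub> b \<otimes>\<^bsub>A\<^esub> c)),
      one = (\<one>\<^bsub>A\<^esub>, \<zero>\<^bsub>A\<^esub>), zero = (\<zero>\<^bsub>A\<^esub>, \<zero>\<^bsub>A\<^esub>),
      add = (\<lambda>(a, b) (c, d). (a \<oplus>\<^bsub>A\<^esub> c, b \<oplus>\<^bsub>A\<^esub> d)),
      smult = (\<lambda>c (a, b). (c \<odot>\<^bsub>A\<^esub> a, c \<odot>\<^bsub>A\<^esub> b))\<rparr>"

lemma parity_algebra_simps [simp]: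
  "carrier (parity_algebra A) = carrier A \<times> carrier A"
  "(a, b) \<otimes>\<^bsub>parity_algebra A\<^esub> (c, d) =
     (a \<otimes>\<^bsub>A\<^esub> c \<oplus>\<^bsub>A\<^esub> b \<otimes>\<^bsub>A\<^esub> d, a \<otimes>\<^bsub>A\<^esub> d \<oplus>\<^bsub>A\<^esub> b \<otimes>\<^bsub>A\<^esub> c)"
  "\<one>\<^bsub>parity_algebra A\<^esub> = (\<one>\<^bsub>A\<^esub>, \<zero>\<^bsub>A\<^esub>)" "\<zero>\<^bsub>parity_algebra A\<^esub> = (\<zero>\<^bsub>A\<^esub>, \<zero>\<^bsub>A\<^esub>)"
  "(a, b) \<oplus>\<^bsub>parity_algebra A\<^esub> (c, d) = (a \<oplus>\<^bsub>A\<^esub> c, b \<oplus>\<^bsub>A\<^esub> d)"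
  "k \<odot>\<^bsub>parity_algebra A\<^esub> (a, b) = (k \<odot>\<^bsub>A\<^esub> a, k \<odot>\<^bsub>A\<^esub> b)"
  by (simp_all add: parity_algebra_def)

lemma assoc_algebra_parity:
  assumes "assoc_algebra A" shows "assoc_algebra (parity_algebra A)"
proof -
  interpret assoc_algebra A by fact
  show ?thesis
    by (rule assoc_algebraI; clarsimp)
      (simp_all add: m_assoc a_ac l_distr r_distr smult_add_left smult_add_right smult_smult
        smult_mult_left smult_mult_right)
qed

lemma ideal_smult_closed:
  assumes "assoc_algebra A" "ideal I A" "x \<in> I"
  shows "c \<odot>\<^bsub>A\<^esub> x \<in> I"
proof -
  interpret assoc_algebra A by fact
  interpret I: ideal I A by fact
  have "c \<odot>\<^bsub>A\<^esub> x = (c \<odot>\<^bsub>A\<^esub> \<one>\<^bsub>A\<^esub>) \<otimes>\<^bsub>A\<^esub> x"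
    using I.Icarr[OF assms(3)] by (simp add: smult_mult_left)
  then show ?thesis
    using assms(3) by (simp add: I.I_l_closed)
qed

lemma quotient_algebra_simps:
  "carrier (quotient_algebra A I) = (\<lambda>x. I +>\<^bsub>A\<^esub> x) ` carrier A"
  "one (quotient_algebra A I) = I +>\<^bsub>A\<^esub> \<one>\<^bsub>A\<^esub>"
  "zero (quotient_algebra A I) = I"
  by (auto simp: quotient_algebra_def FactRing_simps)

lemma quotient_algebra_proj:
  assumes "assoc_algebra A" "ideal I A"
  shows "(\<lambda>x. I +>\<^bsub>A\<^esub> x) \<in> alg_hom A (quotient_algebra A I)"
proof -
  interpret assoc_algebra A by fact
  interpret I: ideal I A by fact
  have sm: "(\<Union>y\<in>I +>\<^bsub>A\<^esub> x. I +>\<^bsub>A\<^esub> (c \<odot>\<^bsub>A\<^esub> y)) = I +>\<^bsub>A\<^esub> (c \<odot>\<^bsub>A\<^esub> x)" if x: "x \<in> carrier A" for c x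
  proof -
    have "I +>\<^bsub>A\<^esub> (c \<odot>\<^bsub>A\<^esub> y) = I +>\<^bsub>A\<^esub> (c \<odot>\<^bsub>A\<^esub> x)" if y: "y \<in> I +>\<^bsub>A\<^esub> x" for y
    proof -
      obtain i where i: "i \<in> I" and y: "y = i \<oplus>\<^bsub>A\<^esub> x"
        using y by (auto simp: a_r_coset_def')
      have "c \<odot>\<^bsub>A\<^esub> y = c \<odot>\<^bsub>A\<^esub> i \<oplus>\<^bsub>A\<^esub> c \<odot>\<^bsub>A\<^esub> x"
        using i x y by (simp add: smult_add_right)
      then have "c \<odot>\<^bsub>A\<^esub> y \<in> I +>\<^bsub>A\<^esub> (c \<odot>\<^bsub>A\<^esub> x)"
        using ideal_smult_closed[OF assms i] by (auto simp: a_r_coset_def')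
      then show ?thesis
        using x by (metis I.a_repr_independence' smult_in)
    qed
    moreover have "x \<in> I +>\<^bsub>A\<^esub> x"
      using x by (rule I.a_rcos_self)
    ultimately show ?thesis
      by blast
  qed
  show ?thesis
    by (rule alg_homI)
      (auto simp: quotient_algebra_def FactRing_simps I.rcoset_mult_add I.a_rcos_sum sm)
qed

lemma assoc_algebra_quotient:
  assumes "assoc_algebra A" "ideal I A"
  shows "assoc_algebra (quotient_algebra A I)"
proof (rule assoc_algebra_image[OF assms(1) _ quotient_algebra_proj[OF assms]])
  interpret assoc_algebra A by fact
  interpret I: ideal I A by fact
  show "I +>\<^bsub>A\<^esub> \<zero>\<^bsub>A\<^esub> = \<zero>\<^bsub>quotient_algebra A I\<^esub>"
    by (simp add: quotient_algebra_simps a_coset_add_zero I.a_subset)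
qed (simp add: quotient_algebra_simps)

lemma coset_eq_zero_iff:
  assumes "assoc_algebra A" "ideal I A" "x \<in> carrier A"
  shows "I +>\<^bsub>A\<^esub> x = \<zero>\<^bsub>quotient_algebra A I\<^esub> \<longleftrightarrow> x \<in> I"
proof -
  interpret assoc_algebra A by fact
  interpret I: ideal I A by fact
  show ?thesis
    using assms(3) I.rcos_const_imp_mem I.a_rcos_const by (auto simp: quotient_algebra_simps)
qed

section \<open>Linear extension of maps on a basis\<close>

lemma lookup_pm_scale [simp]: "Poly_Mapping.lookup (pm_scale c t) k = c * Poly_Mapping.lookup t k"
  unfolding pm_scale_def by transfer (auto simp: when_def)

interpretation pm: vector_space "pm_scale :: 'k::field \<Rightarrow> ('s \<Rightarrow>\<^sub>0 'k) \<Rightarrow> ('s \<Rightarrow>\<^sub>0 'k)"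
  by unfold_locales (auto intro!: poly_mapping_eqI simp: lookup_add algebra_simps)

lemma pm_scale_single [simp]:
  "pm_scale c (Poly_Mapping.single k d) = Poly_Mapping.single k (c * d)"
  by (rule poly_mapping_eqI) (auto simp: lookup_single when_def)

lemma keys_pm_scale: "Poly_Mapping.keys (pm_scale c t) \<subseteq> Poly_Mapping.keys t"
  by (auto simp: in_keys_iff)

lemma poly_mapping_single_induct [consumes 1, case_names single add]:
  fixes t :: "'s \<Rightarrow>\<^sub>0 'k::field"
  assumes "Poly_Mapping.keys t \<subseteq> C"
    and single: "\<And>k c. k \<in> C \<Longrightarrow> P (Poly_Mapping.single k c)"
    and add: "\<And>s t. Poly_Mapping.keys s \<subseteq> C \<Longrightarrow> Poly_Mapping.keys t \<subseteq> C \<Longrightarrow> P s \<Longrightarrow> P t \<Longrightarrow> P (s + t)"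
    and zero: "P 0"
  shows "P t"
  using assms(1)
proof (induction t rule: update_induct)
  case const
  show ?case by (rule zero)
next
  case (update t k c)
  have eq: "Poly_Mapping.update k c t = t + Poly_Mapping.single k c"
    by (rule poly_mapping_eqI)
      (use update.hyps(1) in \<open>auto simp: lookup_update lookup_add lookup_single when_def in_keys_iff\<close>)
  have "k \<in> C" "Poly_Mapping.keys t \<subseteq> C"
    using update.prems update.hyps by (auto simp: keys_update)
  then show ?case
    unfolding eq using update.IH by (intro add single) auto
qed

text \<open>Linear extension from a basis comes in two versions: into a module with a carrier, as in
  \<^const>\<open>tensor_lift\<close>, and into a free vector space that is a whole type, where sums have the
  full arithmetic of the type.\<close>

definition lincomb :: "('k::field, 'm, 'z) module_scheme \<Rightarrow> ('s \<Rightarrow> 'm) \<Rightarrow> ('s \<Rightarrow>\<^sub>0 'k) \<Rightarrow> 'm" where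
  "lincomb M \<beta> t = finsum M (\<lambda>k. Poly_Mapping.lookup t k \<odot>\<^bsub>M\<^esub> \<beta> k) (Poly_Mapping.keys t)"

definition pm_extend :: "('s \<Rightarrow> ('r \<Rightarrow>\<^sub>0 'k::field)) \<Rightarrow> ('s \<Rightarrow>\<^sub>0 'k) \<Rightarrow> ('r \<Rightarrow>\<^sub>0 'k)" where
  "pm_extend \<beta> t = (\<Sum>k\<in>Poly_Mapping.keys t. pm_scale (Poly_Mapping.lookup t k) (\<beta> k))"

lemma pm_extend_superset:
  assumes "finite S" "Poly_Mapping.keys t \<subseteq> S"
  shows "pm_extend \<beta> t = (\<Sum>k\<in>S. pm_scale (Poly_Mapping.lookup t k) (\<beta> k))"
  unfolding pm_extend_def using assms
  by (intro sum.mono_neutral_left) (auto simp: in_keys_iff)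

lemma pm_extend_add: "pm_extend \<beta> (s + t) = pm_extend \<beta> s + pm_extend \<beta> t"
proof -
  let ?S = "Poly_Mapping.keys s \<union> Poly_Mapping.keys t"
  have "Poly_Mapping.keys (s + t) \<subseteq> ?S"
    by (rule keys_add)
  then show ?thesis
    by (simp add: pm_extend_superset[of ?S] lookup_add pm.scale_left_distrib sum.distrib)
qed

lemma pm_extend_scale: "pm_extend \<beta> (pm_scale c t) = pm_scale c (pm_extend \<beta> t)"
  unfolding pm_extend_superset[OF finite_keys keys_pm_scale]
  by (simp add: pm_extend_def pm.scale_sum_right)

lemma pm_extend_zero [simp]: "pm_extend \<beta> 0 = 0"
  by (simp add: pm_extend_def)

lemma pm_extend_single [simp]: "pm_extend \<beta> (Poly_Mapping.single k c) = pm_scale c (\<beta> k)"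
  by (cases "c = 0") (simp_all add: pm_extend_def)

lemma pm_extend_diff: "pm_extend \<beta> (s - t) = pm_extend \<beta> s - pm_extend \<beta> t"
  using pm_extend_add[of \<beta> "s - t" t] by simp

lemma pm_extend_fun_add: "pm_extend (\<lambda>k. \<beta> k + \<gamma> k) t = pm_extend \<beta> t + pm_extend \<gamma> t"
  by (simp add: pm_extend_def pm.scale_right_distrib sum.distrib)

lemma pm_extend_fun_scale: "pm_extend (\<lambda>k. pm_scale c (\<beta> k)) t = pm_scale c (pm_extend \<beta> t)"
  by (simp add: pm_extend_def pm.scale_sum_right mult.commute)

context assoc_algebra
begin

lemma additive_monoid: "abelian_monoid A"
  by (rule abelian_group.axioms(1)[OF additive_group])

lemma finsum_superset:
  assumes "finite S" "T \<subseteq> S" "f \<in> S \<rightarrow> carrier A" "\<And>k. k \<in> S - T \<Longrightarrow> f k = \<zero>"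
  shows "finsum A f T = finsum A f S"
  unfolding finsum_def
  by (rule comm_monoid.finprod_mono_neutral_cong_left[OF abelian_monoid.a_comm_monoid[OF additive_monoid]])
    (use assms in auto)

lemma lincomb_superset:
  assumes "finite S" "Poly_Mapping.keys t \<subseteq> S" "\<beta> \<in> S \<rightarrow> carrier A"
  shows "lincomb A \<beta> t = finsum A (\<lambda>k. Poly_Mapping.lookup t k \<odot> \<beta> k) S"
  unfolding lincomb_def using assms
  by (intro finsum_superset) (auto simp: in_keys_iff Pi_iff)

lemma lincomb_closed: "\<beta> \<in> Poly_Mapping.keys t \<rightarrow> carrier A \<Longrightarrow> lincomb A \<beta> t \<in> carrier A"
  unfolding lincomb_def by (rule abelian_monoid.finsum_closed[OF additive_monoid]) auto

lemma lincomb_add: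
  assumes "Poly_Mapping.keys s \<subseteq> C" "Poly_Mapping.keys t \<subseteq> C" "\<beta> \<in> C \<rightarrow> carrier A"
  shows "lincomb A \<beta> (s + t) = lincomb A \<beta> s \<oplus> lincomb A \<beta> t"
proof -
  let ?S = "Poly_Mapping.keys s \<union> Poly_Mapping.keys t"
  have "Poly_Mapping.keys (s + t) \<subseteq> ?S"
    by (rule keys_add)
  moreover have "\<beta> \<in> ?S \<rightarrow> carrier A"
    using assms by auto
  moreover have "finsum A (\<lambda>k. (Poly_Mapping.lookup s k + Poly_Mapping.lookup t k) \<odot> \<beta> k) ?S =
      finsum A (\<lambda>k. Poly_Mapping.lookup s k \<odot> \<beta> k \<oplus> Poly_Mapping.lookup t k \<odot> \<beta> k) ?S"
    by (rule abelian_monoid.finsum_cong'[OF additive_monoid]) (use calculation in \<open>auto simp: smult_add_left Pi_iff\<close>)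
  moreover have "finsum A (\<lambda>k. Poly_Mapping.lookup s k \<odot> \<beta> k \<oplus> Poly_Mapping.lookup t k \<odot> \<beta> k) ?S =
      finsum A (\<lambda>k. Poly_Mapping.lookup s k \<odot> \<beta> k) ?S \<oplus> finsum A (\<lambda>k. Poly_Mapping.lookup t k \<odot> \<beta> k) ?S"
    by (rule abelian_monoid.finsum_addf[OF additive_monoid]) (use calculation in \<open>auto simp: Pi_iff\<close>)
  ultimately show ?thesis
    by (simp add: lincomb_superset[of ?S] lookup_add)
qed

lemma lincomb_smult:
  assumes "\<beta> \<in> Poly_Mapping.keys t \<rightarrow> carrier A"
  shows "lincomb A \<beta> (pm_scale c t) = c \<odot> lincomb A \<beta> t"
proof -
  have "lincomb A \<beta> (pm_scale c t) = finsum A (\<lambda>k. (c * Poly_Mapping.lookup t k) \<odot> \<beta> k) (Poly_Mapping.keys t)"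
    using lincomb_superset[OF finite_keys keys_pm_scale assms] by simp
  also have "\<dots> = finsum A (\<lambda>k. c \<odot> (Poly_Mapping.lookup t k \<odot> \<beta> k)) (Poly_Mapping.keys t)"
    by (rule abelian_monoid.finsum_cong'[OF additive_monoid]) (use assms in \<open>auto simp: smult_smult Pi_iff\<close>)
  also have "\<dots> = c \<odot> lincomb A \<beta> t"
    unfolding lincomb_def by (rule finsum_smult_ldistr[symmetric]) (use assms in auto)
  finally show ?thesis .
qed

lemma lincomb_zero [simp]: "lincomb A \<beta> 0 = \<zero>"
  by (simp add: lincomb_def)

lemma lincomb_single:
  "\<beta> k \<in> carrier A \<Longrightarrow> lincomb A \<beta> (Poly_Mapping.single k c) = c \<odot> \<beta> k"
  by (cases "c = 0") (simp_all add: lincomb_def abelian_monoid.finsum_insert[OF additive_monoid])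

lemma lincomb_diff:
  assumes "Poly_Mapping.keys s \<subseteq> C" "Poly_Mapping.keys t \<subseteq> C" "\<beta> \<in> C \<rightarrow> carrier A"
  shows "lincomb A \<beta> (s - t) = lincomb A \<beta> s \<ominus> lincomb A \<beta> t"
proof -
  have eq: "s - t = s + pm_scale (- 1) t"
    by simp
  have "\<beta> \<in> Poly_Mapping.keys t \<rightarrow> carrier A"
    using assms by auto
  then show ?thesis
    unfolding eq lincomb_add[OF assms(1) subset_trans[OF keys_pm_scale assms(2)] assms(3)]
    by (simp add: lincomb_smult minus_eq_smult lincomb_closed a_minus_def del: pm.scale_minus_left)
qed

end

section \<open>Tensor products of algebras\<close>

definition linear_on ::
  "('k::field, 'a, 'm) module_scheme \<Rightarrow> ('k, 'b, 'n) module_scheme \<Rightarrow> ('a \<Rightarrow> 'b) \<Rightarrow> bool" where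
  "linear_on A M f \<longleftrightarrow> (\<forall>x\<in>carrier A. f x \<in> carrier M) \<and>
     (\<forall>x\<in>carrier A. \<forall>y\<in>carrier A. f (x \<oplus>\<^bsub>A\<^esub> y) = f x \<oplus>\<^bsub>M\<^esub> f y) \<and>
     (\<forall>c. \<forall>x\<in>carrier A. f (c \<odot>\<^bsub>A\<^esub> x) = c \<odot>\<^bsub>M\<^esub> f x)"

definition bilinear_on ::
  "('k::field, 'a, 'm) module_scheme \<Rightarrow> ('k, 'b, 'n) module_scheme \<Rightarrow> ('k, 'c, 'l) module_scheme
     \<Rightarrow> ('a \<Rightarrow> 'b \<Rightarrow> 'c) \<Rightarrow> bool" where
  "bilinear_on A B M \<beta> \<longleftrightarrow> (\<forall>a\<in>carrier A. linear_on B M (\<beta> a)) \<and>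
     (\<forall>b\<in>carrier B. linear_on A M (\<lambda>a. \<beta> a b))"

lemma linear_onI:
  assumes "\<And>x. x \<in> carrier A \<Longrightarrow> f x \<in> carrier M"
    and "\<And>x y. x \<in> carrier A \<Longrightarrow> y \<in> carrier A \<Longrightarrow> f (x \<oplus>\<^bsub>A\<^esub> y) = f x \<oplus>\<^bsub>M\<^esub> f y"
    and "\<And>c x. x \<in> carrier A \<Longrightarrow> f (c \<odot>\<^bsub>A\<^esub> x) = c \<odot>\<^bsub>M\<^esub> f x"
  shows "linear_on A M f"
  using assms by (simp add: linear_on_def)

lemma linear_onD:
  assumes "linear_on A M f"
  shows "\<And>x. x \<in> carrier A \<Longrightarrow> f x \<in> carrier M"
    and "\<And>x y. x \<in> carrier A \<Longrightarrow> y \<in> carrier A \<Longrightarrow> f (x \<oplus>\<^bsub>A\<^esub> y) = f x \<oplus>\<^bsub>M\<^esub> f y"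
    and "\<And>c x. x \<in> carrier A \<Longrightarrow> f (c \<odot>\<^bsub>A\<^esub> x) = c \<odot>\<^bsub>M\<^esub> f x"
  using assms by (simp_all add: linear_on_def)

lemma bilinear_onI:
  assumes "\<And>a. a \<in> carrier A \<Longrightarrow> linear_on B M (\<beta> a)"
    and "\<And>b. b \<in> carrier B \<Longrightarrow> linear_on A M (\<lambda>a. \<beta> a b)"
  shows "bilinear_on A B M \<beta>"
  using assms by (simp add: bilinear_on_def)

lemma bilinear_onD:
  assumes "bilinear_on A B M \<beta>"
  shows "\<And>a b. a \<in> carrier A \<Longrightarrow> b \<in> carrier B \<Longrightarrow> \<beta> a b \<in> carrier M"
    and "\<And>a a' b. a \<in> carrier A \<Longrightarrow> a' \<in> carrier A \<Longrightarrow> b \<in> carrier B \<Longrightarrow>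
      \<beta> (a \<oplus>\<^bsub>A\<^esub> a') b = \<beta> a b \<oplus>\<^bsub>M\<^esub> \<beta> a' b"
    and "\<And>a b b'. a \<in> carrier A \<Longrightarrow> b \<in> carrier B \<Longrightarrow> b' \<in> carrier B \<Longrightarrow>
      \<beta> a (b \<oplus>\<^bsub>B\<^esub> b') = \<beta> a b \<oplus>\<^bsub>M\<^esub> \<beta> a b'"
    and "\<And>a b c. a \<in> carrier A \<Longrightarrow> b \<in> carrier B \<Longrightarrow> \<beta> (c \<odot>\<^bsub>A\<^esub> a) b = c \<odot>\<^bsub>M\<^esub> \<beta> a b"
    and "\<And>a b c. a \<in> carrier A \<Longrightarrow> b \<in> carrier B \<Longrightarrow> \<beta> a (c \<odot>\<^bsub>B\<^esub> b) = c \<odot>\<^bsub>M\<^esub> \<beta> a b"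
  using assms by (simp_all add: bilinear_on_def linear_on_def)

text \<open>Componentwise multiplication of pairs, extended bilinearly. It turns the free vector space on
  \<^term>\<open>carrier A \<times> carrier B\<close> into an algebra, of which the tensor product is the image under
  \<^const>\<open>tensor_class\<close>. The algebra axioms are checked on pairs and pass to the image.\<close>

definition pair_mult ::
  "('k::field, 'a, 'm) module_scheme \<Rightarrow> ('k, 'b, 'n) module_scheme \<Rightarrow>
   ('a \<times> 'b \<Rightarrow>\<^sub>0 'k) \<Rightarrow> ('a \<times> 'b \<Rightarrow>\<^sub>0 'k) \<Rightarrow> ('a \<times> 'b \<Rightarrow>\<^sub>0 'k)" where
  "pair_mult A B s t = pm_extend (\<lambda>k. pm_extend (\<lambda>l.
     Poly_Mapping.single (fst k \<otimes>\<^bsub>A\<^esub> fst l, snd k \<otimes>\<^bsub>B\<^esub> snd l) 1) t) s"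

definition pair_algebra ::
  "('k::field, 'a, 'm) module_scheme \<Rightarrow> ('k, 'b, 'n) module_scheme \<Rightarrow> ('k, 'a \<times> 'b \<Rightarrow>\<^sub>0 'k) module" where
  "pair_algebra A B =
     \<lparr>carrier = {t. Poly_Mapping.keys t \<subseteq> carrier A \<times> carrier B},
      monoid.mult = pair_mult A B, one = Poly_Mapping.single (\<one>\<^bsub>A\<^esub>, \<one>\<^bsub>B\<^esub>) 1,
      zero = 0, add = (+), smult = pm_scale\<rparr>"

lemma pair_mult_eq:
  "pair_mult A B s t =
     (\<Sum>(a, b)\<in>Poly_Mapping.keys s. \<Sum>(a', b')\<in>Poly_Mapping.keys t.
        Poly_Mapping.single (a \<otimes>\<^bsub>A\<^esub> a', b \<otimes>\<^bsub>B\<^esub> b')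
          (Poly_Mapping.lookup s (a, b) * Poly_Mapping.lookup t (a', b')))"
  by (simp add: pair_mult_def pm_extend_def pm.scale_sum_right split_def)

lemma pair_mult_single [simp]:
  "pair_mult A B (Poly_Mapping.single (a, b) c) (Poly_Mapping.single (a', b') d) =
     Poly_Mapping.single (a \<otimes>\<^bsub>A\<^esub> a', b \<otimes>\<^bsub>B\<^esub> b') (c * d)"
  by (simp add: pair_mult_def)

lemma pair_mult_add_left: "pair_mult A B (s + s') t = pair_mult A B s t + pair_mult A B s' t"
  and pair_mult_add_right: "pair_mult A B s (t + t') = pair_mult A B s t + pair_mult A B s t'"
  and pair_mult_diff_left: "pair_mult A B (s - s') t = pair_mult A B s t - pair_mult A B s' t"
  and pair_mult_scale_left: "pair_mult A B (pm_scale c s) t = pm_scale c (pair_mult A B s t)"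
  and pair_mult_scale_right: "pair_mult A B s (pm_scale c t) = pm_scale c (pair_mult A B s t)"
  and pair_mult_zero [simp]: "pair_mult A B 0 t = 0" "pair_mult A B s 0 = 0"
  by (simp_all add: pair_mult_def pm_extend_add pm_extend_diff pm_extend_scale
      pm_extend_fun_add pm_extend_fun_scale) (simp add: pm_extend_def)

lemma pair_mult_diff_right: "pair_mult A B s (t - t') = pair_mult A B s t - pair_mult A B s t'"
  using pair_mult_add_right[of A B s "t - t'" t'] by simp

locale algebra_pair = A: assoc_algebra A + B: assoc_algebra B
  for A :: "('k::field, 'a, 'm) module_scheme" and B :: "('k, 'b, 'n) module_scheme"
begin

definition pairs :: "('a \<times> 'b \<Rightarrow>\<^sub>0 'k) set" where
  "pairs = {t. Poly_Mapping.keys t \<subseteq> carrier A \<times> carrier B}"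

abbreviation null :: "('a \<times> 'b \<Rightarrow>\<^sub>0 'k) set" where
  "null \<equiv> Modules.module.span pm_scale (tensor_relations A B)"

abbreviation AB :: "('k, ('a \<times> 'b \<Rightarrow>\<^sub>0 'k) set) module" where
  "AB \<equiv> tensor_algebra_prod A B"

lemma pairs_add: "s \<in> pairs \<Longrightarrow> t \<in> pairs \<Longrightarrow> s + t \<in> pairs"
  using keys_add[of s t] by (auto simp: pairs_def)

lemma pairs_scale: "t \<in> pairs \<Longrightarrow> pm_scale c t \<in> pairs"
  using keys_pm_scale[of c t] by (auto simp: pairs_def)

lemma pairs_zero: "0 \<in> pairs"
  by (simp add: pairs_def)

lemma pairs_diff: "s \<in> pairs \<Longrightarrow> t \<in> pairs \<Longrightarrow> s - t \<in> pairs"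
  using pairs_add[of s "pm_scale (- 1) t"] pairs_scale[of t "- 1"] by simp

lemma pairs_single: "a \<in> carrier A \<Longrightarrow> b \<in> carrier B \<Longrightarrow> Poly_Mapping.single (a, b) c \<in> pairs"
  by (simp add: pairs_def)

lemma pairs_induct [consumes 1, case_names single add]:
  assumes "t \<in> pairs"
    and "\<And>a b c. a \<in> carrier A \<Longrightarrow> b \<in> carrier B \<Longrightarrow> P (Poly_Mapping.single (a, b) c)"
    and "\<And>s t. s \<in> pairs \<Longrightarrow> t \<in> pairs \<Longrightarrow> P s \<Longrightarrow> P t \<Longrightarrow> P (s + t)"
  shows "P t"
proof -
  have "P 0"
    using assms(2)[of "\<zero>\<^bsub>A\<^esub>" "\<zero>\<^bsub>B\<^esub>" 0] by simp
  with assms(1)[unfolded pairs_def mem_Collect_eq] show ?thesis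
    using assms(2,3) unfolding pairs_def
    by (induction t rule: poly_mapping_single_induct) auto
qed

lemma pair_mult_closed:
  assumes "s \<in> pairs" "t \<in> pairs" shows "pair_mult A B s t \<in> pairs"
  using assms(1)
proof (induction s rule: pairs_induct)
  case (single a b c)
  note ab = this
  show ?case
    using assms(2)
  proof (induction t rule: pairs_induct)
    case (add s t)
    then show ?case by (simp only: pair_mult_add_right pairs_add)
  qed (use ab in \<open>simp add: pairs_single\<close>)
next
  case (add s t)
  then show ?case by (simp only: pair_mult_add_left pairs_add)
qed

lemma assoc_algebra_pair: "assoc_algebra (pair_algebra A B)"
proof -
  have sel [simp]: "carrier (pair_algebra A B) = pairs" "monoid.mult (pair_algebra A B) = pair_mult A B"
    "one (pair_algebra A B) = Poly_Mapping.single (\<one>\<^bsub>A\<^esub>, \<one>\<^bsub>B\<^esub>) 1"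
    "zero (pair_algebra A B) = 0" "add (pair_algebra A B) = (+)" "smult (pair_algebra A B) = pm_scale"
    by (simp_all add: pair_algebra_def pairs_def)
  have assoc: "pair_mult A B (pair_mult A B x y) z = pair_mult A B x (pair_mult A B y z)"
    if xyz: "x \<in> pairs" "y \<in> pairs" "z \<in> pairs" for x y z
    using xyz(1)
  proof (induction x rule: pairs_induct)
    case (single a b c)
    note x = this
    show ?case
      using xyz(2)
    proof (induction y rule: pairs_induct)
      case (single a' b' c')
      note y = this
      show ?case
        using xyz(3)
      proof (induction z rule: pairs_induct)
        case (single a'' b'' c'')
        then show ?case
          using x y by (simp add: A.m_assoc B.m_assoc mult.assoc)
      qed (simp only: pair_mult_add_left pair_mult_add_right)
    qed (simp only: pair_mult_add_left pair_mult_add_right)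
  qed (simp only: pair_mult_add_left pair_mult_add_right)
  have one: "pair_mult A B (Poly_Mapping.single (\<one>\<^bsub>A\<^esub>, \<one>\<^bsub>B\<^esub>) 1) x = x"
    "pair_mult A B x (Poly_Mapping.single (\<one>\<^bsub>A\<^esub>, \<one>\<^bsub>B\<^esub>) 1) = x" if "x \<in> pairs" for x
    using that by (induction x rule: pairs_induct) (simp_all add: pair_mult_add_right pair_mult_add_left)
  show ?thesis
    by (rule assoc_algebraI; unfold sel)
      (simp_all add: assoc one pairs_add pairs_scale pairs_zero pairs_single pair_mult_closed
        pair_mult_add_left pair_mult_add_right pair_mult_scale_left pair_mult_scale_right
        pm.scale_left_distrib pm.scale_right_distrib add_ac)
qed

lemma null_add_left:
  assumes "a \<in> carrier A" "a' \<in> carrier A" "b \<in> carrier B"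
  shows "Poly_Mapping.single (a \<oplus>\<^bsub>A\<^esub> a', b) c - Poly_Mapping.single (a, b) c
    - Poly_Mapping.single (a', b) c \<in> null"
proof -
  have "Poly_Mapping.single (a \<oplus>\<^bsub>A\<^esub> a', b) 1 - Poly_Mapping.single (a, b) 1
    - Poly_Mapping.single (a', b) (1 :: 'k) \<in> null"
    by (rule pm.span_base) (use assms in \<open>unfold tensor_relations_def, blast\<close>)
  from pm.span_scale[OF this, of c] show ?thesis
    by (simp add: pm.scale_right_diff_distrib)
qed

lemma null_add_right:
  assumes "a \<in> carrier A" "b \<in> carrier B" "b' \<in> carrier B"
  shows "Poly_Mapping.single (a, b \<oplus>\<^bsub>B\<^esub> b') c - Poly_Mapping.single (a, b) c
    - Poly_Mapping.single (a, b') c \<in> null"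
proof -
  have "Poly_Mapping.single (a, b \<oplus>\<^bsub>B\<^esub> b') 1 - Poly_Mapping.single (a, b) 1
    - Poly_Mapping.single (a, b') (1 :: 'k) \<in> null"
    by (rule pm.span_base) (use assms in \<open>unfold tensor_relations_def, blast\<close>)
  from pm.span_scale[OF this, of c] show ?thesis
    by (simp add: pm.scale_right_diff_distrib)
qed

lemma null_smult_left:
  assumes "a \<in> carrier A" "b \<in> carrier B"
  shows "Poly_Mapping.single (d \<odot>\<^bsub>A\<^esub> a, b) c - Poly_Mapping.single (a, b) (c * d) \<in> null"
proof -
  have "Poly_Mapping.single (d \<odot>\<^bsub>A\<^esub> a, b) 1 - Poly_Mapping.single (a, b) d \<in> null"
    by (rule pm.span_base) (use assms in \<open>unfold tensor_relations_def, blast\<close>)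
  from pm.span_scale[OF this, of c] show ?thesis
    by (simp add: pm.scale_right_diff_distrib)
qed

lemma null_smult_right:
  assumes "a \<in> carrier A" "b \<in> carrier B"
  shows "Poly_Mapping.single (a, d \<odot>\<^bsub>B\<^esub> b) c - Poly_Mapping.single (a, b) (c * d) \<in> null"
proof -
  have "Poly_Mapping.single (a, d \<odot>\<^bsub>B\<^esub> b) 1 - Poly_Mapping.single (a, b) d \<in> null"
    by (rule pm.span_base) (use assms in \<open>unfold tensor_relations_def, blast\<close>)
  from pm.span_scale[OF this, of c] show ?thesis
    by (simp add: pm.scale_right_diff_distrib)
qed

text \<open>Induction over the span of the bilinearity relations, with one base case for each of the four
  families.\<close>

lemma null_minimal:
  assumes s: "s \<in> null"
    and add_left: "\<And>a a' b. a \<in> carrier A \<Longrightarrow> a' \<in> carrier A \<Longrightarrow> b \<in> carrier B \<Longrightarrow>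
      Q (Poly_Mapping.single (a \<oplus>\<^bsub>A\<^esub> a', b) 1 - Poly_Mapping.single (a, b) 1 - Poly_Mapping.single (a', b) 1)"
    and add_right: "\<And>a b b'. a \<in> carrier A \<Longrightarrow> b \<in> carrier B \<Longrightarrow> b' \<in> carrier B \<Longrightarrow>
      Q (Poly_Mapping.single (a, b \<oplus>\<^bsub>B\<^esub> b') 1 - Poly_Mapping.single (a, b) 1 - Poly_Mapping.single (a, b') 1)"
    and smult_left: "\<And>c a b. a \<in> carrier A \<Longrightarrow> b \<in> carrier B \<Longrightarrow>
      Q (Poly_Mapping.single (c \<odot>\<^bsub>A\<^esub> a, b) 1 - Poly_Mapping.single (a, b) c)"
    and smult_right: "\<And>c a b. a \<in> carrier A \<Longrightarrow> b \<in> carrier B \<Longrightarrow>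
      Q (Poly_Mapping.single (a, c \<odot>\<^bsub>B\<^esub> b) 1 - Poly_Mapping.single (a, b) c)"
    and sub: "Q 0" "\<And>s t. Q s \<Longrightarrow> Q t \<Longrightarrow> Q (s + t)" "\<And>c s. Q s \<Longrightarrow> Q (pm_scale c s)"
  shows "Q s"
proof -
  have "tensor_relations A B \<subseteq> {s. Q s}"
    unfolding tensor_relations_def
    by (intro Un_least subsetI; elim CollectE exE conjE; hypsubst; rule CollectI;
        rule add_left add_right smult_left smult_right; assumption)
  moreover have "pm.subspace {s. Q s}"
    using sub by (intro pm.subspaceI) auto
  ultimately have "null \<subseteq> {s. Q s}"
    by (rule pm.span_minimal)
  then show ?thesis
    using s by blast
qed

lemma null_pairs: "s \<in> null \<Longrightarrow> s \<in> pairs"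
  by (erule null_minimal[where Q = "\<lambda>s. s \<in> pairs"]; intro pairs_diff pairs_single pairs_add pairs_scale pairs_zero A.a_closed B.a_closed
      A.smult_in B.smult_in; assumption)

text \<open>The relations span an ideal: by bilinearity a relation is multiplied by a single pair, which
  gives a relation of the same family by distributivity in one component.\<close>

lemma null_mult_right:
  assumes "s \<in> null" "t \<in> pairs" shows "pair_mult A B s t \<in> null"
  using assms(2)
proof (induction t rule: pairs_induct)
  case (single x y d)
  show ?case
    using assms(1)
  proof (rule null_minimal)
    fix a a' b assume "a \<in> carrier A" "a' \<in> carrier A" "b \<in> carrier B"
    then show "pair_mult A B (Poly_Mapping.single (a \<oplus>\<^bsub>A\<^esub> a', b) 1 - Poly_Mapping.single (a, b) 1
        - Poly_Mapping.single (a', b) 1) (Poly_Mapping.single (x, y) d) \<in> null"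
      using single by (simp add: pair_mult_diff_left A.l_distr null_add_left)
  next
    fix a b b' assume "a \<in> carrier A" "b \<in> carrier B" "b' \<in> carrier B"
    then show "pair_mult A B (Poly_Mapping.single (a, b \<oplus>\<^bsub>B\<^esub> b') 1 - Poly_Mapping.single (a, b) 1
        - Poly_Mapping.single (a, b') 1) (Poly_Mapping.single (x, y) d) \<in> null"
      using single by (simp add: pair_mult_diff_left B.l_distr null_add_right)
  next
    fix c a b assume "a \<in> carrier A" "b \<in> carrier B"
    then show "pair_mult A B (Poly_Mapping.single (c \<odot>\<^bsub>A\<^esub> a, b) 1 - Poly_Mapping.single (a, b) c)
        (Poly_Mapping.single (x, y) d) \<in> null"
      and "pair_mult A B (Poly_Mapping.single (a, c \<odot>\<^bsub>B\<^esub> b) 1 - Poly_Mapping.single (a, b) c)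
        (Poly_Mapping.single (x, y) d) \<in> null"
      using single null_smult_left[of "a \<otimes>\<^bsub>A\<^esub> x" "b \<otimes>\<^bsub>B\<^esub> y" c d] null_smult_right[of "a \<otimes>\<^bsub>A\<^esub> x" "b \<otimes>\<^bsub>B\<^esub> y" c d]
      by (simp_all add: pair_mult_diff_left A.smult_mult_left B.smult_mult_left mult.commute)
  qed (simp_all add: pair_mult_add_left pair_mult_scale_left pm.span_zero pm.span_add pm.span_scale)
qed (simp add: pair_mult_add_right pm.span_add)

lemma null_mult_left:
  assumes "s \<in> null" "t \<in> pairs" shows "pair_mult A B t s \<in> null"
  using assms(2)
proof (induction t rule: pairs_induct)
  case (single x y d)
  show ?case
    using assms(1)
  proof (rule null_minimal)
    fix a a' b assume "a \<in> carrier A" "a' \<in> carrier A" "b \<in> carrier B"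
    then show "pair_mult A B (Poly_Mapping.single (x, y) d) (Poly_Mapping.single (a \<oplus>\<^bsub>A\<^esub> a', b) 1
        - Poly_Mapping.single (a, b) 1 - Poly_Mapping.single (a', b) 1) \<in> null"
      using single by (simp add: pair_mult_diff_right A.r_distr null_add_left)
  next
    fix a b b' assume "a \<in> carrier A" "b \<in> carrier B" "b' \<in> carrier B"
    then show "pair_mult A B (Poly_Mapping.single (x, y) d) (Poly_Mapping.single (a, b \<oplus>\<^bsub>B\<^esub> b') 1
        - Poly_Mapping.single (a, b) 1 - Poly_Mapping.single (a, b') 1) \<in> null"
      using single by (simp add: pair_mult_diff_right B.r_distr null_add_right)
  next
    fix c a b assume "a \<in> carrier A" "b \<in> carrier B"
    then show "pair_mult A B (Poly_Mapping.single (x, y) d)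
        (Poly_Mapping.single (c \<odot>\<^bsub>A\<^esub> a, b) 1 - Poly_Mapping.single (a, b) c) \<in> null"
      and "pair_mult A B (Poly_Mapping.single (x, y) d)
        (Poly_Mapping.single (a, c \<odot>\<^bsub>B\<^esub> b) 1 - Poly_Mapping.single (a, b) c) \<in> null"
      using single null_smult_left[of "x \<otimes>\<^bsub>A\<^esub> a" "y \<otimes>\<^bsub>B\<^esub> b" c d] null_smult_right[of "x \<otimes>\<^bsub>A\<^esub> a" "y \<otimes>\<^bsub>B\<^esub> b" c d]
      by (simp_all add: pair_mult_diff_right A.smult_mult_right B.smult_mult_right)
  qed (simp_all add: pair_mult_add_right pair_mult_scale_right pm.span_zero pm.span_add pm.span_scale)
qed (simp add: pair_mult_add_left pm.span_add)

lemma tensor_class_eq_iff: "tensor_class A B s = tensor_class A B t \<longleftrightarrow> s - t \<in> null"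
proof
  assume "tensor_class A B s = tensor_class A B t"
  moreover have "s \<in> tensor_class A B s"
    by (simp add: tensor_class_def pm.span_zero)
  ultimately show "s - t \<in> null"
    by (simp add: tensor_class_def)
next
  assume st: "s - t \<in> null"
  have "r - s \<in> null \<longleftrightarrow> r - t \<in> null" for r
    using pm.span_add[OF _ st, of "r - s"] pm.span_diff[OF _ st, of "r - t"] by auto
  then show "tensor_class A B s = tensor_class A B t"
    by (simp add: tensor_class_def)
qed

lemma tensor_class_self: "s \<in> tensor_class A B s"
  by (simp add: tensor_class_def pm.span_zero)

lemma tensor_class_pairs:
  assumes "t \<in> pairs" "s \<in> tensor_class A B t"
  shows "s \<in> pairs"
  using assms pairs_add[of "s - t" t] null_pairs[of "s - t"] by (simp add: tensor_class_def)

lemma tensor_prod_simps: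
  "carrier AB = tensor_class A B ` pairs"
  "\<one>\<^bsub>AB\<^esub> = pure_tensor A B \<one>\<^bsub>A\<^esub> \<one>\<^bsub>B\<^esub>"
  "\<zero>\<^bsub>AB\<^esub> = tensor_class A B 0"
  by (simp_all add: tensor_algebra_prod_def pairs_def)

text \<open>The operations of the tensor product are unions over all representatives. Each is constant
  on classes, so that the union is a single class.\<close>

lemma tensor_prod_ops:
  "monoid.mult AB = (\<lambda>X Y. \<Union>s\<in>X. \<Union>t\<in>Y. tensor_class A B (pair_mult A B s t))"
  "add AB = (\<lambda>X Y. \<Union>s\<in>X. \<Union>t\<in>Y. tensor_class A B (s + t))"
  "smult AB = (\<lambda>c X. \<Union>t\<in>X. tensor_class A B (pm_scale c t))"
  by (simp_all add: tensor_algebra_prod_def pair_mult_eq)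

lemma UN_constant_class:
  "x \<in> X \<Longrightarrow> (\<And>s. s \<in> X \<Longrightarrow> F s = C) \<Longrightarrow> (\<Union>s\<in>X. F s) = C"
  by auto

lemma tensor_class_add:
  "tensor_class A B s \<oplus>\<^bsub>AB\<^esub> tensor_class A B t = tensor_class A B (s + t)"
proof -
  have "tensor_class A B (s' + t') = tensor_class A B (s + t)"
    if "s' \<in> tensor_class A B s" "t' \<in> tensor_class A B t" for s' t'
    using that pm.span_add[of "s' - s" _ "t' - t"]
    by (simp add: tensor_class_eq_iff) (simp add: tensor_class_def algebra_simps)
  then show ?thesis
    unfolding tensor_prod_ops
    by (intro UN_constant_class[OF tensor_class_self]) blast
qed

lemma tensor_class_smult:
  "c \<odot>\<^bsub>AB\<^esub> tensor_class A B t = tensor_class A B (pm_scale c t)"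
proof -
  have "tensor_class A B (pm_scale c t') = tensor_class A B (pm_scale c t)"
    if "t' \<in> tensor_class A B t" for t'
    using that pm.span_scale[of "t' - t" _ c]
    by (simp add: tensor_class_eq_iff) (simp add: tensor_class_def pm.scale_right_diff_distrib)
  then show ?thesis
    unfolding tensor_prod_ops
    by (intro UN_constant_class[OF tensor_class_self]) blast
qed

lemma tensor_class_mult:
  assumes "s \<in> pairs" "t \<in> pairs"
  shows "tensor_class A B s \<otimes>\<^bsub>AB\<^esub> tensor_class A B t = tensor_class A B (pair_mult A B s t)"
proof -
  have "tensor_class A B (pair_mult A B s' t') = tensor_class A B (pair_mult A B s t)"
    if s': "s' \<in> tensor_class A B s" and t': "t' \<in> tensor_class A B t" for s' t'
  proof -
    have "pair_mult A B (s' - s) t' \<in> null" "pair_mult A B s (t' - t) \<in> null"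
      using null_mult_right null_mult_left tensor_class_pairs[OF assms(2) t'] assms(1) s' t'
      by (auto simp: tensor_class_def)
    from pm.span_add[OF this] show ?thesis
      by (simp add: tensor_class_eq_iff pair_mult_diff_left pair_mult_diff_right)
  qed
  then show ?thesis
    unfolding tensor_prod_ops
    by (intro UN_constant_class[OF tensor_class_self]) blast
qed

lemma tensor_class_hom: "tensor_class A B \<in> alg_hom (pair_algebra A B) AB"
  by (rule alg_homI) (auto simp: pair_algebra_def tensor_prod_simps tensor_class_add
      tensor_class_smult tensor_class_mult pure_tensor_def simp flip: pairs_def)

lemma assoc_algebra_tensor: "assoc_algebra AB"
  by (rule assoc_algebra_image[OF assoc_algebra_pair _ tensor_class_hom])
    (simp_all add: pair_algebra_def tensor_prod_simps flip: pairs_def)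

sublocale AB: assoc_algebra AB
  by (rule assoc_algebra_tensor)

lemma pure_tensor_closed [simp]:
  "a \<in> carrier A \<Longrightarrow> b \<in> carrier B \<Longrightarrow> pure_tensor A B a b \<in> carrier AB"
  by (simp add: pure_tensor_def tensor_prod_simps pairs_single)

lemma pure_tensor_mult:
  assumes "a \<in> carrier A" "b \<in> carrier B" "a' \<in> carrier A" "b' \<in> carrier B"
  shows "pure_tensor A B a b \<otimes>\<^bsub>AB\<^esub> pure_tensor A B a' b' = pure_tensor A B (a \<otimes>\<^bsub>A\<^esub> a') (b \<otimes>\<^bsub>B\<^esub> b')"
  using assms by (simp add: pure_tensor_def tensor_class_mult pairs_single)

lemma pure_tensor_bilinear: "bilinear_on A B AB (pure_tensor A B)"
proof (intro bilinear_onI linear_onI)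
  fix a a' b assume "a \<in> carrier A" "a' \<in> carrier A" "b \<in> carrier B"
  then show "pure_tensor A B (a \<oplus>\<^bsub>A\<^esub> a') b = pure_tensor A B a b \<oplus>\<^bsub>AB\<^esub> pure_tensor A B a' b"
    using null_add_left[of a a' b 1]
    by (simp add: pure_tensor_def tensor_class_add tensor_class_eq_iff diff_diff_eq)
next
  fix a b b' assume "a \<in> carrier A" "b \<in> carrier B" "b' \<in> carrier B"
  then show "pure_tensor A B a (b \<oplus>\<^bsub>B\<^esub> b') = pure_tensor A B a b \<oplus>\<^bsub>AB\<^esub> pure_tensor A B a b'"
    using null_add_right[of a b b' 1]
    by (simp add: pure_tensor_def tensor_class_add tensor_class_eq_iff diff_diff_eq)
next
  fix c a b assume "a \<in> carrier A" "b \<in> carrier B"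
  then show "pure_tensor A B (c \<odot>\<^bsub>A\<^esub> a) b = c \<odot>\<^bsub>AB\<^esub> pure_tensor A B a b"
    and "pure_tensor A B a (c \<odot>\<^bsub>B\<^esub> b) = c \<odot>\<^bsub>AB\<^esub> pure_tensor A B a b"
    using null_smult_left[of a b c 1] null_smult_right[of a b c 1]
    by (simp_all add: pure_tensor_def tensor_class_smult tensor_class_eq_iff)
qed simp_all

text \<open>Scalars are absorbed by the first factor, so sums of pure tensors are everything.\<close>

lemma tensor_induct [consumes 1, case_names pure add]:
  assumes "x \<in> carrier AB"
    and pure: "\<And>a b. a \<in> carrier A \<Longrightarrow> b \<in> carrier B \<Longrightarrow> P (pure_tensor A B a b)"
    and add: "\<And>x y. x \<in> carrier AB \<Longrightarrow> y \<in> carrier AB \<Longrightarrow> P x \<Longrightarrow> P y \<Longrightarrow> P (x \<oplus>\<^bsub>AB\<^esub> y)"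
  shows "P x"
proof -
  obtain t where x: "x = tensor_class A B t" and "t \<in> pairs"
    using assms(1) by (auto simp: tensor_prod_simps)
  from this(2) have "P (tensor_class A B t)"
  proof (induction t rule: pairs_induct)
    case (single a b c)
    have "tensor_class A B (Poly_Mapping.single (a, b) c) = c \<odot>\<^bsub>AB\<^esub> pure_tensor A B a b"
      by (simp add: pure_tensor_def tensor_class_smult)
    also have "\<dots> = pure_tensor A B (c \<odot>\<^bsub>A\<^esub> a) b"
      using single bilinear_onD(4)[OF pure_tensor_bilinear] by simp
    finally show ?case
      using single pure by simp
  next
    case (add s t)
    have "tensor_class A B r \<in> carrier AB" if "r \<in> pairs" for r
      using that by (auto simp: tensor_prod_simps)
    from assms(3)[OF this[OF add.hyps(1)] this[OF add.hyps(2)] add.IH] show ?case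
      by (simp add: tensor_class_add)
  qed
  then show ?thesis
    by (simp add: x)
qed

context
  fixes M :: "('k, 'c, 'l) module_scheme" and \<beta>
  assumes M: "assoc_algebra M" and \<beta>: "bilinear_on A B M \<beta>"
begin

interpretation M: assoc_algebra M
  by (rule M)

lemma case_prod_funcset: "case_prod \<beta> \<in> carrier A \<times> carrier B \<rightarrow> carrier M"
  using bilinear_onD(1)[OF \<beta>] by auto

lemma lincomb_pairs_closed: "s \<in> pairs \<Longrightarrow> lincomb M (case_prod \<beta>) s \<in> carrier M"
  by (rule M.lincomb_closed) (use case_prod_funcset in \<open>auto simp: pairs_def Pi_iff\<close>)

lemma lincomb_pairs_add:
  "s \<in> pairs \<Longrightarrow> t \<in> pairs \<Longrightarrow>
    lincomb M (case_prod \<beta>) (s + t) = lincomb M (case_prod \<beta>) s \<oplus>\<^bsub>M\<^esub> lincomb M (case_prod \<beta>) t"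
  unfolding pairs_def mem_Collect_eq by (rule M.lincomb_add[OF _ _ case_prod_funcset])

lemma lincomb_pairs_smult:
  "s \<in> pairs \<Longrightarrow> lincomb M (case_prod \<beta>) (pm_scale c s) = c \<odot>\<^bsub>M\<^esub> lincomb M (case_prod \<beta>) s"
  by (rule M.lincomb_smult) (use case_prod_funcset in \<open>auto simp: pairs_def Pi_iff\<close>)

text \<open>A bilinear map vanishes on the relations. So all representatives of a class have the same
  image, and the set inside \<^const>\<open>tensor_lift\<close> is a singleton.\<close>

lemma lincomb_null:
  assumes "s \<in> null" shows "lincomb M (case_prod \<beta>) s = \<zero>\<^bsub>M\<^esub>"
proof -
  note \<beta>' = bilinear_onD[OF \<beta>]
  have diff: "lincomb M (case_prod \<beta>) (s - t) = lincomb M (case_prod \<beta>) s \<ominus>\<^bsub>M\<^esub> lincomb M (case_prod \<beta>) t"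
    if "s \<in> pairs" "t \<in> pairs" for s t
    using that by (intro M.lincomb_diff[OF _ _ case_prod_funcset]) (auto simp: pairs_def)
  note simps = diff pairs_diff pairs_single M.lincomb_single \<beta>' M.add_diff_diff M.diff_self
  from assms have "s \<in> pairs \<and> lincomb M (case_prod \<beta>) s = \<zero>\<^bsub>M\<^esub>"
  proof (rule null_minimal)
    fix a a' b assume "a \<in> carrier A" "a' \<in> carrier A" "b \<in> carrier B"
    then show "Poly_Mapping.single (a \<oplus>\<^bsub>A\<^esub> a', b) 1 - Poly_Mapping.single (a, b) 1
        - Poly_Mapping.single (a', b) 1 \<in> pairs \<and>
      lincomb M (case_prod \<beta>) (Poly_Mapping.single (a \<oplus>\<^bsub>A\<^esub> a', b) 1 - Poly_Mapping.single (a, b) 1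
        - Poly_Mapping.single (a', b) 1) = \<zero>\<^bsub>M\<^esub>"
      by (simp add: simps)
  next
    fix a b b' assume "a \<in> carrier A" "b \<in> carrier B" "b' \<in> carrier B"
    then show "Poly_Mapping.single (a, b \<oplus>\<^bsub>B\<^esub> b') 1 - Poly_Mapping.single (a, b) 1
        - Poly_Mapping.single (a, b') 1 \<in> pairs \<and>
      lincomb M (case_prod \<beta>) (Poly_Mapping.single (a, b \<oplus>\<^bsub>B\<^esub> b') 1 - Poly_Mapping.single (a, b) 1
        - Poly_Mapping.single (a, b') 1) = \<zero>\<^bsub>M\<^esub>"
      by (simp add: simps)
  next
    fix c a b assume "a \<in> carrier A" "b \<in> carrier B"
    then show "Poly_Mapping.single (c \<odot>\<^bsub>A\<^esub> a, b) 1 - Poly_Mapping.single (a, b) c \<in> pairs \<and>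
        lincomb M (case_prod \<beta>) (Poly_Mapping.single (c \<odot>\<^bsub>A\<^esub> a, b) 1 - Poly_Mapping.single (a, b) c) = \<zero>\<^bsub>M\<^esub>"
      and "Poly_Mapping.single (a, c \<odot>\<^bsub>B\<^esub> b) 1 - Poly_Mapping.single (a, b) c \<in> pairs \<and>
        lincomb M (case_prod \<beta>) (Poly_Mapping.single (a, c \<odot>\<^bsub>B\<^esub> b) 1 - Poly_Mapping.single (a, b) c) = \<zero>\<^bsub>M\<^esub>"
      by (simp_all add: simps)
  next
    fix s t assume "s \<in> pairs \<and> lincomb M (case_prod \<beta>) s = \<zero>\<^bsub>M\<^esub>" "t \<in> pairs \<and> lincomb M (case_prod \<beta>) t = \<zero>\<^bsub>M\<^esub>"
    then show "s + t \<in> pairs \<and> lincomb M (case_prod \<beta>) (s + t) = \<zero>\<^bsub>M\<^esub>"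
      using lincomb_pairs_add by (simp add: pairs_add)
  next
    fix c s assume "s \<in> pairs \<and> lincomb M (case_prod \<beta>) s = \<zero>\<^bsub>M\<^esub>"
    then show "pm_scale c s \<in> pairs \<and> lincomb M (case_prod \<beta>) (pm_scale c s) = \<zero>\<^bsub>M\<^esub>"
      using lincomb_pairs_smult by (simp add: pairs_scale)
  qed (simp add: pairs_zero)
  then show ?thesis
    by blast
qed

lemma tensor_lift_class:
  assumes t: "t \<in> pairs"
  shows "tensor_lift M \<beta> (tensor_class A B t) = lincomb M (case_prod \<beta>) t"
proof -
  have eq: "lincomb M (case_prod \<beta>) s = lincomb M (case_prod \<beta>) t" if s: "s \<in> tensor_class A B t" for s
  proof -
    have "s - t \<in> null"
      using s by (simp add: tensor_class_def)
    then show ?thesis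
      using lincomb_pairs_add[of "s - t" t] lincomb_null[of "s - t"] null_pairs[of "s - t"] t
        lincomb_pairs_closed[OF t] by simp
  qed
  have "(\<lambda>(a, b). Poly_Mapping.lookup s (a, b) \<odot>\<^bsub>M\<^esub> \<beta> a b) =
      (\<lambda>k. Poly_Mapping.lookup s k \<odot>\<^bsub>M\<^esub> case_prod \<beta> k)" for s
    by auto
  then have "tensor_lift M \<beta> (tensor_class A B t) = the_elem (lincomb M (case_prod \<beta>) ` tensor_class A B t)"
    by (simp add: tensor_lift_def lincomb_def)
  also have "lincomb M (case_prod \<beta>) ` tensor_class A B t = {lincomb M (case_prod \<beta>) t}"
    using eq tensor_class_self[of t] by blast
  finally show ?thesis
    by simp
qed

lemma tensor_lift_linear: "linear_on AB M (tensor_lift M \<beta>)"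
  by (rule linear_onI)
    (auto simp: tensor_prod_simps tensor_class_add tensor_class_smult tensor_lift_class pairs_add pairs_scale
      lincomb_pairs_add lincomb_pairs_smult lincomb_pairs_closed)

lemma tensor_lift_pure:
  "a \<in> carrier A \<Longrightarrow> b \<in> carrier B \<Longrightarrow> tensor_lift M \<beta> (pure_tensor A B a b) = \<beta> a b"
  using bilinear_onD(1)[OF \<beta>]
  by (simp add: pure_tensor_def tensor_lift_class pairs_single M.lincomb_single)

text \<open>Both sides of multiplicativity are bilinear in the two factors, so pure tensors suffice.\<close>

lemma tensor_lift_hom:
  assumes mult: "\<And>a b a' b'. a \<in> carrier A \<Longrightarrow> b \<in> carrier B \<Longrightarrow> a' \<in> carrier A \<Longrightarrow> b' \<in> carrier B \<Longrightarrow>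
      \<beta> (a \<otimes>\<^bsub>A\<^esub> a') (b \<otimes>\<^bsub>B\<^esub> b') = \<beta> a b \<otimes>\<^bsub>M\<^esub> \<beta> a' b'"
    and one: "\<beta> \<one>\<^bsub>A\<^esub> \<one>\<^bsub>B\<^esub> = \<one>\<^bsub>M\<^esub>"
  shows "tensor_lift M \<beta> \<in> alg_hom AB M"
proof (rule alg_homI)
  note lin = linear_onD[OF tensor_lift_linear]
  fix x y assume x: "x \<in> carrier AB" and y: "y \<in> carrier AB"
  show "tensor_lift M \<beta> (x \<otimes>\<^bsub>AB\<^esub> y) = tensor_lift M \<beta> x \<otimes>\<^bsub>M\<^esub> tensor_lift M \<beta> y"
    using x
  proof (induction x rule: tensor_induct)
    case (pure a b)
    note ab = this
    show ?case
      using y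
    proof (induction y rule: tensor_induct)
      case (pure a' b')
      then show ?case
        using ab by (simp add: pure_tensor_mult tensor_lift_pure mult)
    next
      case (add y y')
      then show ?case
        using ab by (simp add: lin AB.r_distr M.r_distr)
    qed
  next
    case (add x x')
    then show ?case
      using y by (simp add: lin AB.l_distr M.l_distr)
  qed
qed (simp_all add: linear_onD[OF tensor_lift_linear] tensor_prod_simps(2) tensor_lift_pure one)

end

end

lemma algebra_pairI: "assoc_algebra A \<Longrightarrow> assoc_algebra B \<Longrightarrow> algebra_pair A B"
  by (simp add: algebra_pair_def)

lemma tensor_map_props:
  assumes A: "assoc_algebra A" and B: "assoc_algebra B" and C: "assoc_algebra C" and D: "assoc_algebra D"
    and f: "f \<in> alg_hom A C" and g: "g \<in> alg_hom B D"
  shows tensor_map_hom: "tensor_map C D f g \<in> alg_hom (tensor_algebra_prod A B) (tensor_algebra_prod C D)"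
    and tensor_map_pure: "\<And>a b. a \<in> carrier A \<Longrightarrow> b \<in> carrier B \<Longrightarrow>
      tensor_map C D f g (pure_tensor A B a b) = pure_tensor C D (f a) (g b)"
proof -
  interpret AB: algebra_pair A B by (rule algebra_pairI) fact+
  interpret CD: algebra_pair C D by (rule algebra_pairI) fact+
  note f = alg_homD[OF f] and g = alg_homD[OF g] and pure = bilinear_onD[OF CD.pure_tensor_bilinear]
  have bil: "bilinear_on A B (tensor_algebra_prod C D) (\<lambda>a b. pure_tensor C D (f a) (g b))"
    by (intro bilinear_onI linear_onI) (simp_all add: f g pure)
  show "tensor_map C D f g \<in> alg_hom (tensor_algebra_prod A B) (tensor_algebra_prod C D)"
    unfolding tensor_map_def
    by (rule AB.tensor_lift_hom[OF CD.assoc_algebra_tensor bil])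
      (simp_all add: f g CD.pure_tensor_mult CD.tensor_prod_simps(2))
  show "tensor_map C D f g (pure_tensor A B a b) = pure_tensor C D (f a) (g b)"
    if "a \<in> carrier A" "b \<in> carrier B" for a b
    unfolding tensor_map_def using that
    by (rule AB.tensor_lift_pure[OF CD.assoc_algebra_tensor bil])
qed

text \<open>The associativity isomorphism is a nested lift.  The inner lift is itself bilinear and
  multiplicative jointly in the tensor \<open>x\<close> and in \<open>c\<close>, which is what the outer lift needs.\<close>

lemma tensor_assoc_props:
  assumes A: "assoc_algebra A" and B: "assoc_algebra B" and C: "assoc_algebra C"
  shows tensor_assoc_hom: "tensor_assoc A B C \<in>
      alg_hom (tensor_algebra_prod (tensor_algebra_prod A B) C) (tensor_algebra_prod A (tensor_algebra_prod B C))"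
    and tensor_assoc_pure: "\<And>a b c. a \<in> carrier A \<Longrightarrow> b \<in> carrier B \<Longrightarrow> c \<in> carrier C \<Longrightarrow>
      tensor_assoc A B C (pure_tensor (tensor_algebra_prod A B) C (pure_tensor A B a b) c) =
      pure_tensor A (tensor_algebra_prod B C) a (pure_tensor B C b c)"
proof -
  interpret AB: algebra_pair A B by (rule algebra_pairI) fact+
  interpret BC: algebra_pair B C by (rule algebra_pairI) fact+
  interpret AB_C: algebra_pair AB.AB C by (rule algebra_pairI[OF AB.assoc_algebra_tensor C])
  interpret A_BC: algebra_pair A BC.AB by (rule algebra_pairI[OF A BC.assoc_algebra_tensor])
  let ?T = "A_BC.AB"
  let ?i = "\<lambda>c a b. pure_tensor A BC.AB a (pure_tensor B C b c)"
  let ?j = "\<lambda>x c. tensor_lift ?T (?i c) x"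
  note p1 = bilinear_onD[OF BC.pure_tensor_bilinear] and p2 = bilinear_onD[OF A_BC.pure_tensor_bilinear]
  have T: "assoc_algebra ?T"
    by (rule A_BC.assoc_algebra_tensor)
  have bil: "bilinear_on A B ?T (?i c)" if "c \<in> carrier C" for c
    using that by (intro bilinear_onI linear_onI) (simp_all add: p1 p2)
  note lin = linear_onD[OF AB.tensor_lift_linear[OF T bil]]
    and lift_pure = AB.tensor_lift_pure[OF T bil]
  have add: "?j x (c \<oplus>\<^bsub>C\<^esub> c') = ?j x c \<oplus>\<^bsub>?T\<^esub> ?j x c'"
    if "x \<in> carrier AB.AB" "c \<in> carrier C" "c' \<in> carrier C" for x c c'
    using that(1)
  proof (induction x rule: AB.tensor_induct)
    case (pure a b)
    then show ?case using that(2,3) by (simp add: lift_pure p1 p2)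
  next
    case (add x y)
    then show ?case using that(2,3) by (simp add: lin A_BC.AB.a_ac)
  qed
  have smult: "?j x (k \<odot>\<^bsub>C\<^esub> c) = k \<odot>\<^bsub>?T\<^esub> ?j x c" if "x \<in> carrier AB.AB" "c \<in> carrier C" for x k c
    using that(1)
  proof (induction x rule: AB.tensor_induct)
    case (pure a b)
    then show ?case using that(2) by (simp add: lift_pure p1 p2)
  next
    case (add x y)
    then show ?case using that(2) by (simp add: lin A_BC.AB.smult_add_right)
  qed
  have outer: "bilinear_on AB.AB C ?T ?j"
    by (intro bilinear_onI linear_onI) (simp_all add: lin add smult)
  have mult: "?j (x \<otimes>\<^bsub>AB.AB\<^esub> y) (c \<otimes>\<^bsub>C\<^esub> d) = ?j x c \<otimes>\<^bsub>?T\<^esub> ?j y d"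
    if "x \<in> carrier AB.AB" "c \<in> carrier C" "y \<in> carrier AB.AB" "d \<in> carrier C" for x y c d
    using that(1)
  proof (induction x rule: AB.tensor_induct)
    case (pure a b)
    note ab = this
    show ?case
      using that(3)
    proof (induction y rule: AB.tensor_induct)
      case (pure a' b')
      then show ?case
        using ab that(2,4) by (simp add: AB.pure_tensor_mult lift_pure BC.pure_tensor_mult A_BC.pure_tensor_mult)
    next
      case (add y y')
      then show ?case
        using ab that(2,4) by (simp add: lin AB.AB.r_distr A_BC.AB.r_distr)
    qed
  next
    case (add x x')
    then show ?case
      using that(2-4) by (simp add: lin AB.AB.l_distr A_BC.AB.l_distr)
  qed
  have eq: "tensor_assoc A B C = tensor_lift ?T ?j"
    by (simp add: tensor_assoc_def Let_def)
  show "tensor_assoc A B C \<in> alg_hom AB_C.AB ?T"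
    unfolding eq
    by (rule AB_C.tensor_lift_hom[OF T outer])
      (simp_all add: mult AB.tensor_prod_simps(2) BC.tensor_prod_simps(2) A_BC.tensor_prod_simps(2) lift_pure)
  show "tensor_assoc A B C (pure_tensor AB.AB C (pure_tensor A B a b) c) = pure_tensor A BC.AB a (pure_tensor B C b c)"
    if "a \<in> carrier A" "b \<in> carrier B" "c \<in> carrier C" for a b c
    unfolding eq using that by (simp add: AB_C.tensor_lift_pure[OF T outer] lift_pure)
qed

section \<open>Algebras generated by primitive elements\<close>

abbreviation word :: "('k, 'a, 'm) module_scheme \<Rightarrow> ('v \<Rightarrow> 'a) \<Rightarrow> 'v list \<Rightarrow> 'a" where
  "word A \<iota> xs \<equiv> foldr (monoid.mult A) (map \<iota> xs) \<one>\<^bsub>A\<^esub>"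

definition homogeneous_words ::
  "('k, 'a, 'm) module_scheme \<Rightarrow> ('v \<Rightarrow> 'a) \<Rightarrow> (bit \<Rightarrow> 'v set) \<Rightarrow> bit \<Rightarrow> 'a set" where
  "homogeneous_words A \<iota> gr i =
     {word A \<iota> xs | xs ds. list_all2 (\<lambda>x d. x \<in> gr d) xs ds \<and> sum_list ds = i}"

locale generated_algebra = assoc_algebra A
  for A :: "('k::field, 'a, 'm) module_scheme" (structure) +
  fixes \<iota> :: "'v \<Rightarrow> 'a"
  assumes gen_closed [simp]: "\<iota> x \<in> carrier A"
    and generated: "carrier A = linear_span A (range (word A \<iota>))"
begin

lemma word_closed [simp]: "word A \<iota> xs \<in> carrier A"
  by (induction xs) auto

lemma word_append: "word A \<iota> (xs @ ys) = word A \<iota> xs \<otimes> word A \<iota> ys"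
  by (induction xs) (simp_all add: m_assoc)

lemma generated_induct [consumes 1, case_names one mult add smult]:
  assumes "x \<in> carrier A"
    and one: "P \<one>" and mult: "\<And>v w. w \<in> carrier A \<Longrightarrow> P w \<Longrightarrow> P (\<iota> v \<otimes> w)"
    and add: "\<And>x y. x \<in> carrier A \<Longrightarrow> y \<in> carrier A \<Longrightarrow> P x \<Longrightarrow> P y \<Longrightarrow> P (x \<oplus> y)"
    and smult: "\<And>c x. x \<in> carrier A \<Longrightarrow> P x \<Longrightarrow> P (c \<odot> x)"
  shows "P x"
proof -
  have "x \<in> linear_span A (range (word A \<iota>))"
    using assms(1) generated by simp
  moreover have "range (word A \<iota>) \<subseteq> carrier A"
    by auto
  ultimately show ?thesis
  proof (induction x rule: linear_span_induct)
    case (base x)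
    then obtain xs where x: "x = word A \<iota> xs"
      by blast
    show ?case
      unfolding x by (induction xs) (use one mult in auto)
  next
    case zero
    show ?case
      using smult[of \<one> 0] one by simp
  qed (use add smult in auto)
qed

lemma generated_hom_eqI:
  assumes "f \<in> alg_hom A B" "g \<in> alg_hom A B" "\<And>v. f (\<iota> v) = g (\<iota> v)" "x \<in> carrier A"
  shows "f x = g x"
  using assms(4)
  by (induction x rule: generated_induct)
    (simp_all add: assms(3) alg_homD[OF assms(1)] alg_homD[OF assms(2)])

lemma generated_hom_unique:
  assumes "f \<in> extensional (carrier A)" "f \<in> alg_hom A B"
    and "g \<in> extensional (carrier A)" "g \<in> alg_hom A B" "\<And>v. f (\<iota> v) = g (\<iota> v)"
  shows "f = g"
  using assms generated_hom_eqI by (metis extensionalityI)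

lemma homogeneous_words_closed: "homogeneous_words A \<iota> gr i \<subseteq> carrier A"
  by (auto simp: homogeneous_words_def)

lemma homogeneous_words_induct [consumes 1, case_names Nil Cons]:
  assumes "x \<in> homogeneous_words A \<iota> gr i"
    and "P \<one> 0"
    and "\<And>v d w i. v \<in> gr d \<Longrightarrow> w \<in> homogeneous_words A \<iota> gr i \<Longrightarrow> P w i \<Longrightarrow> P (\<iota> v \<otimes> w) (d + i)"
  shows "P x i"
proof -
  obtain xs ds where x: "x = word A \<iota> xs" and i: "sum_list ds = i" and l: "list_all2 (\<lambda>x d. x \<in> gr d) xs ds"
    using assms(1) by (auto simp: homogeneous_words_def)
  from l have "P (word A \<iota> xs) (sum_list ds)"
  proof (induction rule: list_all2_induct)
    case Nil
    then show ?case using assms(2) by simp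
  next
    case (Cons v xs d ds)
    then have "word A \<iota> xs \<in> homogeneous_words A \<iota> gr (sum_list ds)"
      by (auto simp: homogeneous_words_def)
    then show ?case using Cons assms(3) by simp
  qed
  then show ?thesis by (simp add: x i)
qed

lemma homogeneous_words_one: "\<one> \<in> homogeneous_words A \<iota> gr 0"
  unfolding homogeneous_words_def by (rule CollectI, intro exI[of _ "[]"]) simp

lemma homogeneous_words_gen: "v \<in> gr d \<Longrightarrow> \<iota> v \<in> homogeneous_words A \<iota> gr d"
  unfolding homogeneous_words_def by (rule CollectI, intro exI[of _ "[v]"] exI[of _ "[d]"]) simp

lemma homogeneous_words_mult:
  assumes "x \<in> homogeneous_words A \<iota> gr i" "y \<in> homogeneous_words A \<iota> gr j"
  shows "x \<otimes> y \<in> homogeneous_words A \<iota> gr (i + j)"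
proof -
  obtain xs ds ys es where "x = word A \<iota> xs" "sum_list ds = i" "list_all2 (\<lambda>x d. x \<in> gr d) xs ds"
    and "y = word A \<iota> ys" "sum_list es = j" "list_all2 (\<lambda>x d. x \<in> gr d) ys es"
    using assms by (auto simp: homogeneous_words_def)
  then show ?thesis
    unfolding homogeneous_words_def
    by (intro CollectI exI[of _ "xs @ ys"] exI[of _ "ds @ es"])
      (simp add: list_all2_appendI del: map_append flip: word_append)
qed

end

text \<open>The structure maps are given here by their values on generators; the theorem below is that
  these values already force the axioms. The grading by spans of homogeneous words is direct only if
  no relation mixes parities. The homomorphism into \<^const>\<open>parity_algebra\<close> witnesses this; in
  characteristic 2 the eigenspaces of the involution \<open>\<plusminus>1\<close> are not available for it.\<close>

locale primitively_generated =
  generated_algebra H \<iota> + graded_vector_space scale gr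
  for H :: "('k::field, 'a) hopf" (structure) and \<iota> :: "'v::ab_group_add \<Rightarrow> 'a"
    and scale :: "'k \<Rightarrow> 'v \<Rightarrow> 'v" and gr :: "bit \<Rightarrow> 'v set" +
  assumes gen_add: "\<iota> (x + y) = \<iota> x \<oplus> \<iota> y"
    and comult_alg_hom: "comult H \<in> alg_hom H (tensor_algebra_prod H H)"
    and comult_gen: "comult H (\<iota> x) =
      pure_tensor H H (\<iota> x) \<one> \<oplus>\<^bsub>tensor_algebra_prod H H\<^esub> pure_tensor H H \<one> (\<iota> x)"
    and counit_alg_hom: "counit H \<in> alg_hom H ground_algebra"
    and counit_gen: "counit H (\<iota> x) = 0"
    and antipode_alg_hom: "antipode H \<in> alg_hom H (opposite_algebra H)"
    and antipode_gen: "antipode H (\<iota> x) = \<ominus> \<iota> x"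
    and grade_eq: "grade H i = linear_span H (homogeneous_words H \<iota> gr i)"
    and parity_hom: "\<exists>\<psi> \<in> alg_hom H (parity_algebra H).
      (\<forall>x\<in>gr 0. \<psi> (\<iota> x) = (\<iota> x, \<zero>)) \<and> (\<forall>x\<in>gr 1. \<psi> (\<iota> x) = (\<zero>, \<iota> x))"
begin

sublocale HH: algebra_pair H H
  by (rule algebra_pairI; rule assoc_algebra_axioms)

lemma is_algebra: "assoc_algebra H"
  by (rule assoc_algebra_axioms)

lemmas pure = bilinear_onD[OF HH.pure_tensor_bilinear]
lemmas comult = alg_homD[OF comult_alg_hom]
lemmas counit = alg_homD[OF counit_alg_hom, unfolded ground_algebra_def, simplified]
lemmas antipode = alg_homD[OF antipode_alg_hom, simplified]

text \<open>Both sides are algebra homomorphisms to the triple tensor product, so it is enough to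
  compare them on a generator \<open>x\<close>: there both are the sum of the three tensors with \<open>x\<close> in one
  place and \<open>1\<close> in the others.\<close>

lemma comult_coassoc:
  assumes "x \<in> carrier H"
  shows "tensor_assoc H H H (tensor_map HH.AB H (comult H) id (comult H x)) =
    tensor_map H HH.AB id (comult H) (comult H x)"
proof -
  interpret HH_H: algebra_pair HH.AB H
    by (rule algebra_pairI[OF HH.assoc_algebra_tensor is_algebra])
  interpret H_HH: algebra_pair H HH.AB
    by (rule algebra_pairI[OF is_algebra HH.assoc_algebra_tensor])
  have id: "id \<in> alg_hom H H"
    using alg_hom_id[of H] by (simp add: id_def)
  note lmap = tensor_map_hom[OF is_algebra is_algebra HH.assoc_algebra_tensor is_algebra comult_alg_hom id]
    and rmap = tensor_map_hom[OF is_algebra is_algebra is_algebra HH.assoc_algebra_tensor id comult_alg_hom]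
    and lpure = tensor_map_pure[OF is_algebra is_algebra HH.assoc_algebra_tensor is_algebra comult_alg_hom id]
    and rpure = tensor_map_pure[OF is_algebra is_algebra is_algebra HH.assoc_algebra_tensor id comult_alg_hom]
    and assoc = tensor_assoc_hom[OF is_algebra is_algebra is_algebra]
  show ?thesis
  proof (rule generated_hom_eqI[OF _ _ _ assms])
    show "(\<lambda>x. tensor_assoc H H H (tensor_map HH.AB H (comult H) id (comult H x))) \<in> alg_hom H H_HH.AB"
      by (rule alg_hom_comp[OF alg_hom_comp[OF comult_alg_hom lmap] assoc])
    show "(\<lambda>x. tensor_map H HH.AB id (comult H) (comult H x)) \<in> alg_hom H H_HH.AB"
      by (rule alg_hom_comp[OF comult_alg_hom rmap])
    fix v
    note p1 = bilinear_onD[OF HH_H.pure_tensor_bilinear] and p2 = bilinear_onD[OF H_HH.pure_tensor_bilinear]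
    let ?e = "pure_tensor H HH.AB"
    have "tensor_assoc H H H (tensor_map HH.AB H (comult H) id (comult H (\<iota> v))) =
        ?e (\<iota> v) (pure_tensor H H \<one> \<one>) \<oplus>\<^bsub>H_HH.AB\<^esub> ?e \<one> (pure_tensor H H (\<iota> v) \<one>) \<oplus>\<^bsub>H_HH.AB\<^esub>
        ?e \<one> (pure_tensor H H \<one> (\<iota> v))"
      by (simp add: comult_gen alg_homD[OF lmap] lpure comult(4) HH.tensor_prod_simps(2) p1 p2
          alg_homD[OF assoc] tensor_assoc_pure[OF is_algebra is_algebra is_algebra])
    also have "\<dots> = tensor_map H HH.AB id (comult H) (comult H (\<iota> v))"
      by (simp add: comult_gen alg_homD[OF rmap] rpure comult(4) HH.tensor_prod_simps(2) p2 H_HH.AB.a_assoc)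
    finally show "tensor_assoc H H H (tensor_map HH.AB H (comult H) id (comult H (\<iota> v))) =
        tensor_map H HH.AB id (comult H) (comult H (\<iota> v))" .
  qed
qed

lemma comult_counit:
  assumes "x \<in> carrier H"
  shows "tensor_lift H (\<lambda>a b. counit H a \<odot> b) (comult H x) = x"
    and "tensor_lift H (\<lambda>a b. counit H b \<odot> a) (comult H x) = x"
proof -
  have bil: "bilinear_on H H H (\<lambda>a b. counit H a \<odot> b)" "bilinear_on H H H (\<lambda>a b. counit H b \<odot> a)"
    by (intro bilinear_onI linear_onI;
        simp add: counit smult_add_left smult_add_right smult_smult mult.commute)+
  have hom: "tensor_lift H (\<lambda>a b. counit H a \<odot> b) \<in> alg_hom HH.AB H"
    "tensor_lift H (\<lambda>a b. counit H b \<odot> a) \<in> alg_hom HH.AB H"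
    by (rule HH.tensor_lift_hom[OF is_algebra bil(1)] HH.tensor_lift_hom[OF is_algebra bil(2)];
        simp add: counit smult_mult_left smult_mult_right smult_smult mult.commute)+
  note pure = HH.tensor_lift_pure[OF is_algebra bil(1)] HH.tensor_lift_pure[OF is_algebra bil(2)]
  show "tensor_lift H (\<lambda>a b. counit H a \<odot> b) (comult H x) = x"
    by (rule generated_hom_eqI[OF alg_hom_comp[OF comult_alg_hom hom(1)] alg_hom_id _ assms])
      (simp add: comult_gen alg_homD[OF hom(1)] pure counit counit_gen)
  show "tensor_lift H (\<lambda>a b. counit H b \<odot> a) (comult H x) = x"
    by (rule generated_hom_eqI[OF alg_hom_comp[OF comult_alg_hom hom(2)] alg_hom_id _ assms])
      (simp add: comult_gen alg_homD[OF hom(2)] pure counit counit_gen)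
qed

text \<open>Write \<open>F(a \<otimes> a') = S(a) a'\<close>. This map is not multiplicative, but
  \<open>F(X (b \<otimes> b')) = S(b) F(X) b'\<close>. As \<open>F\<close> vanishes on \<open>\<Delta>(v)\<close> for a generator \<open>v\<close>, it
  vanishes on \<open>\<Delta>(v) Y\<close> for every \<open>Y\<close>, in particular on \<open>\<Delta>(v w)\<close>. Thus \<open>F \<circ> \<Delta>\<close> and the
  counit agree on all words.\<close>

lemma comult_antipode_left:
  assumes "x \<in> carrier H"
  shows "tensor_lift H (\<lambda>a b. antipode H a \<otimes> b) (comult H x) = counit H x \<odot> \<one>"
proof -
  let ?F = "tensor_lift H (\<lambda>a b. antipode H a \<otimes> b)"
  have bil: "bilinear_on H H H (\<lambda>a b. antipode H a \<otimes> b)"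
    by (intro bilinear_onI linear_onI) (simp_all add: antipode l_distr r_distr smult_mult_left smult_mult_right)
  note lin = linear_onD[OF HH.tensor_lift_linear[OF is_algebra bil]] and lift_pure = HH.tensor_lift_pure[OF is_algebra bil]
  have mult_pure: "?F (X \<otimes>\<^bsub>HH.AB\<^esub> pure_tensor H H b b') = antipode H b \<otimes> ?F X \<otimes> b'"
    if "X \<in> carrier HH.AB" "b \<in> carrier H" "b' \<in> carrier H" for X b b'
    using that(1)
  proof (induction X rule: HH.tensor_induct)
    case (pure a a')
    then show ?case
      using that(2,3) by (simp add: HH.pure_tensor_mult lift_pure antipode m_assoc)
  next
    case (add X Y)
    then show ?case
      using that(2,3) by (simp add: HH.AB.l_distr lin l_distr r_distr antipode)
  qed
  have null: "?F (comult H (\<iota> v) \<otimes>\<^bsub>HH.AB\<^esub> Y) = \<zero>" if "Y \<in> carrier HH.AB" for v Y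
    using that
  proof (induction Y rule: HH.tensor_induct)
    case (pure b b')
    have "?F (comult H (\<iota> v)) = \<zero>"
      by (simp add: comult_gen lin lift_pure antipode antipode_gen l_neg)
    then show ?case
      using pure by (simp add: mult_pure comult antipode l_null r_null)
  next
    case (add X Y)
    then show ?case
      by (simp add: HH.AB.r_distr comult lin)
  qed
  show ?thesis
    using assms
    by (induction x rule: generated_induct)
      (simp_all add: comult counit counit_gen null HH.tensor_prod_simps(2) lift_pure antipode
        lin smult_add_left smult_smult)
qed

text \<open>The rule for \<open>G(a \<otimes> a') = a S(a')\<close> is \<open>G((b \<otimes> b') X) = b G(X) S(b')\<close>. It gives
  \<open>G(\<Delta>(v w)) = v G(\<Delta>(w)) - G(\<Delta>(w)) v\<close>, which is zero because by induction \<open>G(\<Delta>(w))\<close> is a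
  scalar.\<close>

lemma comult_antipode_right:
  assumes "x \<in> carrier H"
  shows "tensor_lift H (\<lambda>a b. a \<otimes> antipode H b) (comult H x) = counit H x \<odot> \<one>"
proof -
  let ?G = "tensor_lift H (\<lambda>a b. a \<otimes> antipode H b)"
  have bil: "bilinear_on H H H (\<lambda>a b. a \<otimes> antipode H b)"
    by (intro bilinear_onI linear_onI) (simp_all add: antipode l_distr r_distr smult_mult_left smult_mult_right)
  note lin = linear_onD[OF HH.tensor_lift_linear[OF is_algebra bil]] and lift_pure = HH.tensor_lift_pure[OF is_algebra bil]
  have pure_mult: "?G (pure_tensor H H b b' \<otimes>\<^bsub>HH.AB\<^esub> X) = b \<otimes> ?G X \<otimes> antipode H b'"
    if "X \<in> carrier HH.AB" "b \<in> carrier H" "b' \<in> carrier H" for X b b'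
    using that(1)
  proof (induction X rule: HH.tensor_induct)
    case (pure a a')
    then show ?case
      using that(2,3) by (simp add: HH.pure_tensor_mult lift_pure antipode m_assoc)
  next
    case (add X Y)
    then show ?case
      using that(2,3) by (simp add: HH.AB.r_distr lin l_distr r_distr antipode)
  qed
  show ?thesis
    using assms
  proof (induction x rule: generated_induct)
    case (mult v w)
    have "?G (comult H (\<iota> v \<otimes> w)) = \<iota> v \<otimes> ?G (comult H w) \<oplus> ?G (comult H w) \<otimes> antipode H (\<iota> v)"
      using mult.hyps by (simp add: comult comult_gen HH.AB.l_distr lin pure_mult antipode)
    also have "\<dots> = counit H w \<odot> \<iota> v \<oplus> \<ominus> (counit H w \<odot> \<iota> v)"
      using mult.IH by (simp add: smult_mult_left smult_mult_right antipode_gen minus_eq_smult smult_smult mult.commute)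
    finally show ?case
      using mult.hyps by (simp add: r_neg counit counit_gen)
  qed (simp_all add: comult counit HH.tensor_prod_simps(2) lift_pure antipode lin smult_add_left smult_smult)
qed

lemma grade_closed: "x \<in> grade H i \<Longrightarrow> x \<in> carrier H"
  unfolding grade_eq by (rule linear_span_closed[OF homogeneous_words_closed])

lemma grade_add: "x \<in> grade H i \<Longrightarrow> y \<in> grade H i \<Longrightarrow> x \<oplus> y \<in> grade H i"
  and grade_smult: "x \<in> grade H i \<Longrightarrow> c \<odot> x \<in> grade H i"
  and grade_zero: "\<zero> \<in> grade H i"
  unfolding grade_eq
  by (simp_all add: linear_span_add linear_span_smult linear_span_zero homogeneous_words_closed)

lemma grade_gen: "v \<in> gr i \<Longrightarrow> \<iota> v \<in> grade H i"
  unfolding grade_eq by (intro linear_span_base homogeneous_words_gen)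

lemma grade_one': "\<one> \<in> grade H 0"
  unfolding grade_eq by (intro linear_span_base homogeneous_words_one)

lemma grade_induct [consumes 1, case_names word zero add smult]:
  assumes "x \<in> grade H i" and "\<And>x. x \<in> homogeneous_words H \<iota> gr i \<Longrightarrow> P x" and "P \<zero>"
      "\<And>x y. x \<in> carrier H \<Longrightarrow> y \<in> carrier H \<Longrightarrow> P x \<Longrightarrow> P y \<Longrightarrow> P (x \<oplus> y)"
      "\<And>c x. x \<in> carrier H \<Longrightarrow> P x \<Longrightarrow> P (c \<odot> x)"
  shows "P x"
  using assms(1)[unfolded grade_eq] homogeneous_words_closed
  by (rule linear_span_induct) (use assms in auto)

lemma grade_mult': 
  assumes "x \<in> grade H i" "y \<in> grade H j"
  shows "x \<otimes> y \<in> grade H (i + j)"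
  using assms(1)
proof (induction x rule: grade_induct)
  case (word x)
  note x = this
  have xc: "x \<in> carrier H"
    using x homogeneous_words_closed by blast
  show ?case
    using assms(2)
  proof (induction y rule: grade_induct)
    case (word y)
    then show ?case
      unfolding grade_eq using x by (intro linear_span_base homogeneous_words_mult)
  qed (use xc in \<open>simp_all add: r_null grade_zero r_distr grade_add smult_mult_right grade_smult\<close>)
qed (use grade_closed[OF assms(2)] in \<open>simp_all add: l_null grade_zero l_distr grade_add smult_mult_left grade_smult\<close>)

lemma grade_decompose:
  assumes "x \<in> carrier H"
  shows "\<exists>a\<in>grade H 0. \<exists>b\<in>grade H 1. x = a \<oplus> b"
  using assms
proof (induction x rule: generated_induct)
  case one
  show ?case
    by (intro bexI[of _ \<one>] bexI[of _ \<zero>]) (simp_all add: grade_one' grade_zero)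
next
  case (mult v w)
  then obtain a b where ab: "a \<in> grade H 0" "b \<in> grade H 1" "w = a \<oplus> b"
    by blast
  obtain f where f: "\<forall>i. f i \<in> gr i" "v = f 0 + f 1"
    using gr_direct_sum[of v] by blast
  let ?c = "\<iota> (f 0)" and ?d = "\<iota> (f 1)"
  have cd: "?c \<in> grade H 0" "?d \<in> grade H 1"
    using f by (auto intro: grade_gen)
  have "\<iota> v \<otimes> w = (?c \<otimes> a \<oplus> ?d \<otimes> b) \<oplus> (?c \<otimes> b \<oplus> ?d \<otimes> a)"
    using grade_closed[OF ab(1)] grade_closed[OF ab(2)]
    by (simp add: ab(3) f(2) gen_add l_distr r_distr a_ac)
  moreover have "?c \<otimes> a \<oplus> ?d \<otimes> b \<in> grade H 0" "?c \<otimes> b \<oplus> ?d \<otimes> a \<in> grade H 1"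
    using grade_mult'[OF cd(1) ab(1)] grade_mult'[OF cd(2) ab(2)]
      grade_mult'[OF cd(1) ab(2)] grade_mult'[OF cd(2) ab(1)] by (auto intro: grade_add)
  ultimately show ?case
    by blast
next
  case (add x y)
  then obtain a b c d where *: "a \<in> grade H 0" "b \<in> grade H 1" "x = a \<oplus> b"
      "c \<in> grade H 0" "d \<in> grade H 1" "y = c \<oplus> d"
    by blast
  then have "x \<oplus> y = (a \<oplus> c) \<oplus> (b \<oplus> d)"
    by (simp add: grade_closed a_ac)
  then show ?case
    using * grade_add by blast
next
  case (smult c x)
  then obtain a b where *: "a \<in> grade H 0" "b \<in> grade H 1" "x = a \<oplus> b"
    by blast
  then have "c \<odot> x = c \<odot> a \<oplus> c \<odot> b"
    by (simp add: grade_closed smult_add_right)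
  then show ?case
    using * grade_smult by blast
qed

text \<open>The map \<open>\<psi>\<close> sends an even \<open>a\<close> to \<open>(a, 0)\<close> and an odd \<open>b\<close> to \<open>(0, b)\<close>, hence
  \<open>a + b\<close> to \<open>(a, b)\<close>: the components can be read off.\<close>

lemma grade_unique_decompose:
  assumes "x \<in> carrier H"
  shows "\<exists>!f. (\<forall>i. f i \<in> grade H i) \<and> x = f 0 \<oplus> f 1"
proof -
  obtain \<psi> where \<psi>: "\<psi> \<in> alg_hom H (parity_algebra H)"
    and gen: "\<And>x. x \<in> gr 0 \<Longrightarrow> \<psi> (\<iota> x) = (\<iota> x, \<zero>)" "\<And>x. x \<in> gr 1 \<Longrightarrow> \<psi> (\<iota> x) = (\<zero>, \<iota> x)"
    using parity_hom by blast
  note hom = alg_homD[OF \<psi>]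
  have words: "\<psi> w = (if i = 0 then (w, \<zero>) else (\<zero>, w))" if "w \<in> homogeneous_words H \<iota> gr i" for w i
    using that
  proof (induction rule: homogeneous_words_induct)
    case Nil
    then show ?case by (simp add: hom)
  next
    case (Cons v d w i)
    have "w \<in> carrier H"
      using Cons.hyps homogeneous_words_closed by blast
    then show ?case
      using Cons by (cases d; cases i) (simp_all add: hom gen l_null r_null)
  qed
  have \<psi>_grade: "\<psi> w = (if i = 0 then (w, \<zero>) else (\<zero>, w))" if "w \<in> grade H i" for w i
    using that
  proof (induction w rule: grade_induct)
    case (word w)
    then show ?case by (rule words)
  next
    case zero
    show ?case
      using alg_hom_zero[OF is_algebra assoc_algebra_parity[OF is_algebra] \<psi>] by simp
  qed (auto simp: hom)
  obtain a b where ab: "a \<in> grade H 0" "b \<in> grade H 1" "x = a \<oplus> b"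
    using grade_decompose[OF assms] by blast
  show ?thesis
  proof (rule ex1I[of _ "\<lambda>i. if i = 0 then a else b"])
    show "(\<forall>i. (if i = 0 then a else b) \<in> grade H i) \<and> x = (if (0::bit) = 0 then a else b) \<oplus> (if (1::bit) = 0 then a else b)"
      using ab by (auto simp: bit_not_zero_iff)
  next
    fix f assume f: "(\<forall>i. f i \<in> grade H i) \<and> x = f 0 \<oplus> f 1"
    have *: "\<psi> (c \<oplus> d) = (c, d)" if "c \<in> grade H 0" "d \<in> grade H 1" for c d
      using that by (simp add: hom \<psi>_grade grade_closed)
    have "(f 0, f 1) = (a, b)"
      using *[of "f 0" "f 1"] *[OF ab(1,2)] f ab(3) by simp
    then show "f = (\<lambda>i. if i = 0 then a else b)"
      by (auto simp: bit_not_zero_iff)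
  qed
qed

text \<open>The comultiplication of a word is a product of factors \<open>v \<otimes> 1 + 1 \<otimes> v\<close>, and both
  summands of such a factor have the degree of \<open>v\<close>.\<close>

lemma comult_grade:
  assumes "x \<in> grade H i"
  shows "comult H x \<in> linear_span HH.AB
    {pure_tensor H H a b | a b j l. a \<in> grade H j \<and> b \<in> grade H l \<and> j + l = i}"
proof -
  define G where "G i = {pure_tensor H H a b | a b j l. a \<in> grade H j \<and> b \<in> grade H l \<and> j + l = i}" for i
  have G: "G i \<subseteq> carrier HH.AB" for i
    unfolding G_def using grade_closed by auto
  note span = HH.AB.linear_span_add[OF G] HH.AB.linear_span_smult[OF G] HH.AB.linear_span_zero[OF G]
  have mult: "pure_tensor H H c e \<otimes>\<^bsub>HH.AB\<^esub> y \<in> linear_span HH.AB (G m)"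
    if y: "y \<in> linear_span HH.AB (G i)" and c: "c \<in> grade H j" and e: "e \<in> grade H l"
      and m: "j + l + i = m" for c e j l i y m
    using y G
  proof (induction y rule: HH.AB.linear_span_induct)
    case (base y)
    then obtain a b j' l' where y: "y = pure_tensor H H a b" "a \<in> grade H j'" "b \<in> grade H l'" "j' + l' = i"
      unfolding G_def by blast
    have "pure_tensor H H c e \<otimes>\<^bsub>HH.AB\<^esub> y = pure_tensor H H (c \<otimes> a) (e \<otimes> b)"
      using y(1-3) c e grade_closed by (simp add: HH.pure_tensor_mult)
    moreover have "(j + j') + (l + l') = m"
      unfolding y(4)[symmetric] m[symmetric] by (simp only: add_ac)
    ultimately show ?case
      using grade_mult'[OF c y(2)] grade_mult'[OF e y(3)]
      by (intro HH.AB.linear_span_base) (unfold G_def, blast)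
  qed (use c e grade_closed in \<open>simp_all add: HH.AB.r_null HH.AB.r_distr HH.AB.smult_mult_right span\<close>)
  have words: "comult H w \<in> linear_span HH.AB (G i)" if "w \<in> homogeneous_words H \<iota> gr i" for w i
    using that
  proof (induction rule: homogeneous_words_induct)
    case Nil
    have "pure_tensor H H \<one> \<one> \<in> G 0"
      unfolding G_def using grade_one' by (intro CollectI exI conjI) auto
    then show ?case
      by (simp add: comult HH.tensor_prod_simps(2) HH.AB.linear_span_base)
  next
    case (Cons v d w i)
    have w: "w \<in> carrier H"
      using Cons.hyps homogeneous_words_closed by blast
    define m where "m = d + i"
    have m: "d + 0 + i = m" "0 + d + i = m"
      by (simp_all only: m_def add_0_left add_0_right)
    have "comult H (\<iota> v \<otimes> w) \<in> linear_span HH.AB (G m)"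
      using mult[OF Cons.IH grade_gen[OF Cons.hyps(1)] grade_one' m(1)]
        mult[OF Cons.IH grade_one' grade_gen[OF Cons.hyps(1)] m(2)] w
      by (simp add: comult comult_gen HH.AB.l_distr span)
    then show ?case
      by (simp only: m_def)
  qed
  have "comult H x \<in> linear_span HH.AB (G i)"
    using assms
    by (induction x rule: grade_induct)
      (simp_all add: words alg_hom_zero[OF is_algebra HH.assoc_algebra_tensor comult_alg_hom] comult span)
  then show ?thesis
    by (simp only: G_def)
qed

lemma counit_grade:
  assumes "x \<in> grade H 1" shows "counit H x = 0"
proof -
  have words: "counit H w = 0 \<or> i = 0" if "w \<in> homogeneous_words H \<iota> gr i" for w i
    using that
  proof (induction rule: homogeneous_words_induct)
    case (Cons v d w i)
    have "w \<in> carrier H"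
      using Cons.hyps homogeneous_words_closed by blast
    then show ?case by (simp add: counit counit_gen)
  qed simp
  have "counit H \<zero> = 0"
    using alg_hom_zero[OF is_algebra assoc_algebra_ground counit_alg_hom] by (simp add: ground_algebra_def)
  with assms show ?thesis
    by (induction x rule: grade_induct) (use words in \<open>auto simp: counit\<close>)
qed

lemma antipode_grade:
  assumes "x \<in> grade H i" shows "antipode H x \<in> grade H i"
proof -
  have words: "antipode H w \<in> grade H i" if "w \<in> homogeneous_words H \<iota> gr i" for w i
    using that
  proof (induction rule: homogeneous_words_induct)
    case Nil
    then show ?case by (simp add: antipode grade_one')
  next
    case (Cons v d w i)
    have "w \<in> carrier H"
      using Cons.hyps homogeneous_words_closed by blast
    then have "antipode H (\<iota> v \<otimes> w) = antipode H w \<otimes> ((- 1) \<odot> \<iota> v)"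
      by (simp add: antipode antipode_gen minus_eq_smult)
    then show ?case
      using grade_mult'[OF Cons.IH grade_smult[OF grade_gen[OF Cons.hyps(1)], of "- 1"]] by (simp only: add.commute)
  qed
  show ?thesis
    using assms
    by (induction x rule: grade_induct)
      (use alg_hom_zero[OF is_algebra assoc_algebra_opposite[OF is_algebra] antipode_alg_hom] in
        \<open>simp_all add: words antipode grade_add grade_smult grade_zero\<close>)
qed

theorem hopf_superalgebra: "hopf_superalgebra H"
proof (intro hopf_superalgebra.intro hopf_superalgebra_axioms.intro is_algebra)
  show "submodule (grade H i) (type_ring :: 'k ring) H" for i
    unfolding grade_eq by (rule linear_span_submodule[OF homogeneous_words_closed])
qed (rule comult_alg_hom counit_alg_hom comult_coassoc comult_counit antipode(1,3,5)
    comult_antipode_left comult_antipode_right grade_unique_decompose grade_one' grade_mult'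
    comult_grade counit_grade antipode_grade; assumption)+

end

section \<open>Algebras presented by generators and relations\<close>

lemma (in assoc_algebra) ideal_iff:
  "ideal I A \<longleftrightarrow> I \<subseteq> carrier A \<and> \<zero> \<in> I \<and> (\<forall>x\<in>I. \<forall>y\<in>I. x \<oplus> y \<in> I) \<and>
     (\<forall>a\<in>carrier A. \<forall>x\<in>I. a \<otimes> x \<in> I \<and> x \<otimes> a \<in> I)"
proof
  assume "ideal I A"
  then interpret I: ideal I A .
  show "I \<subseteq> carrier A \<and> \<zero> \<in> I \<and> (\<forall>x\<in>I. \<forall>y\<in>I. x \<oplus> y \<in> I) \<and>
     (\<forall>a\<in>carrier A. \<forall>x\<in>I. a \<otimes> x \<in> I \<and> x \<otimes> a \<in> I)"
    using I.a_subset by (auto simp: I.I_l_closed I.I_r_closed)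
next
  assume I: "I \<subseteq> carrier A \<and> \<zero> \<in> I \<and> (\<forall>x\<in>I. \<forall>y\<in>I. x \<oplus> y \<in> I) \<and>
     (\<forall>a\<in>carrier A. \<forall>x\<in>I. a \<otimes> x \<in> I \<and> x \<otimes> a \<in> I)"
  have "c \<odot> x \<in> I" if "x \<in> I" for c x
  proof -
    have "c \<odot> x = (c \<odot> \<one>) \<otimes> x"
      using I that by (auto simp: smult_mult_left)
    then show ?thesis
      using I that by simp
  qed
  then have "submodule I (type_ring :: 'k ring) A"
    using I by (simp add: submodule_iff)
  then show "ideal I A"
    using I by (intro idealI[OF ring]) (auto simp: submodule_def)
qed

lemma free_algebra_simps [simp]:
  "carrier free_algebra = UNIV" "monoid.mult free_algebra = (*)" "one free_algebra = 1"
  "zero free_algebra = 0" "add free_algebra = (+)" "smult free_algebra = pm_scale"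
  by (simp_all add: free_algebra_def)

lemma free_algebra_induct [case_names word add]:
  fixes t :: "'v tword \<Rightarrow>\<^sub>0 'k::field"
  assumes "\<And>xs c. P (Poly_Mapping.single (TWord xs) c)" "\<And>s t. P s \<Longrightarrow> P t \<Longrightarrow> P (s + t)"
  shows "P t"
proof -
  have "P 0"
    using assms(1)[of "[]" 0] by simp
  moreover have "P (Poly_Mapping.single k c)" for k c
    using assms(1) by (cases k) simp
  ultimately show ?thesis
    using assms(2) by (intro poly_mapping_single_induct[of t UNIV P]) auto
qed

lemma TWord_add: "TWord xs + TWord ys = TWord (xs @ ys)"
  by (simp add: plus_tword_def)

lemma one_free_algebra: "(1 :: 'v tword \<Rightarrow>\<^sub>0 'k::field) = Poly_Mapping.single (TWord []) 1"
  by (simp flip: zero_tword_def)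

lemma pm_scale_mult:
  fixes s t :: "'v tword \<Rightarrow>\<^sub>0 'k::field"
  shows "pm_scale c s * t = pm_scale c (s * t)" "s * pm_scale c t = pm_scale c (s * t)"
proof -
  have "pm_scale c s * t = pm_scale c (s * t) \<and> s * pm_scale c t = pm_scale c (s * t)"
  proof (induction s rule: free_algebra_induct)
    case (word xs d)
    show ?case
      by (induction t rule: free_algebra_induct)
        (simp_all add: mult_single algebra_simps pm.scale_right_distrib)
  qed (simp add: algebra_simps pm.scale_right_distrib)
  then show "pm_scale c s * t = pm_scale c (s * t)" "s * pm_scale c t = pm_scale c (s * t)"
    by auto
qed

lemma assoc_algebra_free: "assoc_algebra (free_algebra :: ('k::field, 'v tword \<Rightarrow>\<^sub>0 'k) module)"
  by (rule assoc_algebraI)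
    (simp_all add: algebra_simps pm_scale_mult pm.scale_right_distrib pm.scale_left_distrib)

lemmas free_ring = assoc_algebra.ring[OF assoc_algebra_free]
lemmas free_ideal_iff = assoc_algebra.ideal_iff[OF assoc_algebra_free]

lemma free_minus [simp]: "a_inv (free_algebra :: ('k::field, 'v tword \<Rightarrow>\<^sub>0 'k) module) = uminus"
  by (rule ext) (simp add: assoc_algebra.minus_eq_smult[OF assoc_algebra_free])

lemma free_diff [simp]: "a_minus (free_algebra :: ('k::field, 'v tword \<Rightarrow>\<^sub>0 'k) module) = (-)"
  by (intro ext) (simp add: a_minus_def)

definition free_lift ::
  "('k::field, 'a, 'm) module_scheme \<Rightarrow> ('v \<Rightarrow> 'a) \<Rightarrow> ('v tword \<Rightarrow>\<^sub>0 'k) \<Rightarrow> 'a" where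
  "free_lift B f = lincomb B (\<lambda>w. word B f (letters w))"

lemma
  fixes B :: "('k::field, 'a, 'm) module_scheme"
  assumes B: "assoc_algebra B" and f: "\<And>v. f v \<in> carrier B"
  shows free_lift_hom: "free_lift B f \<in> alg_hom free_algebra B"
    and free_lift_letter: "free_lift B f (letter v) = f v"
proof -
  interpret B: assoc_algebra B by fact
  have word: "word B f xs \<in> carrier B" for xs
    by (induction xs) (auto simp: f)
  have app: "word B f (xs @ ys) = word B f xs \<otimes>\<^bsub>B\<^esub> word B f ys" for xs ys
    using word by (induction xs) (simp_all add: f B.m_assoc)
  have closed: "free_lift B f t \<in> carrier B" for t
    unfolding free_lift_def by (rule B.lincomb_closed) (simp add: word)
  have add: "free_lift B f (s + t) = free_lift B f s \<oplus>\<^bsub>B\<^esub> free_lift B f t" for s t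
    unfolding free_lift_def by (rule B.lincomb_add[of _ UNIV]) (simp_all add: word)
  have smult: "free_lift B f (pm_scale c t) = c \<odot>\<^bsub>B\<^esub> free_lift B f t" for c t
    unfolding free_lift_def by (rule B.lincomb_smult) (simp add: word)
  have single: "free_lift B f (Poly_Mapping.single (TWord xs) c) = c \<odot>\<^bsub>B\<^esub> word B f xs" for xs c
    unfolding free_lift_def by (simp add: B.lincomb_single word)
  have mult: "free_lift B f (s * t) = free_lift B f s \<otimes>\<^bsub>B\<^esub> free_lift B f t" for s t
  proof (induction s rule: free_algebra_induct)
    case (word xs c)
    show ?case
    proof (induction t rule: free_algebra_induct)
      case (word ys d)
      then show ?case
        using \<open>\<And>xs. word B f xs \<in> carrier B\<close>
        by (simp add: mult_single TWord_add single app B.smult_mult_left B.smult_mult_right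
            B.smult_smult mult.commute del: foldr_append map_append)
    next
      case (add s t)
      then show ?case
        by (simp add: distrib_left \<open>\<And>s t. free_lift B f (s + t) = _\<close> closed B.r_distr)
    qed
  next
    case (add s t)
    then show ?case
      by (simp add: distrib_right \<open>\<And>s t. free_lift B f (s + t) = _\<close> closed B.l_distr)
  qed
  show "free_lift B f \<in> alg_hom free_algebra B"
    by (rule alg_homI) (simp_all add: closed mult add smult one_free_algebra single)
  show "free_lift B f (letter v) = f v"
    by (simp add: letter_def single f)
qed

text \<open>The enveloping algebras are iterated quotients of the free algebra. What is needed of each of
  them is the projection from the free algebra, with its kernel as an ideal given by generators.
  Algebras whose elements are classes of classes of words can then be compared through the relations
  between the words.\<close>

definition presents ::
  "('v tword \<Rightarrow>\<^sub>0 'k::field) set \<Rightarrow> ('k, 'a, 'm) module_scheme \<Rightarrow> (('v tword \<Rightarrow>\<^sub>0 'k) \<Rightarrow> 'a) \<Rightarrow> bool" where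
  "presents R A \<pi> \<longleftrightarrow> assoc_algebra A \<and> \<pi> \<in> alg_hom free_algebra A \<and> range \<pi> = carrier A \<and>
     {t. \<pi> t = \<zero>\<^bsub>A\<^esub>} = Idl\<^bsub>free_algebra\<^esub> R"

lemma presentsD:
  assumes "presents R A \<pi>"
  shows "assoc_algebra A" "\<pi> \<in> alg_hom free_algebra A" "range \<pi> = carrier A"
    "\<And>t. \<pi> t = \<zero>\<^bsub>A\<^esub> \<longleftrightarrow> t \<in> Idl\<^bsub>free_algebra\<^esub> R"
  using assms by (auto simp: presents_def)

lemma Idl_free_ideal: "ideal (Idl\<^bsub>free_algebra\<^esub> R) (free_algebra :: ('k::field, 'v tword \<Rightarrow>\<^sub>0 'k) module)"
  by (rule ring.genideal_ideal[OF free_ring]) simp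

lemma Idl_free_base: "r \<in> R \<Longrightarrow> r \<in> Idl\<^bsub>free_algebra :: ('k::field, 'v tword \<Rightarrow>\<^sub>0 'k) module\<^esub> R"
  using ring.genideal_self[OF free_ring, of R] by auto

lemma free_ideal_closed:
  assumes "ideal J (free_algebra :: ('k::field, 'v tword \<Rightarrow>\<^sub>0 'k) module)"
  shows "\<And>a b. a \<in> J \<Longrightarrow> b \<in> J \<Longrightarrow> a + b \<in> J"
    and "\<And>a b. a \<in> J \<Longrightarrow> b \<in> J \<Longrightarrow> a - b \<in> J"
    and "\<And>a c. a \<in> J \<Longrightarrow> c * a \<in> J" "\<And>a c. a \<in> J \<Longrightarrow> a * c \<in> J"
proof -
  note J = assms[unfolded free_ideal_iff, simplified]
  show add: "a + b \<in> J" if "a \<in> J" "b \<in> J" for a b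
    using J that by auto
  show mult: "c * a \<in> J" "a * c \<in> J" if "a \<in> J" for a c
    using J that by auto
  show "a - b \<in> J" if "a \<in> J" "b \<in> J" for a b
    using add[OF that(1) mult(1)[OF that(2), of "- 1"]] by simp
qed

lemma Idl_free_minimal:
  "ideal J (free_algebra :: ('k::field, 'v tword \<Rightarrow>\<^sub>0 'k) module) \<Longrightarrow> R \<subseteq> J \<Longrightarrow> Idl\<^bsub>free_algebra\<^esub> R \<subseteq> J"
  by (rule ring.genideal_minimal[OF free_ring])

lemma ideal_preimage:
  assumes "assoc_algebra A" "\<pi> \<in> alg_hom free_algebra A" "ideal I A"
  shows "ideal {t. \<pi> t \<in> I} (free_algebra :: ('k::field, 'v tword \<Rightarrow>\<^sub>0 'k) module)"
proof -
  interpret A: assoc_algebra A by fact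
  show ?thesis
    using assms(3) alg_homD[OF assms(2)] alg_hom_zero[OF assoc_algebra_free assms(1,2)]
    by (simp add: A.ideal_iff free_ideal_iff)
qed

text \<open>The relations of an iterated quotient are collected in the free algebra: as \<open>\<pi>\<close> is
  surjective, it maps the ideal generated by \<open>R \<union> S\<close> onto an ideal, which contains \<open>\<pi> ` S\<close>.\<close>

lemma presents_quotient:
  assumes "presents R A \<pi>"
  shows "presents (R \<union> S) (quotient_algebra A (Idl\<^bsub>A\<^esub> (\<pi> ` S))) (\<lambda>t. Idl\<^bsub>A\<^esub> (\<pi> ` S) +>\<^bsub>A\<^esub> \<pi> t)"
proof -
  note \<pi> = presentsD[OF assms]
  note hom = alg_homD[OF \<pi>(2), simplified]
  interpret A: assoc_algebra A by (rule \<pi>(1))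
  let ?I = "Idl\<^bsub>A\<^esub> (\<pi> ` S)" and ?J = "Idl\<^bsub>free_algebra\<^esub> (R \<union> S)"
  have SA: "\<pi> ` S \<subseteq> carrier A"
    using hom(1) by auto
  have I: "ideal ?I A"
    by (rule ring.genideal_ideal[OF A.ring SA])
  have J: "ideal ?J free_algebra"
    by (rule Idl_free_ideal)
  have "?J \<subseteq> {t. \<pi> t \<in> ?I}"
  proof (rule Idl_free_minimal[OF ideal_preimage[OF \<pi>(1,2) I]])
    have "\<pi> r = \<zero>\<^bsub>A\<^esub>" if "r \<in> R" for r
      using \<pi>(4) Idl_free_base[OF that] by simp
    then show "R \<union> S \<subseteq> {t. \<pi> t \<in> ?I}"
      using I ring.genideal_self[OF A.ring SA] by (auto simp: A.ideal_iff)
  qed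
  moreover have "t \<in> ?J" if t: "\<pi> t \<in> ?I" for t
  proof -
    have "ideal (\<pi> ` ?J) A"
      using J \<pi>(3) hom alg_hom_zero[OF assoc_algebra_free \<pi>(1,2)]
      unfolding A.ideal_iff free_ideal_iff
      by (auto simp flip: \<pi>(3) intro!: rev_image_eqI simp flip: hom)
    then have "?I \<subseteq> \<pi> ` ?J"
      by (rule ring.genideal_minimal[OF A.ring]) (auto intro: Idl_free_base)
    then obtain j where j: "j \<in> ?J" "\<pi> t = \<pi> j"
      using t by blast
    have "\<pi> (t - j) = \<pi> t \<ominus>\<^bsub>A\<^esub> \<pi> j"
      using alg_hom_diff[OF assoc_algebra_free \<pi>(1,2)] by simp
    then have "\<pi> (t - j) = \<zero>\<^bsub>A\<^esub>"
      using j hom(1) by (simp add: a_minus_def A.r_neg)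
    then have "t - j \<in> Idl\<^bsub>free_algebra\<^esub> R"
      using \<pi>(4) by simp
    then have "t - j \<in> ?J"
      using Idl_free_minimal[OF J, of R] Idl_free_base[of _ "R \<union> S"] by blast
    then show ?thesis
      using J j(1) unfolding free_ideal_iff by (metis diff_add_cancel free_algebra_simps(5))
  qed
  ultimately have ker: "{t. \<pi> t \<in> ?I} = ?J"
    by blast
  show ?thesis
    unfolding presents_def
    using assoc_algebra_quotient[OF \<pi>(1) I] alg_hom_comp[OF \<pi>(2) quotient_algebra_proj[OF \<pi>(1) I]]
      coset_eq_zero_iff[OF \<pi>(1) I hom(1)] ker
    by (auto simp: quotient_algebra_simps simp flip: \<pi>(3))
qed

lemma presents_free: "presents {} (free_algebra :: ('k::field, 'v tword \<Rightarrow>\<^sub>0 'k) module) (\<lambda>t. t)"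
proof -
  have "ideal {0} (free_algebra :: ('k::field, 'v tword \<Rightarrow>\<^sub>0 'k) module)"
    by (simp add: free_ideal_iff)
  from Idl_free_minimal[OF this, of "{}"]
  have "Idl\<^bsub>free_algebra :: ('k::field, 'v tword \<Rightarrow>\<^sub>0 'k) module\<^esub> {} = {0}"
    using Idl_free_ideal[of "{}"] by (auto simp: free_ideal_iff)
  then show ?thesis
    by (simp add: presents_def assoc_algebra_free alg_hom_id)
qed

lemma presents_eq_iff:
  assumes "presents R A \<pi>"
  shows "\<pi> s = \<pi> t \<longleftrightarrow> s - t \<in> Idl\<^bsub>free_algebra\<^esub> R"
proof -
  note \<pi> = presentsD[OF assms]
  note hom = alg_homD[OF \<pi>(2), simplified]
  interpret A: assoc_algebra A by (rule \<pi>(1))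
  have "\<pi> (s - t) \<oplus>\<^bsub>A\<^esub> \<pi> t = \<pi> s"
    by (simp flip: hom)
  moreover have "\<pi> (s - t) = \<pi> s \<ominus>\<^bsub>A\<^esub> \<pi> t"
    using alg_hom_diff[OF assoc_algebra_free \<pi>(1,2)] by simp
  ultimately have "\<pi> s = \<pi> t \<longleftrightarrow> \<pi> (s - t) = \<zero>\<^bsub>A\<^esub>"
    using hom(1) by (metis A.l_zero A.r_neg a_minus_def)
  then show ?thesis
    by (simp add: \<pi>(4))
qed

lemma presents_factor:
  assumes A: "presents R A \<pi>" and B: "assoc_algebra B" and g: "g \<in> alg_hom free_algebra B"
    and R: "\<And>r. r \<in> R \<Longrightarrow> g r = \<zero>\<^bsub>B\<^esub>"
  shows "\<exists>h\<in>alg_hom A B. \<forall>t. h (\<pi> t) = g t"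
proof -
  note \<pi> = presentsD[OF A]
  note hom = alg_homD[OF \<pi>(2), simplified] and g' = alg_homD[OF g, simplified]
  interpret B: assoc_algebra B by fact
  have "ideal {\<zero>\<^bsub>B\<^esub>} B"
    by (simp add: B.ideal_iff B.l_null B.r_null)
  from Idl_free_minimal[OF ideal_preimage[OF B g this], of R]
  have ker: "g t = \<zero>\<^bsub>B\<^esub>" if "t \<in> Idl\<^bsub>free_algebra\<^esub> R" for t
    using R that by auto
  have eq: "g s = g t" if "\<pi> s = \<pi> t" for s t
  proof -
    have "g (s - t) \<oplus>\<^bsub>B\<^esub> g t = g s"
      by (simp flip: g')
    moreover have "g (s - t) = \<zero>\<^bsub>B\<^esub>"
      using that by (intro ker) (simp add: presents_eq_iff[OF A])
    ultimately show ?thesis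
      using g'(1) by simp
  qed
  define h where "h x = g (SOME t. \<pi> t = x)" for x
  have h: "h (\<pi> t) = g t" for t
    unfolding h_def by (rule eq) (rule someI[of "\<lambda>s. \<pi> s = \<pi> t" t], simp)
  have "h \<in> alg_hom A B"
    by (rule alg_homI) (auto simp: h g' simp flip: \<pi>(3) hom)
  then show ?thesis
    using h by blast
qed

lemma presents_generated:
  assumes "presents R A \<pi>"
  shows "generated_algebra A (\<lambda>v. \<pi> (letter v))"
proof (intro generated_algebra.intro generated_algebra_axioms.intro)
  note \<pi> = presentsD[OF assms]
  note hom = alg_homD[OF \<pi>(2), simplified]
  interpret A: assoc_algebra A by (rule \<pi>(1))
  show "assoc_algebra A" "\<And>v. \<pi> (letter v) \<in> carrier A"
    by (simp_all add: \<pi>(1) hom)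
  let ?w = "word A (\<lambda>v. \<pi> (letter v))"
  have w: "?w xs = \<pi> (Poly_Mapping.single (TWord xs) 1)" for xs
  proof (induction xs)
    case Nil
    then show ?case by (simp add: hom flip: one_free_algebra)
  next
    case (Cons v xs)
    then show ?case by (simp add: letter_def mult_single TWord_add flip: hom)
  qed
  have S: "range ?w \<subseteq> carrier A"
    using w hom(1) by auto
  have "\<pi> t \<in> linear_span A (range ?w)" for t
  proof (induction t rule: free_algebra_induct)
    case (word xs c)
    have "\<pi> (Poly_Mapping.single (TWord xs) c) = c \<odot>\<^bsub>A\<^esub> ?w xs"
      unfolding w by (simp flip: hom)
    then show ?case
      using A.linear_span_smult[OF S A.linear_span_base] by simp
  qed (simp add: hom A.linear_span_add[OF S])
  then show "carrier A = linear_span A (range ?w)"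
    using A.linear_span_closed[OF S] by (auto simp flip: \<pi>(3))
qed

section \<open>The 2-operation on the underlying Lie algebra\<close>

context graded_vector_space
begin

lemma hcomp_in: "hcomp gr z i \<in> gr i"
  and hcomp_sum: "z = hcomp gr z 0 + hcomp gr z 1"
  using theI'[OF gr_direct_sum[of z]] unfolding hcomp_def by auto

lemma hcomp_eqI:
  assumes "a \<in> gr 0" "b \<in> gr 1"
  shows "hcomp gr (a + b) 0 = a" "hcomp gr (a + b) 1 = b"
proof -
  have "hcomp gr (a + b) = (\<lambda>i. if i = 0 then a else b)"
    unfolding hcomp_def by (rule the1_equality[OF gr_direct_sum]) (use assms in \<open>auto simp: bit_not_zero_iff\<close>)
  then show "hcomp gr (a + b) 0 = a" "hcomp gr (a + b) 1 = b"
    by simp_all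
qed

lemma gr_add: "x \<in> gr i \<Longrightarrow> y \<in> gr i \<Longrightarrow> x + y \<in> gr i"
  and gr_scale: "x \<in> gr i \<Longrightarrow> scale c x \<in> gr i"
  and gr_zero: "0 \<in> gr i"
  using gr_subspace[of i] by (auto simp: subspace_def)

lemma hcomp_even: "x \<in> gr 0 \<Longrightarrow> hcomp gr x 0 = x" "x \<in> gr 0 \<Longrightarrow> hcomp gr x 1 = 0"
  and hcomp_odd: "x \<in> gr 1 \<Longrightarrow> hcomp gr x 0 = 0" "x \<in> gr 1 \<Longrightarrow> hcomp gr x 1 = x"
  using hcomp_eqI[of x 0] hcomp_eqI[of 0 x] gr_zero by auto

lemma hcomp_add: "hcomp gr (x + y) i = hcomp gr x i + hcomp gr y i"
proof -
  have "x + y = (hcomp gr x 0 + hcomp gr y 0) + (hcomp gr x 1 + hcomp gr y 1)"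
    by (subst hcomp_sum[of x], subst hcomp_sum[of y]) (simp only: add_ac)
  then show ?thesis
    using hcomp_eqI[of "hcomp gr x 0 + hcomp gr y 0" "hcomp gr x 1 + hcomp gr y 1"]
    by (cases i) (auto simp: hcomp_in gr_add)
qed

lemma hcomp_scale: "hcomp gr (scale c x) i = scale c (hcomp gr x i)"
proof -
  have "scale c x = scale c (hcomp gr x 0) + scale c (hcomp gr x 1)"
    by (subst hcomp_sum[of x]) (simp only: scale_right_distrib)
  then show ?thesis
    using hcomp_eqI[of "scale c (hcomp gr x 0)" "scale c (hcomp gr x 1)"]
    by (cases i) (auto simp: hcomp_in gr_scale)
qed

end

lemma (in vector_space) double_char_2:
  fixes x :: 'b
  assumes "CHAR('a) = 2" shows "x + x = 0"
proof -
  have "(1 + 1 :: 'a) = 0"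
    using of_nat_CHAR[where ?'a = 'a] assms by simp
  then show ?thesis
    using scale_left_distrib[of 1 1 x] by simp
qed

locale char_2_superalgebra = restricted_lie_superalgebra scale gr br q p
  for scale :: "'k::field \<Rightarrow> 'v::ab_group_add \<Rightarrow> 'v" and gr br q p +
  assumes char_2: "CHAR('k) = 2"
begin

abbreviation ev :: "'v \<Rightarrow> 'v" where "ev z \<equiv> hcomp gr z 0"

abbreviation od :: "'v \<Rightarrow> 'v" where "od z \<equiv> hcomp gr z 1"

abbreviation P :: "'v \<Rightarrow> 'v" where "P \<equiv> forget_p gr br q p"

lemma double: "x + x = (0::'v)"
  by (rule double_char_2[OF char_2])

lemma br_add: "br (x + y) z = br x z + br y z" "br x (y + z) = br x y + br x z"
  and br_scale: "br (scale c x) y = scale c (br x y)" "br x (scale c y) = scale c (br x y)"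
  using br_linear_left br_linear_right by (simp_all add: Vector_Spaces.linear_iff)

lemma br_zero: "br 0 x = 0" "br x 0 = 0"
  using br_scale(1)[of 0 0 x] br_scale(2)[of x 0 0] by simp_all

lemma pq_zero: "p 0 = 0" "q 0 = 0"
  using p_scale[OF gr_zero, of 0] q_scale[OF gr_zero, of 0] by simp_all

lemma br_comm: "br x y = br y x"
proof -
  have "br (ev x + od x) (ev y + od y) = br (ev y + od y) (ev x + od x)"
    by (simp only: br_add br_sym[OF hcomp_in hcomp_in, of x _ y] add_ac)
  then show ?thesis
    by (simp flip: hcomp_sum)
qed

lemma br_self: "br x x = 0"
proof -
  have "br (od x) (od x) = q (od x + od x) - (q (od x) + q (od x))"
    using q_polar[OF hcomp_in hcomp_in, of x x] by (simp only: diff_diff_eq)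
  then have odd: "br (od x) (od x) = 0"
    by (simp only: double pq_zero diff_zero)
  have "br (ev x + od x) (ev x + od x) = br (ev x) (ev x) + br (od x) (od x) + (br (ev x) (od x) + br (ev x) (od x))"
    by (simp only: br_add br_comm[of "od x" "ev x"] add_ac)
  also have "\<dots> = 0"
    by (simp only: double br_even_self[OF hcomp_in] odd add_0_left)
  finally show ?thesis
    by (simp flip: hcomp_sum)
qed

lemma forget_p_eq: "P z = p (ev z) + q (od z) + br (od z) (ev z)"
  by (simp add: forget_p_def)

lemma forget_p_even: "x \<in> gr 0 \<Longrightarrow> P x = p x"
  and forget_p_odd: "x \<in> gr 1 \<Longrightarrow> P x = q x"
  by (simp_all add: forget_p_eq hcomp_even hcomp_odd br_zero pq_zero)

lemma q_add: "x \<in> gr 1 \<Longrightarrow> y \<in> gr 1 \<Longrightarrow> q (x + y) = q x + q y + br y x"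
  using q_polar[of y x] by (simp add: algebra_simps)

text \<open>All identities reduce to those of \<open>p\<close> and \<open>q\<close> on the homogeneous parts; the mixed
  terms either occur twice and cancel, or are the term \<open>[z\<^sub>1, z\<^sub>0]\<close> of the definition.\<close>

lemma restricted_graded_lie_algebra: "restricted_graded_lie_algebra scale gr br P"
proof (intro restricted_graded_lie_algebra.intro restricted_lie_algebra.intro lie_algebra.intro
    lie_algebra_axioms.intro restricted_lie_algebra_axioms.intro restricted_graded_lie_algebra_axioms.intro)
  show "graded_vector_space scale gr" "vector_space scale"
    by unfold_locales
  show "Vector_Spaces.linear scale scale (\<lambda>x. br x y)" "Vector_Spaces.linear scale scale (br x)" for x y
    by (rule br_linear_left br_linear_right)+
  show "br x x = 0" "br x (br y z) = br (br x y) z + br y (br x z)" for x y z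
    by (rule br_self br_jacobi)+
  show "P (scale c x) = scale (c\<^sup>2) (P x)" for c x
    by (simp add: forget_p_eq hcomp_scale p_scale[OF hcomp_in] q_scale[OF hcomp_in] br_scale
        scale_right_distrib power2_eq_square)
  show "br (P x) z = br x (br x z)" for x z
  proof -
    have "br x (br x z) = br (ev x + od x) (br (ev x + od x) z)"
      by (simp flip: hcomp_sum)
    also have "\<dots> = br (ev x) (br (ev x) z) + br (od x) (br (od x) z)
        + (br (od x) (br (ev x) z) + br (ev x) (br (od x) z))"
      by (simp only: br_add add_ac)
    also have "br (od x) (br (ev x) z) + br (ev x) (br (od x) z) =
        br (br (od x) (ev x)) z + (br (ev x) (br (od x) z) + br (ev x) (br (od x) z))"
      by (subst br_jacobi) (simp only: add_ac)
    finally show ?thesis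
      by (simp add: double forget_p_eq br_add p_ad[OF hcomp_in] q_ad[OF hcomp_in])
  qed
  show "P (x + y) = P x + P y + br y x" for x y
  proof -
    have "br y x = br (ev y + od y) (ev x + od x)"
      by (simp flip: hcomp_sum)
    also have "\<dots> = br (ev y) (ev x) + br (od y) (od x) + (br (od y) (ev x) + br (od x) (ev y))"
      by (simp only: br_add br_comm[of "ev y" "od x"] add_ac)
    finally have "br y x = br (ev y) (ev x) + br (od y) (od x) + (br (od y) (ev x) + br (od x) (ev y))" .
    then show ?thesis
      by (simp add: forget_p_eq hcomp_add p_add[OF hcomp_in hcomp_in] q_add[OF hcomp_in hcomp_in] br_add add_ac)
  qed
  show "br x y \<in> gr (i + j)" if "x \<in> gr i" "y \<in> gr j" for x y i j
    using that by (rule br_graded)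
  show "P x \<in> gr (i + i)" if "x \<in> gr i" for x i
    using that p_even[of x] q_even[of x] by (cases i) (auto simp: forget_p_even forget_p_odd)
qed

end


section \<open>Relations of the enveloping algebras\<close>

definition linear_relations :: "('k::field \<Rightarrow> 'v::ab_group_add \<Rightarrow> 'v) \<Rightarrow> ('v tword \<Rightarrow>\<^sub>0 'k) set" where
  "linear_relations scale =
     {letter (x + y) - letter x - letter y | x y. True} \<union>
     {letter (scale c x) - pm_scale c (letter x) | c x. True}"

definition commutator :: "('v \<Rightarrow> 'v \<Rightarrow> 'v) \<Rightarrow> 'v \<Rightarrow> 'v \<Rightarrow> ('v tword \<Rightarrow>\<^sub>0 'k::field)" where
  "commutator br x y = letter x * letter y - letter y * letter x - letter (br x y)"

definition square :: "('v \<Rightarrow> 'v) \<Rightarrow> 'v \<Rightarrow> ('v tword \<Rightarrow>\<^sub>0 'k::field)" where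
  "square s x = letter x * letter x - letter (s x)"

definition lie_relations ::
  "('k::field \<Rightarrow> 'v::ab_group_add \<Rightarrow> 'v) \<Rightarrow> ('v \<Rightarrow> 'v \<Rightarrow> 'v) \<Rightarrow> ('v tword \<Rightarrow>\<^sub>0 'k) set" where
  "lie_relations scale br = linear_relations scale \<union> {commutator br x y | x y. True}"

definition super_relations ::
  "('k::field \<Rightarrow> 'v::ab_group_add \<Rightarrow> 'v) \<Rightarrow> (bit \<Rightarrow> 'v set) \<Rightarrow> ('v \<Rightarrow> 'v \<Rightarrow> 'v) \<Rightarrow> ('v \<Rightarrow> 'v) \<Rightarrow>
   ('v tword \<Rightarrow>\<^sub>0 'k) set" where
  "super_relations scale gr br q = linear_relations scale \<union>
     ({commutator br x y | x y i j. x \<in> gr i \<and> y \<in> gr j} \<union> {square q y | y. y \<in> gr 1})"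

lemma super_relationsI:
  "x \<in> gr i \<Longrightarrow> y \<in> gr j \<Longrightarrow> commutator br x y \<in> super_relations scale gr br q"
  "z \<in> gr 1 \<Longrightarrow> square q z \<in> super_relations scale gr br q"
  by (auto simp: super_relations_def)

abbreviation lie_U_proj where
  "lie_U_proj scale br t \<equiv>
     lie_ideal scale br +>\<^bsub>tensor_algebra scale\<^esub> (tensor_ideal scale +>\<^bsub>free_algebra\<^esub> t)"

abbreviation super_U_proj where
  "super_U_proj scale gr br q t \<equiv>
     super_ideal scale gr br q +>\<^bsub>tensor_algebra scale\<^esub> (tensor_ideal scale +>\<^bsub>free_algebra\<^esub> t)"

lemma presents_tensor_algebra:
  "presents (linear_relations scale) (tensor_algebra scale) (\<lambda>t. tensor_ideal scale +>\<^bsub>free_algebra\<^esub> t)"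
  using presents_quotient[OF presents_free, of "linear_relations scale"]
  by (simp add: tensor_algebra_def tensor_ideal_def linear_relations_def)

lemma presents_square:
  assumes "presents R A \<pi>"
  shows "square_relation A (\<lambda>x. \<pi> (letter x)) s x = \<pi> (square s x)"
  using alg_hom_diff[OF assoc_algebra_free presentsD(1,2)[OF assms]] alg_homD(2)[OF presentsD(2)[OF assms]]
  by (simp add: square_relation_def square_def)

lemma commutator_relation_eq:
  "commutator_relation scale br x y = tensor_ideal scale +>\<^bsub>free_algebra\<^esub> commutator br x y"
  using alg_hom_diff[OF assoc_algebra_free presentsD(1,2)[OF presents_tensor_algebra[of scale]]]
    alg_homD(2)[OF presentsD(2)[OF presents_tensor_algebra[of scale]]]
  by (simp add: commutator_relation_def Let_def tensor_incl_def commutator_def)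

lemma presents_lie_U: "presents (lie_relations scale br) (lie_U scale br) (lie_U_proj scale br)"
proof -
  have "{commutator_relation scale br x y | x y. True} =
      (\<lambda>t. tensor_ideal scale +>\<^bsub>free_algebra\<^esub> t) ` {commutator br x y | x y. True}"
    by (auto simp: commutator_relation_eq)
  with presents_quotient[OF presents_tensor_algebra, of scale "{commutator br x y | x y. True}"]
  show ?thesis
    by (simp add: lie_U_def lie_ideal_def lie_relations_def)
qed

lemma presents_super_U:
  "presents (super_relations scale gr br q) (super_U scale gr br q) (super_U_proj scale gr br q)"
proof -
  let ?S = "{commutator br x y | x y i j. x \<in> gr i \<and> y \<in> gr j} \<union> {square q y | y. y \<in> gr 1}"
  have "square_relation (tensor_algebra scale) (tensor_incl scale) q y =
      tensor_ideal scale +>\<^bsub>free_algebra\<^esub> square q y" for y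
    using presents_square[OF presents_tensor_algebra[of scale]] by (simp add: tensor_incl_def[abs_def])
  then have "{commutator_relation scale br x y | x y i j. x \<in> gr i \<and> y \<in> gr j} \<union>
      {square_relation (tensor_algebra scale) (tensor_incl scale) q y | y. y \<in> gr 1} =
      (\<lambda>t. tensor_ideal scale +>\<^bsub>free_algebra\<^esub> t) ` ?S"
    by (auto simp: commutator_relation_eq image_Un)
  with presents_quotient[OF presents_tensor_algebra, of scale ?S]
  show ?thesis
    by (simp add: super_U_def super_ideal_def super_relations_def)
qed

lemma presents_lie_V:
  "presents (lie_relations scale br \<union> {square p z | z. True})
     (quotient_algebra (lie_U scale br) (lie_V_ideal scale br p))
     (\<lambda>t. lie_V_ideal scale br p +>\<^bsub>lie_U scale br\<^esub> lie_U_proj scale br t)"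
proof -
  have "{square_relation (lie_U scale br) (lie_U_incl scale br) p z | z. True} =
      lie_U_proj scale br ` {square p z | z. True}"
    using presents_square[OF presents_lie_U[of scale br]] by (auto simp: lie_U_incl_def[abs_def] tensor_incl_def)
  with presents_quotient[OF presents_lie_U, of scale br "{square p z | z. True}"]
  show ?thesis
    by (simp add: lie_V_ideal_def)
qed

lemma presents_super_V:
  "presents (super_relations scale gr br q \<union> {square p x | x. x \<in> gr 0})
     (quotient_algebra (super_U scale gr br q) (super_V_ideal scale gr br q p))
     (\<lambda>t. super_V_ideal scale gr br q p +>\<^bsub>super_U scale gr br q\<^esub> super_U_proj scale gr br q t)"
proof -
  have "{square_relation (super_U scale gr br q) (super_U_incl scale gr br q) p x | x. x \<in> gr 0} =
      super_U_proj scale gr br q ` {square p x | x. x \<in> gr 0}"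
    using presents_square[OF presents_super_U[of scale gr br q]]
    by (auto simp: super_U_incl_def[abs_def] tensor_incl_def)
  with presents_quotient[OF presents_super_U, of scale gr br q "{square p x | x. x \<in> gr 0}"]
  show ?thesis
    by (simp add: super_V_ideal_def)
qed

context char_2_superalgebra
begin

text \<open>Modulo the linear relations, the commutator relation is biadditive in the two letters. So
  the relations for homogeneous letters give all of them.\<close>

lemma commutator_in:
  assumes J: "ideal J (free_algebra :: ('k, 'v tword \<Rightarrow>\<^sub>0 'k) module)"
    and lin: "linear_relations scale \<subseteq> J"
    and comm: "\<And>x y i j. x \<in> gr i \<Longrightarrow> y \<in> gr j \<Longrightarrow> commutator br x y \<in> J"
  shows "commutator br x y \<in> J"
proof -
  note add = free_ideal_closed(1)[OF J] and diff = free_ideal_closed(2)[OF J]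
    and mult = free_ideal_closed(3,4)[OF J]
  have letter: "letter (u + v) - letter u - letter v \<in> J" for u v
    using lin by (auto simp: linear_relations_def)
  have left: "commutator br (u + v) w \<in> J" if "commutator br u w \<in> J" "commutator br v w \<in> J" for u v w
  proof -
    let ?d = "letter (u + v) - letter u - letter v :: 'v tword \<Rightarrow>\<^sub>0 'k"
    let ?e = "letter (br u w + br v w) - letter (br u w) - letter (br v w) :: 'v tword \<Rightarrow>\<^sub>0 'k"
    have "commutator br (u + v) w =
        commutator br u w + commutator br v w + (?d * letter w - letter w * ?d - ?e)"
      by (simp add: commutator_def br_add algebra_simps)
    also have "\<dots> \<in> J"
      by (rule add[OF add[OF that] diff[OF diff[OF mult(2)[OF letter] mult(1)[OF letter]] letter]])
    finally show ?thesis .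
  qed
  have right: "commutator br w (u + v) \<in> J" if "commutator br w u \<in> J" "commutator br w v \<in> J" for u v w
  proof -
    let ?d = "letter (u + v) - letter u - letter v :: 'v tword \<Rightarrow>\<^sub>0 'k"
    let ?e = "letter (br w u + br w v) - letter (br w u) - letter (br w v) :: 'v tword \<Rightarrow>\<^sub>0 'k"
    have "commutator br w (u + v) =
        commutator br w u + commutator br w v + (letter w * ?d - ?d * letter w - ?e)"
      by (simp add: commutator_def br_add algebra_simps)
    also have "\<dots> \<in> J"
      by (rule add[OF add[OF that] diff[OF diff[OF mult(1)[OF letter] mult(2)[OF letter]] letter]])
    finally show ?thesis .
  qed
  have "commutator br ((ev x) + (od x)) ((ev y) + (od y)) \<in> J"
    by (intro left right comm[OF hcomp_in hcomp_in])
  then show ?thesis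
    by (simp flip: hcomp_sum)
qed

text \<open>The computation behind the formula for the 2-operation. With \<open>x\<close> and \<open>y\<close> the even and the
  odd part of \<open>z\<close>, \<open>(x + y)\<^sup>2 = x\<^sup>2 + y\<^sup>2 + (y x - x y) + 2 x y\<close>. The first three terms become
  \<open>p x\<close>, \<open>q y\<close> and \<open>[y, x]\<close>, and the last one vanishes in characteristic 2. The elements
  \<open>?d\<close>, \<open>?e\<close> and \<open>?f\<close> measure the failure of \<^const>\<open>letter\<close> to be additive in the free
  algebra.\<close>

lemma square_in:
  assumes J: "ideal J (free_algebra :: ('k, 'v tword \<Rightarrow>\<^sub>0 'k) module)"
    and lin: "linear_relations scale \<subseteq> J"
    and comm: "commutator br (od z) (ev z) \<in> J"
    and sq: "square p (ev z) \<in> J" "square q (od z) \<in> J"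
  shows "square P z \<in> J"
proof -
  note add = free_ideal_closed(1)[OF J] and diff = free_ideal_closed(2)[OF J]
    and mult = free_ideal_closed(3,4)[OF J]
  have letter: "letter (u + v) - letter u - letter v \<in> J" for u v
    using lin by (auto simp: linear_relations_def)
  let ?x = "letter (ev z) :: 'v tword \<Rightarrow>\<^sub>0 'k" and ?y = "letter (od z) :: 'v tword \<Rightarrow>\<^sub>0 'k"
  let ?d = "letter ((ev z) + (od z)) - ?x - ?y"
  let ?e = "letter (p (ev z) + q (od z)) - letter (p (ev z)) - letter (q (od z)) :: 'v tword \<Rightarrow>\<^sub>0 'k"
  let ?f = "letter (P z) - letter (p (ev z) + q (od z)) - letter (br (od z) (ev z)) :: 'v tword \<Rightarrow>\<^sub>0 'k"
  have "?f \<in> J"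
    unfolding forget_p_eq by (rule letter)
  have "letter z = ?d + ?x + ?y"
    by (simp flip: hcomp_sum)
  then have "square P z = square p (ev z) + square q (od z) + commutator br (od z) (ev z) +
      (?d * letter z + (?x + ?y) * ?d - ?e - ?f) + (?x * ?y + ?x * ?y)"
    unfolding square_def commutator_def by (simp add: algebra_simps)
  also have "?x * ?y + ?x * ?y = 0"
    by (rule pm.double_char_2[OF char_2])
  also have "square p (ev z) + square q (od z) + commutator br (od z) (ev z) +
      (?d * letter z + (?x + ?y) * ?d - ?e - ?f) + 0 \<in> J"
    unfolding add_0_right
    by (rule add[OF add[OF add[OF sq] comm] diff[OF diff[OF add[OF mult(2)[OF letter] mult(1)[OF letter]] letter] \<open>?f \<in> J\<close>]])
  finally show ?thesis .
qed

text \<open>The relations of the two restricted enveloping algebras generate the same ideal. One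
  direction is an inclusion of relations, since the 2-operation extends both \<open>p\<close> and \<open>q\<close>; the
  other is that the relations for arbitrary elements follow from those for homogeneous ones.\<close>

lemma Idl_relations_eq:
  "Idl\<^bsub>free_algebra\<^esub> (lie_relations scale br \<union> {square P z | z. True}) =
   Idl\<^bsub>free_algebra\<^esub> (super_relations scale gr br q \<union> {square p x | x. x \<in> gr 0})"
  (is "Idl\<^bsub>_\<^esub> ?R = Idl\<^bsub>_\<^esub> ?S")
proof
  let ?J = "Idl\<^bsub>free_algebra\<^esub> ?S"
  have base: "r \<in> ?J" if "r \<in> ?S" for r
    using that by (rule Idl_free_base)
  have lin: "linear_relations scale \<subseteq> ?J"
    using base by (auto simp: super_relations_def)
  have comm: "commutator br x y \<in> ?J" if "x \<in> gr i" "y \<in> gr j" for x y i j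
    by (intro base UnI1 super_relationsI(1)[OF that])
  have sq: "square p (ev z) \<in> ?J" "square q (od z) \<in> ?J" for z
    using hcomp_in[of z 0] by (auto intro!: base super_relationsI(2) hcomp_in)
  have "commutator br x y \<in> ?J" for x y
    by (rule commutator_in[OF Idl_free_ideal lin comm])
  moreover from this have "square P z \<in> ?J" for z
    by (rule square_in[OF Idl_free_ideal lin _ sq])
  ultimately show "Idl\<^bsub>free_algebra\<^esub> ?R \<subseteq> ?J"
    using lin by (intro Idl_free_minimal[OF Idl_free_ideal]) (auto simp: lie_relations_def)
next
  have "square q y \<in> ?R" if "y \<in> gr 1" for y
    using that by (auto simp: square_def forget_p_odd intro!: exI[of _ y])
  moreover have "square p x \<in> ?R" if "x \<in> gr 0" for x
    using that by (auto simp: square_def forget_p_even intro!: exI[of _ x])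
  ultimately have "?S \<subseteq> ?R"
    by (auto simp: lie_relations_def super_relations_def)
  then show "Idl\<^bsub>free_algebra\<^esub> ?S \<subseteq> Idl\<^bsub>free_algebra\<^esub> ?R"
    by (intro Idl_free_minimal[OF Idl_free_ideal] subsetI Idl_free_base) (rule subsetD)
qed

end

section \<open>The Hopf structure of a restricted enveloping algebra\<close>

lemma (in assoc_algebra) double_char_2:
  assumes "CHAR('k) = 2" "x \<in> carrier A" shows "x \<oplus> x = \<zero>" "\<ominus> x = x"
proof -
  have "(1 + 1 :: 'k) = 0"
    using of_nat_CHAR[where 'a = 'k] assms(1) by simp
  then show *: "x \<oplus> x = \<zero>"
    using smult_add_left[of x 1 1] assms(2) by simp
  show "\<ominus> x = x"
    using assms(2) * by (simp add: minus_equality)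
qed

text \<open>\<^const>\<open>primitive_hopf\<close> only adds structure maps to an algebra. Everything that is built from
  the algebra operations is unchanged, although the record type is not.\<close>

lemma same_operations:
  fixes H :: "('k::field, 'a, 'm) module_scheme" and A :: "('k, 'a, 'n) module_scheme"
  assumes "carrier H = carrier A" "monoid.mult H = monoid.mult A" "one H = one A"
    "zero H = zero A" "add H = add A" "smult H = smult A"
  shows alg_hom_same_source: "\<And>B :: ('k, 'b, 'l) module_scheme. alg_hom H B = alg_hom A B"
    and tensor_prod_same: "tensor_algebra_prod H H = tensor_algebra_prod A A"
    and pure_tensor_same: "pure_tensor H H = pure_tensor A A"
    and opposite_same: "\<And>B :: ('k, 'b, 'l) module_scheme. alg_hom B (opposite_algebra H) = alg_hom B (opposite_algebra A)"
    and parity_same: "parity_algebra H = parity_algebra A"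
    and linear_span_same: "linear_span H = linear_span A"
    and a_inv_same: "a_inv H = a_inv A"
    and words_same: "homogeneous_words H \<iota> gr = homogeneous_words A \<iota> gr"
    and assoc_algebra_same: "assoc_algebra A \<Longrightarrow> assoc_algebra H"
proof -
  show "alg_hom H B = alg_hom A B" for B :: "('k, 'b, 'l) module_scheme"
    by (simp add: alg_hom_def ring_hom_def assms)
  show "alg_hom B (opposite_algebra H) = alg_hom B (opposite_algebra A)" for B :: "('k, 'b, 'l) module_scheme"
    by (simp add: alg_hom_def ring_hom_def assms)
  have rel: "tensor_relations H H = tensor_relations A A"
    by (simp only: tensor_relations_def assms)
  then have cls: "tensor_class H H = tensor_class A A"
    by (intro ext) (simp only: tensor_class_def)
  then show pt: "pure_tensor H H = pure_tensor A A"
    by (intro ext) (simp only: pure_tensor_def)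
  show "tensor_algebra_prod H H = tensor_algebra_prod A A"
    by (simp only: tensor_algebra_prod_def cls pt assms)
  show "parity_algebra H = parity_algebra A"
    by (simp only: parity_algebra_def assms)
  show "linear_span H = linear_span A"
    by (intro ext) (simp add: linear_span_def submodule_def subgroup_def submodule_axioms_def m_inv_def assms)
  show "a_inv H = a_inv A"
    by (intro ext) (simp add: a_inv_def m_inv_def assms)
  show "homogeneous_words H \<iota> gr = homogeneous_words A \<iota> gr"
    by (intro ext) (simp only: homogeneous_words_def assms)
  show "assoc_algebra H" if A: "assoc_algebra A"
    by (rule assoc_algebra_image[OF A, of "\<lambda>x. x"]) (auto intro: alg_homI simp: assms)
qed

locale restricted_enveloping = restricted_graded_lie_algebra scale gr br p
  for scale :: "'k::field \<Rightarrow> 'v::ab_group_add \<Rightarrow> 'v" and gr br p +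
  fixes A :: "('k, 'a) module" and \<pi>
  assumes char_2: "CHAR('k) = 2"
    and presentation: "presents (lie_relations scale br \<union> {square p z | z. True}) A \<pi>"
begin

abbreviation \<iota> :: "'v \<Rightarrow> 'a" where "\<iota> v \<equiv> \<pi> (letter v)"

sublocale A: generated_algebra A \<iota>
  by (rule presents_generated[OF presentation])

lemma is_algebra: "assoc_algebra A"
  by (rule presentsD(1)[OF presentation])

text \<open>The universal property of the restricted enveloping algebra. All structure maps, and the
  grading, come from it.\<close>

lemma enveloping_lift:
  assumes B: "assoc_algebra B" and f: "\<And>v. f v \<in> carrier B"
    and add: "\<And>x y. f (x + y) = f x \<oplus>\<^bsub>B\<^esub> f y" and smult: "\<And>c x. f (scale c x) = c \<odot>\<^bsub>B\<^esub> f x"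
    and comm: "\<And>x y. f x \<otimes>\<^bsub>B\<^esub> f y = f y \<otimes>\<^bsub>B\<^esub> f x \<oplus>\<^bsub>B\<^esub> f (br x y)"
    and sq: "\<And>z. f z \<otimes>\<^bsub>B\<^esub> f z = f (p z)"
  shows "\<exists>h\<in>alg_hom A B. \<forall>v. h (\<iota> v) = f v"
proof -
  interpret B: assoc_algebra B by fact
  note hom = free_lift_hom[OF B f] and letter = free_lift_letter[OF B f]
  note simps = alg_homD[OF hom, simplified] letter f alg_hom_diff[OF assoc_algebra_free B hom, simplified]
  have "free_lift B f r = \<zero>\<^bsub>B\<^esub>" if "r \<in> lie_relations scale br \<union> {square p z | z. True}" for r
  proof -
    have "free_lift B f (letter (x + y) - letter x - letter y) = \<zero>\<^bsub>B\<^esub>" for x y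
      by (simp add: simps add B.add_diff_diff)
    moreover have "free_lift B f (letter (scale c x) - pm_scale c (letter x)) = \<zero>\<^bsub>B\<^esub>" for c x
      by (simp add: simps smult B.diff_self)
    moreover have "free_lift B f (commutator br x y) = \<zero>\<^bsub>B\<^esub>" for x y
      by (simp add: commutator_def simps comm[of x y] B.add_diff_diff)
    moreover have "free_lift B f (square p z) = \<zero>\<^bsub>B\<^esub>" for z
      by (simp add: square_def simps sq B.diff_self)
    ultimately show ?thesis
      using that by (auto simp: lie_relations_def linear_relations_def)
  qed
  from presents_factor[OF presentation B hom this]
  obtain h where h: "h \<in> alg_hom A B" "\<And>t. h (\<pi> t) = free_lift B f t"
    by blast
  show ?thesis
    by (rule bexI[OF _ h(1)]) (simp add: h(2) letter)
qed

lemma \<iota>_relations: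
  "\<iota> (x + y) = \<iota> x \<oplus>\<^bsub>A\<^esub> \<iota> y" "\<iota> (scale c x) = c \<odot>\<^bsub>A\<^esub> \<iota> x"
  "\<iota> x \<otimes>\<^bsub>A\<^esub> \<iota> y = \<iota> y \<otimes>\<^bsub>A\<^esub> \<iota> x \<oplus>\<^bsub>A\<^esub> \<iota> (br x y)" "\<iota> z \<otimes>\<^bsub>A\<^esub> \<iota> z = \<iota> (p z)"
proof -
  note hom = alg_homD[OF presentsD(2)[OF presentation], simplified]
  have eq: "\<pi> s = \<pi> t" if "s - t \<in> lie_relations scale br \<union> {square p z | z. True}" for s t
    unfolding presents_eq_iff[OF presentation] using that by (rule Idl_free_base)
  have "\<pi> (letter (x + y)) = \<pi> (letter x + letter y)"
    by (rule eq) (auto simp: lie_relations_def linear_relations_def diff_diff_eq[symmetric])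
  then show "\<iota> (x + y) = \<iota> x \<oplus>\<^bsub>A\<^esub> \<iota> y"
    by (simp add: hom)
  have "\<pi> (letter (scale c x)) = \<pi> (pm_scale c (letter x))"
    by (rule eq) (auto simp: lie_relations_def linear_relations_def)
  then show "\<iota> (scale c x) = c \<odot>\<^bsub>A\<^esub> \<iota> x"
    by (simp add: hom)
  have "\<pi> (letter x * letter y) = \<pi> (letter y * letter x + letter (br x y))"
    by (rule eq) (auto simp: lie_relations_def commutator_def diff_diff_eq[symmetric])
  then show "\<iota> x \<otimes>\<^bsub>A\<^esub> \<iota> y = \<iota> y \<otimes>\<^bsub>A\<^esub> \<iota> x \<oplus>\<^bsub>A\<^esub> \<iota> (br x y)"
    by (simp add: hom)
  have "\<pi> (letter z * letter z) = \<pi> (letter (p z))"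
    by (rule eq) (auto simp: square_def)
  then show "\<iota> z \<otimes>\<^bsub>A\<^esub> \<iota> z = \<iota> (p z)"
    by (simp add: hom)
qed

lemma \<iota>_zero: "\<iota> 0 = \<zero>\<^bsub>A\<^esub>"
  using \<iota>_relations(2)[of 0 0] by simp

sublocale AA: algebra_pair A A
  by (rule algebra_pairI[OF is_algebra is_algebra])

text \<open>The product of the values at \<open>x\<close> and \<open>y\<close> contains the mixed terms
  \<open>x \<otimes> y + y \<otimes> x\<close>. They are symmetric, so they drop out of commutators, and for \<open>x = y\<close> they
  vanish in characteristic 2.\<close>

lemma comult_exists:
  "\<exists>h\<in>alg_hom A AA.AB. \<forall>v. h (\<iota> v) = pure_tensor A A (\<iota> v) \<one>\<^bsub>A\<^esub> \<oplus>\<^bsub>AA.AB\<^esub> pure_tensor A A \<one>\<^bsub>A\<^esub> (\<iota> v)"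
proof (rule enveloping_lift[OF AA.assoc_algebra_tensor])
  note pure = bilinear_onD[OF AA.pure_tensor_bilinear]
  note double = AA.AB.double_char_2(1)[OF char_2]
  let ?f = "\<lambda>v. pure_tensor A A (\<iota> v) \<one>\<^bsub>A\<^esub> \<oplus>\<^bsub>AA.AB\<^esub> pure_tensor A A \<one>\<^bsub>A\<^esub> (\<iota> v)"
  show "?f v \<in> carrier AA.AB" for v
    by simp
  show "?f (x + y) = ?f x \<oplus>\<^bsub>AA.AB\<^esub> ?f y" for x y
    by (simp add: \<iota>_relations(1) pure AA.AB.a_ac)
  show "?f (scale c x) = c \<odot>\<^bsub>AA.AB\<^esub> ?f x" for c x
    by (simp add: \<iota>_relations(2) pure AA.AB.smult_add_right)
  have mult: "?f x \<otimes>\<^bsub>AA.AB\<^esub> ?f y =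
      (pure_tensor A A (\<iota> x \<otimes>\<^bsub>A\<^esub> \<iota> y) \<one>\<^bsub>A\<^esub> \<oplus>\<^bsub>AA.AB\<^esub> pure_tensor A A \<one>\<^bsub>A\<^esub> (\<iota> x \<otimes>\<^bsub>A\<^esub> \<iota> y)) \<oplus>\<^bsub>AA.AB\<^esub>
      (pure_tensor A A (\<iota> x) (\<iota> y) \<oplus>\<^bsub>AA.AB\<^esub> pure_tensor A A (\<iota> y) (\<iota> x))" for x y
    by (simp add: AA.AB.l_distr AA.AB.r_distr AA.pure_tensor_mult AA.AB.a_ac)
  show "?f x \<otimes>\<^bsub>AA.AB\<^esub> ?f y = ?f y \<otimes>\<^bsub>AA.AB\<^esub> ?f x \<oplus>\<^bsub>AA.AB\<^esub> ?f (br x y)" for x y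
    unfolding mult \<iota>_relations(3)[of x y] by (simp add: pure AA.AB.a_ac)
  show "?f z \<otimes>\<^bsub>AA.AB\<^esub> ?f z = ?f (p z)" for z
    unfolding mult \<iota>_relations(4)[of z] by (simp add: double)
qed

lemma counit_exists: "\<exists>h\<in>alg_hom A (ground_algebra :: ('k, 'k) module). \<forall>v. h (\<iota> v) = 0"
  by (rule enveloping_lift[OF assoc_algebra_ground]) (simp_all add: ground_algebra_def)

text \<open>In characteristic 2 the antipode fixes the generators, and the commutator relation reads the
  same in the opposite algebra.\<close>

lemma antipode_exists: "\<exists>h\<in>alg_hom A (opposite_algebra A). \<forall>v. h (\<iota> v) = \<ominus>\<^bsub>A\<^esub> \<iota> v"
proof -
  have comm: "\<iota> y \<otimes>\<^bsub>A\<^esub> \<iota> x = \<iota> x \<otimes>\<^bsub>A\<^esub> \<iota> y \<oplus>\<^bsub>A\<^esub> \<iota> (br x y)" for x y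
    unfolding \<iota>_relations(3)[of x y]
    by (simp add: A.a_assoc A.double_char_2(1)[OF char_2])
  show ?thesis
    unfolding A.double_char_2(2)[OF char_2 A.gen_closed]
    by (rule enveloping_lift[OF assoc_algebra_opposite[OF is_algebra]]) (simp_all add: \<iota>_relations(1,2,4) comm[symmetric])
qed

text \<open>The relations are homogeneous for the grading of the Lie algebra: the bracket adds degrees,
  the 2-operation doubles them, and in the square of \<open>a + b \<epsilon>\<close> the coefficient of \<open>\<epsilon>\<close> is
  \<open>a b + b a\<close>, which is a bracket in characteristic 2.\<close>

lemma parity_exists:
  "\<exists>h\<in>alg_hom A (parity_algebra A). \<forall>v. h (\<iota> v) = (\<iota> (hcomp gr v 0), \<iota> (hcomp gr v 1))"
proof (rule enveloping_lift[OF assoc_algebra_parity[OF is_algebra]])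
  let ?f = "\<lambda>v. (\<iota> (hcomp gr v 0), \<iota> (hcomp gr v 1))" and ?B = "parity_algebra A"
  note split = hcomp_sum[symmetric]
  have br_add: "br (x + y) z = br x z + br y z" "br x (y + z) = br x y + br x z" for x y z
    using br_linear_left br_linear_right by (simp_all add: Vector_Spaces.linear_iff)
  show "?f v \<in> carrier ?B" for v
    by simp
  show "?f (x + y) = ?f x \<oplus>\<^bsub>?B\<^esub> ?f y" for x y
    by (simp add: hcomp_add \<iota>_relations(1))
  show "?f (scale c x) = c \<odot>\<^bsub>?B\<^esub> ?f x" for c x
    by (simp add: hcomp_scale \<iota>_relations(2))
  show "?f x \<otimes>\<^bsub>?B\<^esub> ?f y = ?f y \<otimes>\<^bsub>?B\<^esub> ?f x \<oplus>\<^bsub>?B\<^esub> ?f (br x y)" for x y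
  proof -
    define x0 x1 y0 y1 where defs: "x0 = hcomp gr x 0" "x1 = hcomp gr x 1" "y0 = hcomp gr y 0" "y1 = hcomp gr y 1"
    have mem: "x0 \<in> gr 0" "x1 \<in> gr 1" "y0 \<in> gr 0" "y1 \<in> gr 1"
      unfolding defs by (rule hcomp_in)+
    have "br x y = br (x0 + x1) (y0 + y1)"
      unfolding defs by (simp only: split)
    then have br: "br x y = (br x0 y0 + br x1 y1) + (br x0 y1 + br x1 y0)"
      by (simp only: br_add add_ac)
    have "br x0 y0 + br x1 y1 \<in> gr 0" "br x0 y1 + br x1 y0 \<in> gr 1"
      using br_graded[OF mem(1,3)] br_graded[OF mem(2,4)] br_graded[OF mem(1,4)] br_graded[OF mem(2,3)]
      by (auto intro: gr_add)
    from hcomp_eqI[OF this] have "hcomp gr (br x y) 0 = br x0 y0 + br x1 y1" "hcomp gr (br x y) 1 = br x0 y1 + br x1 y0"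
      unfolding br by auto
    then show ?thesis
      unfolding defs[symmetric]
      by (simp add: \<iota>_relations(1) \<iota>_relations(3)[of x0 y0] \<iota>_relations(3)[of x1 y1]
          \<iota>_relations(3)[of x0 y1] \<iota>_relations(3)[of x1 y0] A.a_ac)
  qed
  show "?f z \<otimes>\<^bsub>?B\<^esub> ?f z = ?f (p z)" for z
  proof -
    define z0 z1 where defs: "z0 = hcomp gr z 0" "z1 = hcomp gr z 1"
    have mem: "z0 \<in> gr 0" "z1 \<in> gr 1"
      unfolding defs by (rule hcomp_in)+
    have "p z = p (z0 + z1)"
      unfolding defs by (simp only: split)
    then have pz: "p z = (p z0 + p z1) + br z1 z0"
      by (simp only: p_add)
    have "p z0 + p z1 \<in> gr 0" "br z1 z0 \<in> gr 1"
      using p_graded[OF mem(1)] p_graded[OF mem(2)] br_graded[OF mem(2,1)] by (auto intro: gr_add)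
    from hcomp_eqI[OF this] have "hcomp gr (p z) 0 = p z0 + p z1" "hcomp gr (p z) 1 = br z1 z0"
      unfolding pz by auto
    moreover have "\<iota> z0 \<otimes>\<^bsub>A\<^esub> \<iota> z1 \<oplus>\<^bsub>A\<^esub> \<iota> z1 \<otimes>\<^bsub>A\<^esub> \<iota> z0 = \<iota> (br z1 z0)"
      unfolding \<iota>_relations(3)[of z1 z0]
      by (simp add: A.double_char_2(1)[OF char_2] flip: A.a_assoc)
    ultimately show ?thesis
      unfolding defs[symmetric] by (simp add: \<iota>_relations(1,4))
  qed
qed

text \<open>The structure maps of \<^const>\<open>primitive_hopf\<close> are definite descriptions. Uniqueness holds
  because \<open>A\<close> is generated by \<open>\<iota>\<close>.\<close>

lemma primitive_hopf_maps:
  defines "H \<equiv> primitive_hopf A \<iota> gr"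
  shows "comult H \<in> alg_hom A AA.AB"
    "comult H (\<iota> v) = pure_tensor A A (\<iota> v) \<one>\<^bsub>A\<^esub> \<oplus>\<^bsub>AA.AB\<^esub> pure_tensor A A \<one>\<^bsub>A\<^esub> (\<iota> v)"
    "counit H \<in> alg_hom A ground_algebra" "counit H (\<iota> v) = 0"
    "antipode H \<in> alg_hom A (opposite_algebra A)" "antipode H (\<iota> v) = \<ominus>\<^bsub>A\<^esub> \<iota> v"
proof -
  have ex: "\<exists>!h. h \<in> extensional (carrier A) \<and> h \<in> alg_hom A B \<and> (\<forall>v. h (\<iota> v) = f v)"
    if some: "\<exists>h\<in>alg_hom A B. \<forall>v. h (\<iota> v) = f v" for f and B :: "('k, 'c) module"
  proof -
    obtain h where h: "h \<in> alg_hom A B" "\<forall>v. h (\<iota> v) = f v"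
      using some by blast
    have "restrict h (carrier A) \<in> alg_hom A B"
      by (rule alg_hom_cong[OF is_algebra h(1)]) simp
    then show ?thesis
      using h(2) by (intro ex1I[of _ "restrict h (carrier A)"]) (auto intro!: A.generated_hom_unique)
  qed
  have "comult H \<in> extensional (carrier A) \<and> comult H \<in> alg_hom A AA.AB \<and> (\<forall>v. comult H (\<iota> v) =
      pure_tensor A A (\<iota> v) \<one>\<^bsub>A\<^esub> \<oplus>\<^bsub>AA.AB\<^esub> pure_tensor A A \<one>\<^bsub>A\<^esub> (\<iota> v))"
    unfolding H_def primitive_hopf_def hopf.simps by (rule theI'[OF ex[OF comult_exists]])
  then show "comult H \<in> alg_hom A AA.AB"
    "comult H (\<iota> v) = pure_tensor A A (\<iota> v) \<one>\<^bsub>A\<^esub> \<oplus>\<^bsub>AA.AB\<^esub> pure_tensor A A \<one>\<^bsub>A\<^esub> (\<iota> v)"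
    by auto
  have "counit H \<in> extensional (carrier A) \<and> counit H \<in> alg_hom A ground_algebra \<and> (\<forall>v. counit H (\<iota> v) = 0)"
    unfolding H_def primitive_hopf_def hopf.simps by (rule theI'[OF ex[OF counit_exists]])
  then show "counit H \<in> alg_hom A ground_algebra" "counit H (\<iota> v) = 0"
    by auto
  have "antipode H \<in> extensional (carrier A) \<and> antipode H \<in> alg_hom A (opposite_algebra A) \<and>
      (\<forall>v. antipode H (\<iota> v) = \<ominus>\<^bsub>A\<^esub> \<iota> v)"
    unfolding H_def primitive_hopf_def hopf.simps by (rule theI'[OF ex[OF antipode_exists]])
  then show "antipode H \<in> alg_hom A (opposite_algebra A)" "antipode H (\<iota> v) = \<ominus>\<^bsub>A\<^esub> \<iota> v"
    by auto
qed

theorem primitively_generated: "primitively_generated (primitive_hopf A \<iota> gr) \<iota> scale gr"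
proof -
  let ?H = "primitive_hopf A \<iota> gr"
  have ops: "carrier ?H = carrier A" "monoid.mult ?H = monoid.mult A" "one ?H = one A"
    "zero ?H = zero A" "add ?H = add A" "smult ?H = smult A"
    by (simp_all add: primitive_hopf_def)
  note same = same_operations[OF ops]
  show ?thesis
  proof (intro primitively_generated.intro generated_algebra.intro generated_algebra_axioms.intro
      primitively_generated_axioms.intro; (unfold same ops)?)
    show "assoc_algebra ?H"
      by (rule assoc_algebra_same[OF ops is_algebra])
    show "graded_vector_space scale gr"
      by unfold_locales
    show "carrier A = linear_span A (range (word A \<iota>))"
      by (rule A.generated)
    show "grade ?H i = linear_span A (homogeneous_words A \<iota> gr i)" for i
      by (simp add: primitive_hopf_def homogeneous_words_def)
    obtain h where h: "h \<in> alg_hom A (parity_algebra A)"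
        "\<And>v. h (\<iota> v) = (\<iota> (hcomp gr v 0), \<iota> (hcomp gr v 1))"
      using parity_exists by blast
    show "\<exists>\<psi>\<in>alg_hom A (parity_algebra A).
        (\<forall>x\<in>gr 0. \<psi> (\<iota> x) = (\<iota> x, \<zero>\<^bsub>A\<^esub>)) \<and> (\<forall>x\<in>gr 1. \<psi> (\<iota> x) = (\<zero>\<^bsub>A\<^esub>, \<iota> x))"
      by (rule bexI[OF _ h(1)]) (simp add: h(2) hcomp_even hcomp_odd \<iota>_zero)
  qed (rule primitive_hopf_maps \<iota>_relations(1) A.gen_closed)+
qed

end


section \<open>Comparison of the two restricted enveloping algebras\<close>

text \<open>A homomorphism that matches the generators respects all of the Hopf structure, since the
  structure maps are determined by their values on generators.\<close>

lemma primitively_generated_hom: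
  assumes H: "primitively_generated H \<iota> scale gr" and K: "primitively_generated K \<kappa> scale gr"
    and \<phi>: "\<phi> \<in> alg_hom H K" and gen: "\<And>v. \<phi> (\<iota> v) = \<kappa> v"
  shows "\<phi> \<in> hopf_superalgebra_hom H K"
proof -
  interpret H: primitively_generated H \<iota> scale gr by (rule H)
  interpret K: primitively_generated K \<kappa> scale gr by (rule K)
  note \<phi>' = alg_homD[OF \<phi>]
  note map = tensor_map_hom[OF H.is_algebra H.is_algebra K.is_algebra K.is_algebra \<phi> \<phi>] and map_pure = tensor_map_pure[OF H.is_algebra H.is_algebra K.is_algebra K.is_algebra \<phi> \<phi>]
  have "tensor_map K K \<phi> \<phi> (comult H x) = comult K (\<phi> x)" if "x \<in> carrier H" for x
    by (rule H.generated_hom_eqI[OF alg_hom_comp[OF H.comult_alg_hom map] alg_hom_comp[OF \<phi> K.comult_alg_hom] _ that])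
      (simp add: H.comult_gen K.comult_gen gen alg_homD[OF map] map_pure \<phi>'(4))
  moreover have "counit K (\<phi> x) = counit H x" if "x \<in> carrier H" for x
    by (rule H.generated_hom_eqI[OF alg_hom_comp[OF \<phi> K.counit_alg_hom] H.counit_alg_hom _ that])
      (simp add: H.counit_gen K.counit_gen gen)
  moreover have "\<phi> (antipode H x) = antipode K (\<phi> x)" if "x \<in> carrier H" for x
  proof -
    have "\<phi> \<in> alg_hom (opposite_algebra H) (opposite_algebra K)"
      by (rule alg_homI) (simp_all add: \<phi>')
    from H.generated_hom_eqI[OF alg_hom_comp[OF H.antipode_alg_hom this] alg_hom_comp[OF \<phi> K.antipode_alg_hom] _ that]
    show ?thesis
      by (simp add: H.antipode_gen K.antipode_gen gen alg_hom_minus[OF H.is_algebra K.is_algebra \<phi>])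
  qed
  moreover have "\<phi> x \<in> grade K i" if x: "x \<in> grade H i" for i x
    using x
  proof (induction x rule: H.grade_induct)
    case (word x)
    then have "\<phi> x \<in> homogeneous_words K \<kappa> gr i"
    proof (induction rule: H.homogeneous_words_induct)
      case Nil
      show ?case
        using K.homogeneous_words_one by (simp add: \<phi>')
    next
      case (Cons v d w i)
      then have "w \<in> carrier H"
        using H.homogeneous_words_closed by blast
      then show ?case
        using K.homogeneous_words_mult[OF K.homogeneous_words_gen[of v gr d] Cons.IH] Cons.hyps(1)
        by (simp add: \<phi>' gen)
    qed
    then show ?case
      unfolding K.grade_eq by (rule K.linear_span_base)
  qed (simp_all add: \<phi>' alg_hom_zero[OF H.is_algebra K.is_algebra \<phi>] K.grade_add K.grade_smult K.grade_zero)
  ultimately show ?thesis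
    using \<phi> by (auto simp: hopf_superalgebra_hom_def)
qed

lemma presents_same_ideal:
  assumes "presents R A \<pi>" "Idl\<^bsub>free_algebra\<^esub> R = Idl\<^bsub>free_algebra\<^esub> S"
  shows "presents S A \<pi>"
  using assms by (simp add: presents_def)

lemma presents_iso:
  assumes A: "presents R A \<pi>" and B: "presents R B \<rho>"
  shows "\<exists>\<phi>\<in>alg_hom A B. bij_betw \<phi> (carrier A) (carrier B) \<and> (\<forall>t. \<phi> (\<pi> t) = \<rho> t)"
proof -
  have "\<rho> r = \<zero>\<^bsub>B\<^esub>" if "r \<in> R" for r
    using Idl_free_base[OF that] by (simp add: presentsD(4)[OF B])
  from presents_factor[OF A presentsD(1,2)[OF B] this]
  obtain \<phi> where \<phi>: "\<phi> \<in> alg_hom A B" "\<And>t. \<phi> (\<pi> t) = \<rho> t"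
    by blast
  have "inj_on \<phi> (carrier A)"
    unfolding presentsD(3)[OF A, symmetric] inj_on_def
    by (auto simp: \<phi>(2) presents_eq_iff[OF A] presents_eq_iff[OF B])
  moreover have "\<phi> ` carrier A = carrier B"
    unfolding presentsD(3)[OF A, symmetric] presentsD(3)[OF B, symmetric] image_image \<phi>(2) ..
  ultimately show ?thesis
    using \<phi> by (auto simp: bij_betw_def)
qed

context char_2_superalgebra
begin

text \<open>On classes of words the canonical map is what its name suggests, because the commutator
  relations for arbitrary elements hold in the superalgebra case; so the definite element in
  \<^const>\<open>U_proj\<close> exists.\<close>

lemma U_proj_class:
  "U_proj scale gr br q (lie_U_proj scale br t) = super_U_proj scale gr br q t"
proof -
  let ?I = "lie_ideal scale br" and ?T = "tensor_algebra scale" and ?i = "\<lambda>t. tensor_ideal scale +>\<^bsub>free_algebra\<^esub> t"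
  note T = presentsD[OF presents_tensor_algebra[of scale]]
  interpret T: assoc_algebra ?T
    by (rule T(1))
  have "{commutator_relation scale br x y | x y. True} \<subseteq> carrier ?T"
    using T(3) by (auto simp: commutator_relation_eq)
  then interpret I: ideal ?I ?T
    unfolding lie_ideal_def by (rule ring.genideal_ideal[OF T.ring])
  have closed: "?i t \<in> carrier ?T" for t
    using T(3) by blast
  have sub: "Idl\<^bsub>free_algebra\<^esub> (lie_relations scale br) \<subseteq> Idl\<^bsub>free_algebra\<^esub> (super_relations scale gr br q)"
  proof (rule Idl_free_minimal[OF Idl_free_ideal])
    have lin: "linear_relations scale \<subseteq> Idl\<^bsub>free_algebra\<^esub> (super_relations scale gr br q)"
      by (auto simp: super_relations_def intro!: Idl_free_base)
    moreover have "commutator br x y \<in> Idl\<^bsub>free_algebra\<^esub> (super_relations scale gr br q)" for x y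
      by (rule commutator_in[OF Idl_free_ideal lin]) (rule Idl_free_base, rule super_relationsI(1))
    ultimately show "lie_relations scale br \<subseteq> Idl\<^bsub>free_algebra\<^esub> (super_relations scale gr br q)"
      by (auto simp: lie_relations_def)
  qed
  have "super_ideal scale gr br q +>\<^bsub>?T\<^esub> u = super_U_proj scale gr br q t" if u: "u \<in> lie_U_proj scale br t" for u
  proof -
    have "u \<in> carrier ?T"
      using u closed[of t] I.a_elemrcos_carrier by blast
    then obtain s where s: "u = ?i s"
      unfolding T(3)[symmetric] by (elim rangeE)
    have "lie_U_proj scale br s = lie_U_proj scale br t"
      using u closed s I.a_repr_independence' by metis
    then have "s - t \<in> Idl\<^bsub>free_algebra\<^esub> (super_relations scale gr br q)"
      using sub by (auto simp: presents_eq_iff[OF presents_lie_U])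
    then show ?thesis
      by (simp add: s presents_eq_iff[OF presents_super_U])
  qed
  moreover have "?i t \<in> lie_U_proj scale br t"
    by (rule I.a_rcos_self[OF closed])
  ultimately have "(\<lambda>u. super_ideal scale gr br q +>\<^bsub>?T\<^esub> u) ` lie_U_proj scale br t = {super_U_proj scale gr br q t}"
    by blast
  then show ?thesis
    by (simp add: U_proj_def)
qed

lemma U_proj_hom: "U_proj scale gr br q \<in> alg_hom (lie_U scale br) (super_U scale gr br q)"
proof (rule alg_homI)
  note L = presentsD[OF presents_lie_U[of scale br]] and S = presentsD[OF presents_super_U[of scale gr br q]]
  note l = alg_homD(2,3,5)[OF L(2), simplified, symmetric] and s = alg_homD[OF S(2), simplified]
  fix X Y c assume "X \<in> carrier (lie_U scale br)" "Y \<in> carrier (lie_U scale br)"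
  then obtain x y where xy: "X = lie_U_proj scale br x" "Y = lie_U_proj scale br y"
    unfolding L(3)[symmetric] by (elim rangeE)
  show "U_proj scale gr br q X \<in> carrier (super_U scale gr br q)"
    and "U_proj scale gr br q (X \<otimes>\<^bsub>lie_U scale br\<^esub> Y) =
      U_proj scale gr br q X \<otimes>\<^bsub>super_U scale gr br q\<^esub> U_proj scale gr br q Y"
    and "U_proj scale gr br q (X \<oplus>\<^bsub>lie_U scale br\<^esub> Y) =
      U_proj scale gr br q X \<oplus>\<^bsub>super_U scale gr br q\<^esub> U_proj scale gr br q Y"
    and "U_proj scale gr br q (c \<odot>\<^bsub>lie_U scale br\<^esub> X) = c \<odot>\<^bsub>super_U scale gr br q\<^esub> U_proj scale gr br q X"
    unfolding xy by (simp_all only: l U_proj_class s)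
next
  note l = alg_homD(4)[OF presentsD(2)[OF presents_lie_U[of scale br]], simplified, symmetric]
    and s = alg_homD(4)[OF presentsD(2)[OF presents_super_U[of scale gr br q]], simplified]
  show "U_proj scale gr br q \<one>\<^bsub>lie_U scale br\<^esub> = \<one>\<^bsub>super_U scale gr br q\<^esub>"
    by (simp only: l U_proj_class s)
qed

lemma U_proj_surj: "U_proj scale gr br q ` carrier (lie_U scale br) = carrier (super_U scale gr br q)"
  unfolding presentsD(3)[OF presents_lie_U, symmetric] presentsD(3)[OF presents_super_U, symmetric]
    image_image U_proj_class ..

text \<open>Both restricted enveloping algebras are presented by the same ideal of the free algebra. The
  second, too, is therefore a restricted enveloping algebra of the underlying Lie algebra, from which
  it gets its Hopf structure.\<close>

lemma V_iso:
  "\<exists>\<phi> \<in> hopf_superalgebra_iso (lie_V scale gr br P) (super_V scale gr br q p).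
     \<forall>u \<in> carrier (lie_U scale br).
       \<phi> (lie_V_ideal scale br P +>\<^bsub>lie_U scale br\<^esub> u) =
       super_V_ideal scale gr br q p +>\<^bsub>super_U scale gr br q\<^esub> U_proj scale gr br q u"
proof -
  let ?A = "quotient_algebra (lie_U scale br) (lie_V_ideal scale br P)"
    and ?B = "quotient_algebra (super_U scale gr br q) (super_V_ideal scale gr br q p)"
    and ?\<pi> = "\<lambda>t. lie_V_ideal scale br P +>\<^bsub>lie_U scale br\<^esub> lie_U_proj scale br t"
    and ?\<rho> = "\<lambda>t. super_V_ideal scale gr br q p +>\<^bsub>super_U scale gr br q\<^esub> super_U_proj scale gr br q t"
  note A = presents_lie_V[of scale br P]
  note B = presents_same_ideal[OF presents_super_V[of scale gr br q p] Idl_relations_eq[symmetric]]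
  have V: "restricted_enveloping scale gr br P ?A ?\<pi>" "restricted_enveloping scale gr br P ?B ?\<rho>"
    by (intro restricted_enveloping.intro restricted_enveloping_axioms.intro restricted_graded_lie_algebra char_2 A B)+
  have H: "primitively_generated (lie_V scale gr br P) (\<lambda>v. ?\<pi> (letter v)) scale gr"
    and K: "primitively_generated (super_V scale gr br q p) (\<lambda>v. ?\<rho> (letter v)) scale gr"
    using restricted_enveloping.primitively_generated[OF V(1)] restricted_enveloping.primitively_generated[OF V(2)]
    by (simp_all add: lie_V_def super_V_def lie_U_incl_def super_U_incl_def tensor_incl_def)
  obtain \<phi> where \<phi>: "\<phi> \<in> alg_hom ?A ?B" "bij_betw \<phi> (carrier ?A) (carrier ?B)" "\<And>t. \<phi> (?\<pi> t) = ?\<rho> t"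
    using presents_iso[OF A B] by blast
  have "\<phi> \<in> alg_hom (lie_V scale gr br P) (super_V scale gr br q p)"
    using \<phi>(1) by (simp add: lie_V_def super_V_def primitive_hopf_def alg_hom_def ring_hom_def)
  then have "\<phi> \<in> hopf_superalgebra_hom (lie_V scale gr br P) (super_V scale gr br q p)"
    by (rule primitively_generated_hom[OF H K]) (rule \<phi>(3))
  then have "\<phi> \<in> hopf_superalgebra_iso (lie_V scale gr br P) (super_V scale gr br q p)"
    using \<phi>(2) primitively_generated.hopf_superalgebra[OF H] primitively_generated.hopf_superalgebra[OF K]
    by (simp add: hopf_superalgebra_iso_def) (simp add: lie_V_def super_V_def primitive_hopf_def)
  moreover have "\<phi> (lie_V_ideal scale br P +>\<^bsub>lie_U scale br\<^esub> u) =
      super_V_ideal scale gr br q p +>\<^bsub>super_U scale gr br q\<^esub> U_proj scale gr br q u"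
    if u: "u \<in> carrier (lie_U scale br)" for u
  proof -
    obtain t where "u = lie_U_proj scale br t"
      using u unfolding presentsD(3)[OF presents_lie_U[of scale br], symmetric] by (elim rangeE)
    then show ?thesis
      by (simp only: \<phi>(3) U_proj_class)
  qed
  ultimately show ?thesis
    by blast
qed

end

theorem lemma2p14:
  fixes scale :: "'k::field \<Rightarrow> 'v::ab_group_add \<Rightarrow> 'v"
    and gr :: "bit \<Rightarrow> 'v set"
    and br :: "'v \<Rightarrow> 'v \<Rightarrow> 'v"
    and q p :: "'v \<Rightarrow> 'v"
  assumes "CHAR('k) = 2"
    and "restricted_lie_superalgebra scale gr br q p"
  shows "restricted_graded_lie_algebra scale gr br (forget_p gr br q p) \<and>
    U_proj scale gr br q \<in> alg_hom (lie_U scale br) (super_U scale gr br q) \<and>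
    U_proj scale gr br q ` carrier (lie_U scale br) = carrier (super_U scale gr br q) \<and>
    (\<exists>\<phi> \<in> hopf_superalgebra_iso (lie_V scale gr br (forget_p gr br q p)) (super_V scale gr br q p).
       \<forall>u \<in> carrier (lie_U scale br).
         \<phi> (lie_V_ideal scale br (forget_p gr br q p) +>\<^bsub>lie_U scale br\<^esub> u) =
         super_V_ideal scale gr br q p +>\<^bsub>super_U scale gr br q\<^esub> U_proj scale gr br q u)"
proof -
  interpret char_2_superalgebra scale gr br q p
    by (intro char_2_superalgebra.intro char_2_superalgebra_axioms.intro assms)
  show ?thesis
    by (intro conjI restricted_graded_lie_algebra U_proj_hom U_proj_surj V_iso)
qed

end
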